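(* Let $p$ be a prime, $G$ the Vilenkin group associated with $p$, and $G^*$ its dual group. A measurable set $S\subset G^*$ is a generalized scaling set if and only if the following conditions hold: (i) $\mu^*(S)=\frac{1}{p-1}$; (ii) $S\subset BS$ modulo null sets; (iii) $\lim_{k\to\infty}1_S(B^{-k}\omega)=1$ for a.e. $\omega\in G^*$; (iv) $\sum_{\sigma=0}^{p-1}\eta(\omega\oplus 0.\sigma)=\eta(B\omega)+1$ for a.e. $\omega \in G^*$, where $\eta(\omega)=\sum_{h\in H^\perp}1_S(\omega\oplus h)$.
   Context: Vilenkin group: for a prime $p$, $G$ is the group of sequences $x=(x_j)_{j\in\mathbb{Z}}$ with $x_j\in\{0,\dots,p-1\}$ and $x_j=0$ for all $j<k(x)$, under coordinatewise addition mod $p$, denoted $\oplus$ (inverse operation $\ominus$); identity $\theta$. A basis of neighbourhoods of $\theta$ is $U_l=\{x\in G: x_j=0 \text{ for } j\le l\}$, $l\in\mathbb{Z}$; $U=U_0$; Haar measure $\mu$ is normalized by $\mu(U)=1$. The dual group $G^*$ consists of sequences $\omega=(\omega_j)_{j\in\mathbb{Z}}$ of the same form, with the same operations, neighbourhoods $U_l^*$, $U^*=U_0^*=\{\omega : \omega_j=0 \text{ for } j\le 0\}$, and Haar measure $\mu^*$ with $\mu^*(U^* )=1$. The pairing is $\chi(x,\omega)=\exp\big(\frac{2\pi i}{p}\sum_{j\in\mathbb{Z}}x_j\omega_{1-j}\big)$. $H=\{x\in G: x_j=0 \text{ for } j>0\}$; its annihilator is $H^\perp=\{\omega\in G^*:\omega_j=0\text{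 for }j>0\}$. $A\in\mathrm{Aut}(G)$, $(Ax)_j=x_{j+1}$; $B\in\mathrm{Aut}(G^* )$, $(B\omega)_j=\omega_{j+1}$. For $\sigma\in\{0,\dots,p-1\}$, $0.\sigma$ denotes the element of $G^*$ whose coordinate with index $1$ is $\sigma$ and whose other coordinates are $0$. A function $\psi\in L^2(G)$ is a wavelet if $\{p^{j/2}\psi(A^jx\ominus h): j\in\mathbb{Z},h\in H\}$ is an orthonormal basis of $L^2(G)$. A measurable $\Omega\subset G^*$ is a wavelet set if $\psi=\check{1}_\Omega$ (the inverse Fourier transform of the characteristic function of $\Omega$) is a wavelet in $L^2(G)$. A measurable $S\subset G^*$ is a generalized scaling set if $\mu^*(S)=\frac{1}{p-1}$ and $BS\setminus S$ is a wavelet set. *)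

theory Defs
  imports "HOL-Probability.Probability" "HOL-Computational_Algebra.Primes"
begin

section \<open>The Vilenkin group and its Haar measure\<close>

text \<open>
  The dual group consists of the same sequences, with the same operations and neighbourhoods, as the
  group itself; the pairing is \<open>vchar\<close> below.  Hence \<open>vilenkin p\<close>, its operations, the subgroup
  \<open>vH p\<close>, the shift \<open>vshift\<close> and the measure \<open>vhaar p\<close> serve for both \<open>G\<close> and \<open>G\<^sup>*\<close>
  (in particular \<open>vH p\<close> is both \<open>H\<close> and its annihilator, and \<open>vshift 1\<close> is both \<open>A\<close> and \<open>B\<close>).
\<close>

definition vilenkin :: "nat \<Rightarrow> (int \<Rightarrow> int) set" where
  "vilenkin p = {x. (\<forall>j. x j \<in> {0..<int p}) \<and> (\<exists>k. \<forall>j<k. x j = 0)}"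

definition vadd :: "nat \<Rightarrow> (int \<Rightarrow> int) \<Rightarrow> (int \<Rightarrow> int) \<Rightarrow> (int \<Rightarrow> int)" where
  "vadd p x y = (\<lambda>j. (x j + y j) mod int p)"

definition vsub :: "nat \<Rightarrow> (int \<Rightarrow> int) \<Rightarrow> (int \<Rightarrow> int) \<Rightarrow> (int \<Rightarrow> int)" where
  "vsub p x y = (\<lambda>j. (x j - y j) mod int p)"

definition vnbhd :: "nat \<Rightarrow> int \<Rightarrow> (int \<Rightarrow> int) set" where
  "vnbhd p l = {x \<in> vilenkin p. \<forall>j\<le>l. x j = 0}"

definition vtop :: "nat \<Rightarrow> (int \<Rightarrow> int) topology" where
  "vtop p = topology_generated_by {vadd p x ` vnbhd p l | x l. x \<in> vilenkin p}"

definition vborel :: "nat \<Rightarrow> (int \<Rightarrow> int) measure" where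
  "vborel p = sigma (vilenkin p) {V. openin (vtop p) V}"

text \<open>
  Local finiteness and regularity need not be demanded: the first follows from the normalization,
  the second is automatic on a second countable locally compact space.
\<close>

definition is_vhaar :: "nat \<Rightarrow> (int \<Rightarrow> int) measure \<Rightarrow> bool" where
  "is_vhaar p M \<longleftrightarrow>
     sets M = sets (vborel p) \<and>
     (\<forall>x\<in>vilenkin p. \<forall>E\<in>sets M. emeasure M (vadd p x ` E) = emeasure M E) \<and>
     emeasure M (vnbhd p 0) = 1"

text \<open>
  Completed, so that ``measurable'' includes all subsets of Borel null sets, as for \<open>lebesgue\<close>.
  Existence and uniqueness of the described measure are proved below (\<open>ex1_vhaar\<close>).
\<close>

definition vhaar :: "nat \<Rightarrow> (int \<Rightarrow> int) measure" where
  "vhaar p = completion (THE M. is_vhaar p M)"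

definition vH :: "nat \<Rightarrow> (int \<Rightarrow> int) set" where
  "vH p = {x \<in> vilenkin p. \<forall>j>0. x j = 0}"

text \<open>\<open>vshift k\<close> is the \<open>k\<close>-th power of the automorphism \<open>(Ax)\<^sub>j = x\<^sub>j\<^sub>+\<^sub>1\<close>, for any integer \<open>k\<close>.\<close>

definition vshift :: "int \<Rightarrow> (int \<Rightarrow> int) \<Rightarrow> (int \<Rightarrow> int)" where
  "vshift k x = (\<lambda>j. x (j + k))"

lemma vshift_0: "vshift 0 = id"
  by (simp add: vshift_def fun_eq_iff)

lemma vshift_add: "vshift (k + l) = vshift k \<circ> vshift l"
  by (simp add: vshift_def fun_eq_iff add.assoc)

text \<open>The element \<open>0.\<sigma>\<close>.\<close>

definition vdigit :: "int \<Rightarrow> (int \<Rightarrow> int)" where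
  "vdigit s = (\<lambda>j. if j = 1 then s else 0)"

section \<open>Fourier transform\<close>

text \<open>The index set of the sum is finite for \<open>x\<close>, \<open>w\<close> in \<open>vilenkin p\<close>.\<close>

definition vchar :: "nat \<Rightarrow> (int \<Rightarrow> int) \<Rightarrow> (int \<Rightarrow> int) \<Rightarrow> complex" where
  "vchar p x w =
     exp (2 * of_real pi * \<i> / of_nat p * of_int (\<Sum>j | x j * w (1 - j) \<noteq> 0. x j * w (1 - j)))"

text \<open>
  The integral formula gives the inverse Fourier transform of integrable functions.  It is only
  applied to indicator functions of sets of finite measure, which are exactly the indicator
  functions in \<open>L\<^sup>2\<close>, and which are integrable.
\<close>

definition inv_fourier :: "nat \<Rightarrow> ((int \<Rightarrow> int) \<Rightarrow> complex) \<Rightarrow> (int \<Rightarrow> int) \<Rightarrow> complex" where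
  "inv_fourier p f x = (\<integral>w. f w * vchar p x w \<partial>vhaar p)"

section \<open>Orthonormal bases, wavelets and generalized scaling sets\<close>

definition L2fun :: "'a measure \<Rightarrow> ('a \<Rightarrow> complex) set" where
  "L2fun M = {f \<in> borel_measurable M. integrable M (\<lambda>x. (cmod (f x))\<^sup>2)}"

definition L2inner :: "'a measure \<Rightarrow> ('a \<Rightarrow> complex) \<Rightarrow> ('a \<Rightarrow> complex) \<Rightarrow> complex" where
  "L2inner M f g = (\<integral>x. f x * cnj (g x) \<partial>M)"

definition L2norm :: "'a measure \<Rightarrow> ('a \<Rightarrow> complex) \<Rightarrow> real" where
  "L2norm M f = sqrt (\<integral>x. (cmod (f x))\<^sup>2 \<partial>M)"

text \<open>An orthonormal family whose linear span is dense.\<close>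

definition L2_orthonormal_basis :: "'a measure \<Rightarrow> 'i set \<Rightarrow> ('i \<Rightarrow> 'a \<Rightarrow> complex) \<Rightarrow> bool" where
  "L2_orthonormal_basis M I e \<longleftrightarrow>
     (\<forall>i\<in>I. e i \<in> L2fun M) \<and>
     (\<forall>i\<in>I. \<forall>k\<in>I. L2inner M (e i) (e k) = (if i = k then 1 else 0)) \<and>
     (\<forall>f\<in>L2fun M. \<forall>\<epsilon>>0. \<exists>F c. finite F \<and> F \<subseteq> I \<and>
        L2norm M (\<lambda>x. f x - (\<Sum>i\<in>F. c i * e i x)) < \<epsilon>)"

definition wavelet :: "nat \<Rightarrow> ((int \<Rightarrow> int) \<Rightarrow> complex) \<Rightarrow> bool" where
  "wavelet p \<psi> \<longleftrightarrow> \<psi> \<in> L2fun (vhaar p) \<and>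
     L2_orthonormal_basis (vhaar p) (UNIV \<times> vH p)
       (\<lambda>(j, h) x. of_real (real p powr (of_int j / 2)) * \<psi> (vsub p (vshift j x) h))"

definition wavelet_set :: "nat \<Rightarrow> (int \<Rightarrow> int) set \<Rightarrow> bool" where
  "wavelet_set p \<Omega> \<longleftrightarrow>
     \<Omega> \<in> sets (vhaar p) \<and> emeasure (vhaar p) \<Omega> < \<infinity> \<and> wavelet p (inv_fourier p (indicator \<Omega>))"

definition generalized_scaling_set :: "nat \<Rightarrow> (int \<Rightarrow> int) set \<Rightarrow> bool" where
  "generalized_scaling_set p S \<longleftrightarrow>
     S \<in> sets (vhaar p) \<and>
     emeasure (vhaar p) S = ennreal (1 / (real p - 1)) \<and>
     wavelet_set p (vshift 1 ` S - S)"

definition veta :: "nat \<Rightarrow> (int \<Rightarrow> int) set \<Rightarrow> (int \<Rightarrow> int) \<Rightarrow> ennreal" where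
  "veta p S w = (\<Sum>\<^sub>\<infinity>h\<in>vH p. indicator S (vadd p w h))"

section \<open>Existence and uniqueness of the Haar measure\<close>

definition vcoset :: "nat \<Rightarrow> (int \<Rightarrow> int) \<Rightarrow> int \<Rightarrow> (int \<Rightarrow> int) set" where
  "vcoset p x l = {y \<in> vilenkin p. \<forall>j\<le>l. y j = x j}"

lemma vadd_in: "p > 0 \<Longrightarrow> x \<in> vilenkin p \<Longrightarrow> y \<in> vilenkin p \<Longrightarrow> vadd p x y \<in> vilenkin p"
  unfolding vilenkin_def vadd_def
proof (clarsimp, goal_cases)
  case (1 k k')
  then show ?case by (intro exI[of _ "min k k'"]) auto
qed

lemma vsub_in: "p > 0 \<Longrightarrow> x \<in> vilenkin p \<Longrightarrow> y \<in> vilenkin p \<Longrightarrow> vsub p x y \<in> vilenkin p"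
  unfolding vilenkin_def vsub_def
proof (clarsimp, goal_cases)
  case (1 k k')
  then show ?case by (intro exI[of _ "min k k'"]) auto
qed

lemma vil_mod: "x \<in> vilenkin p \<Longrightarrow> x j mod int p = x j"
  by (auto simp: vilenkin_def)

lemma vadd_vsub: "y \<in> vilenkin p \<Longrightarrow> vadd p x (vsub p y x) = y"
  by (rule ext) (simp add: vadd_def vsub_def mod_simps vil_mod)

lemma vsub_vadd: "y \<in> vilenkin p \<Longrightarrow> vsub p (vadd p x y) x = y"
  by (rule ext) (simp add: vadd_def vsub_def mod_simps vil_mod)

lemma vadd_eq_iff:
  assumes "x \<in> vilenkin p" "y \<in> vilenkin p" "z \<in> vilenkin p"
  shows "vadd p x y j = z j \<longleftrightarrow> y j = vsub p z x j"
proof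
  assume "vadd p x y j = z j"
  hence "vsub p z x j = vsub p (vadd p x y) x j" by (simp add: vsub_def)
  thus "y j = vsub p z x j" using vsub_vadd[OF assms(2)] by simp
next
  assume "y j = vsub p z x j"
  hence "vadd p x y j = vadd p x (vsub p z x) j" by (simp add: vadd_def)
  thus "vadd p x y j = z j" using vadd_vsub[OF assms(3)] by simp
qed

lemma vadd_image:
  assumes "p > 0" "x \<in> vilenkin p" "E \<subseteq> vilenkin p"
  shows "vadd p x ` E = {z \<in> vilenkin p. vsub p z x \<in> E}"
proof safe
  fix y assume "y \<in> E"
  with assms show "vadd p x y \<in> vilenkin p" "vsub p (vadd p x y) x \<in> E"
    by (auto simp: vsub_vadd subset_eq intro: vadd_in)
next
  fix z assume "z \<in> vilenkin p" "vsub p z x \<in> E"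
  thus "z \<in> vadd p x ` E" using vadd_vsub[of z p x] by (metis image_eqI)
qed

lemma vzero_in: "p > 0 \<Longrightarrow> (\<lambda>_. 0) \<in> vilenkin p"
  by (auto simp: vilenkin_def)

lemma vadd_coset:
  assumes "p > 0" "x \<in> vilenkin p" "y \<in> vilenkin p"
  shows "vadd p x ` vcoset p y l = vcoset p (vadd p x y) l"
proof -
  have "vsub p z x \<in> vcoset p y l \<longleftrightarrow> z \<in> vcoset p (vadd p x y) l" if z: "z \<in> vilenkin p" for z
  proof -
    have "(vsub p z x j = y j) = (z j = vadd p x y j)" for j
      using vadd_eq_iff[OF assms(2,3) z, of j] by metis
    thus ?thesis using z assms by (auto simp: vcoset_def vsub_in)
  qed
  thus ?thesis using assms by (subst vadd_image) (auto simp: vcoset_def)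
qed

lemma vnbhd_coset: "vnbhd p l = vcoset p (\<lambda>_. 0) l"
  by (simp add: vnbhd_def vcoset_def)

lemma vadd_0: "x \<in> vilenkin p \<Longrightarrow> vadd p x (\<lambda>_. 0) = x"
  by (rule ext) (simp add: vadd_def vil_mod)

lemma vadd_nbhd: "p > 0 \<Longrightarrow> x \<in> vilenkin p \<Longrightarrow> vadd p x ` vnbhd p l = vcoset p x l"
  by (simp add: vnbhd_coset vadd_coset vzero_in vadd_0)

definition vcosets :: "nat \<Rightarrow> (int \<Rightarrow> int) set set" where
  "vcosets p = {vcoset p x l | x l. x \<in> vilenkin p \<and> 0 \<le> l}"

definition vtrunc :: "int \<Rightarrow> (int \<Rightarrow> int) \<Rightarrow> (int \<Rightarrow> int)" where
  "vtrunc l x = (\<lambda>j. if j \<le> l then x j else 0)"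

lemma countable_trunc: "countable {x \<in> vilenkin p. \<forall>j>l. x j = 0}"
proof -
  have "{x \<in> vilenkin p. \<forall>j>l. x j = 0} \<subseteq>
     (\<Union>k. {f. \<forall>x. (x \<in> {k..l} \<longrightarrow> f x \<in> {0..<int p}) \<and> (x \<notin> {k..l} \<longrightarrow> f x = 0)})"
  proof
    fix x assume x: "x \<in> {x \<in> vilenkin p. \<forall>j>l. x j = 0}"
    then obtain k where k: "\<forall>j<k. x j = 0" by (auto simp: vilenkin_def)
    have "\<forall>j. (j \<in> {k..l} \<longrightarrow> x j \<in> {0..<int p}) \<and> (j \<notin> {k..l} \<longrightarrow> x j = 0)"
      using x k by (auto simp: vilenkin_def not_le)
    thus "x \<in> (\<Union>k. {f. \<forall>x. (x \<in> {k..l} \<longrightarrow> f x \<in> {0..<int p}) \<and> (x \<notin> {k..l} \<longrightarrow> f x = 0)})"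
      by blast
  qed
  moreover have "countable \<dots>"
  proof (intro countable_UN)
    show "countable {f. \<forall>x. (x \<in> {k..l} \<longrightarrow> f x \<in> {0..<int p}) \<and> (x \<notin> {k..l} \<longrightarrow> f x = (0::int))}" for k
      by (rule countable_finite[OF finite_set_of_finite_funs]) auto
  qed auto
  ultimately show ?thesis by (rule countable_subset)
qed

lemma countable_vH: "countable (vH p)"
  unfolding vH_def by (rule countable_trunc)

lemma vtrunc_in: "p > 0 \<Longrightarrow> x \<in> vilenkin p \<Longrightarrow> vtrunc l x \<in> vilenkin p"
  by (auto simp: vilenkin_def vtrunc_def)

lemma vcoset_trunc: "vcoset p (vtrunc l x) l = vcoset p x l"
  by (auto simp: vcoset_def vtrunc_def)

lemma countable_vcosets:
  assumes "p > 0" shows "countable (vcosets p)"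
proof -
  have "vcosets p \<subseteq> (\<Union>l. (\<lambda>x. vcoset p x l) ` {x \<in> vilenkin p. \<forall>j>l. x j = 0})"
  proof
    fix c assume "c \<in> vcosets p"
    then obtain x l where "x \<in> vilenkin p" "c = vcoset p x l" by (auto simp: vcosets_def)
    hence "c = vcoset p (vtrunc l x) l"
      "vtrunc l x \<in> {x \<in> vilenkin p. \<forall>j>l. x j = 0}"
      using assms by (simp_all add: vcoset_trunc vtrunc_in) (simp add: vtrunc_def)
    thus "c \<in> (\<Union>l. (\<lambda>x. vcoset p x l) ` {x \<in> vilenkin p. \<forall>j>l. x j = 0})" by blast
  qed
  moreover have "countable \<dots>" by (intro countable_UN countable_image countable_trunc) auto
  ultimately show ?thesis by (rule countable_subset)
qed

lemma vtop_eq: "p > 0 \<Longrightarrow> vtop p = topology_generated_by {vcoset p x l | x l. x \<in> vilenkin p}"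
  unfolding vtop_def by (rule arg_cong[where f = topology_generated_by]) (metis (no_types, lifting) vadd_nbhd)

lemma openin_vtop_imp:
  assumes "p > 0" "openin (vtop p) V" "x \<in> V"
  shows "x \<in> vilenkin p \<and> (\<exists>l\<ge>0. vcoset p x l \<subseteq> V)"
proof -
  have "generate_topology_on {vcoset p x l | x l. x \<in> vilenkin p} V"
    using assms(2) unfolding vtop_eq[OF assms(1)] openin_topology_generated_by_iff .
  hence "\<forall>x\<in>V. x \<in> vilenkin p \<and> (\<exists>l\<ge>0. vcoset p x l \<subseteq> V)"
  proof induction
    case (Int a b)
    show ?case
    proof
      fix x assume "x \<in> a \<inter> b"
      then obtain l m where "x \<in> vilenkin p" "l \<ge> 0" "vcoset p x l \<subseteq> a" "vcoset p x m \<subseteq> b" 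
        using Int.IH by blast
      moreover have "vcoset p x (max l m) \<subseteq> vcoset p x l \<inter> vcoset p x m" 
        by (auto simp: vcoset_def)
      ultimately show "x \<in> vilenkin p \<and> (\<exists>l\<ge>0. vcoset p x l \<subseteq> a \<inter> b)"
        by (intro conjI exI[of _ "max l m"]) auto
    qed
  next
    case (UN K)
    then show ?case by (meson UnionE Union_upper subset_trans)
  next
    case (Basis s)
    then obtain y l where y: "y \<in> vilenkin p" "s = vcoset p y l" by auto
    show ?case
    proof
      fix x assume "x \<in> s"
      hence "x \<in> vilenkin p \<and> max 0 l \<ge> 0 \<and> vcoset p x (max 0 l) \<subseteq> s"
        using y by (auto simp: vcoset_def)
      thus "x \<in> vilenkin p \<and> (\<exists>l\<ge>0. vcoset p x l \<subseteq> s)" by blast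
    qed
  qed auto
  thus ?thesis using assms by blast
qed

lemma openin_coset:
  assumes "p > 0" "x \<in> vilenkin p" shows "openin (vtop p) (vcoset p x l)"
  unfolding vtop_eq[OF assms(1)] openin_topology_generated_by_iff
  using assms by (intro generate_topology_on.Basis) auto

lemma vcosets_sub: "vcosets p \<subseteq> Pow (vilenkin p)"
  by (auto simp: vcosets_def vcoset_def)

lemma open_sub: "p > 0 \<Longrightarrow> {V. openin (vtop p) V} \<subseteq> Pow (vilenkin p)"
  using openin_vtop_imp by blast

lemma space_vborel: "p > 0 \<Longrightarrow> space (vborel p) = vilenkin p"
  by (simp add: vborel_def open_sub space_measure_of)

lemma sets_vborel:
  assumes "p > 0"
  shows "sets (vborel p) = sigma_sets (vilenkin p) (vcosets p)"
proof -
  have "sigma_sets (vilenkin p) {V. openin (vtop p) V} = sigma_sets (vilenkin p) (vcosets p)"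
  proof (rule sigma_sets_eqI)
    fix V assume "V \<in> {V. openin (vtop p) V}"
    hence V: "openin (vtop p) V" by simp
    have "V = \<Union>{c \<in> vcosets p. c \<subseteq> V}"
    proof (intro equalityI subsetI)
      fix x assume "x \<in> V"
      then obtain l where "x \<in> vilenkin p" "l \<ge> 0" "vcoset p x l \<subseteq> V"
        using openin_vtop_imp[OF assms V] by blast
      moreover have "x \<in> vcoset p x l" using calculation by (simp add: vcoset_def)
      ultimately show "x \<in> \<Union>{c \<in> vcosets p. c \<subseteq> V}" by (auto simp: vcosets_def)
    qed auto
    moreover have "\<Union>{c \<in> vcosets p. c \<subseteq> V} \<in> sigma_sets (vilenkin p) (vcosets p)"
      by (intro sigma_sets_UNION countable_subset[OF _ countable_vcosets[OF assms]]) auto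
    ultimately show "V \<in> sigma_sets (vilenkin p) (vcosets p)" by simp
  next
    fix c assume "c \<in> vcosets p"
    thus "c \<in> sigma_sets (vilenkin p) {V. openin (vtop p) V}"
      using assms by (auto simp: vcosets_def intro!: sigma_sets.Basic openin_coset)
  qed
  thus ?thesis using assms by (simp add: vborel_def open_sub sets_measure_of)
qed

lemma vborel_eqI:
  assumes p: "p > 0" and M: "sets M = sets (vborel p)" and N: "sets N = sets (vborel p)"
    and eq: "\<And>x l. x \<in> vilenkin p \<Longrightarrow> l \<ge> 0 \<Longrightarrow> emeasure M (vcoset p x l) = emeasure N (vcoset p x l)"
    and fin: "\<And>x. x \<in> vilenkin p \<Longrightarrow> emeasure M (vcoset p x 0) \<noteq> \<infinity>"
  shows "M = N"
proof -
  let ?C = "insert {} (vcosets p)"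
  let ?A = "(\<lambda>x. vcoset p x 0) ` vH p"
  have ss: "sigma_sets (vilenkin p) (vcosets p) = sigma_sets (vilenkin p) ?C"
    by (rule sigma_sets_eqI) (auto intro: sigma_sets.Basic sigma_sets.Empty)
  show ?thesis
  proof (rule measure_eqI_generator_eq_countable[where E = ?C and \<Omega> = "vilenkin p" and A = ?A])
    show "Int_stable ?C"
    proof (rule Int_stableI)
      fix a b assume ab: "a \<in> ?C" "b \<in> ?C"
      show "a \<inter> b \<in> ?C"
      proof (cases "a \<inter> b = {}")
        case False
        then obtain z where z: "z \<in> a" "z \<in> b" by blast
        obtain x l where x: "x \<in> vilenkin p" "l \<ge> 0" "a = vcoset p x l"
          using ab z by (auto simp: vcosets_def)
        obtain y m where y: "y \<in> vilenkin p" "m \<ge> 0" "b = vcoset p y m"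
          using ab z by (auto simp: vcosets_def)
        have "a = vcoset p z l" "b = vcoset p z m" "z \<in> vilenkin p"
          using x y z by (auto simp: vcoset_def)
        moreover have "vcoset p z l \<inter> vcoset p z m = vcoset p z (max l m)"
          by (auto simp: vcoset_def) (metis le_cases max.orderE max.commute)
        ultimately have "a \<inter> b = vcoset p z (max l m)" "z \<in> vilenkin p" "0 \<le> max l m"
          using x(2) by auto
        thus ?thesis unfolding vcosets_def by blast
      qed simp
    qed
    show "?C \<subseteq> Pow (vilenkin p)" using vcosets_sub by blast
    show "\<And>X. X \<in> ?C \<Longrightarrow> emeasure M X = emeasure N X"
      using eq by (auto simp: vcosets_def)
    show "sets M = sigma_sets (vilenkin p) ?C" "sets N = sigma_sets (vilenkin p) ?C"
      using M N ss p by (simp_all add: sets_vborel)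
    show "?A \<subseteq> ?C" by (auto simp: vcosets_def vH_def)
    show "countable ?A" using countable_vH by blast
    show "\<Union>?A = vilenkin p"
    proof (intro equalityI subsetI)
      fix x assume "x \<in> vilenkin p"
      hence "vtrunc 0 x \<in> vH p" "x \<in> vcoset p (vtrunc 0 x) 0"
        using p by (auto simp: vH_def vtrunc_in vcoset_trunc) (auto simp: vtrunc_def vcoset_def)
      thus "x \<in> \<Union>?A" by blast
    qed (auto simp: vcoset_def)
    show "\<And>a. a \<in> ?A \<Longrightarrow> emeasure M a \<noteq> \<infinity>" using fin by (auto simp: vH_def)
  qed
qed

lemma coset_meas: "p > 0 \<Longrightarrow> x \<in> vilenkin p \<Longrightarrow> vcoset p x l \<in> sets (vborel p)"
  unfolding vborel_def by (subst sets_measure_of[OF open_sub]) (auto intro!: sigma_sets.Basic openin_coset)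

lemma haar_coset:
  assumes p: "p > 0" and M: "is_vhaar p M" and x: "x \<in> vilenkin p" 
  shows "emeasure M (vcoset p x (int n)) = ennreal (1 / real p ^ n)"
proof -
  have tr: "emeasure M (vcoset p x l) = emeasure M (vnbhd p l)" if "x \<in> vilenkin p" for x l
    using M that coset_meas[OF p vzero_in[OF p]] vadd_nbhd[OF p that, of l]
    unfolding is_vhaar_def vnbhd_coset by metis
  have "emeasure M (vnbhd p (int n)) = ennreal (1 / real p ^ n)"
  proof (induction n)
    case 0
    then show ?case using M by (simp add: is_vhaar_def)
  next
    case (Suc n)
    let ?d = "\<lambda>s j. if j = 1 + int n then s else (0::int)"
    have d: "?d s \<in> vilenkin p" if "s \<in> {0..<int p}" for s
      using that p by (auto simp: vilenkin_def intro!: exI[of _ "1 + int n"])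
    have un: "vnbhd p (int n) = (\<Union>s\<in>{0..<int p}. vcoset p (?d s) (int (Suc n)))"
    proof (intro equalityI subsetI)
      fix y assume y: "y \<in> vnbhd p (int n)"
      hence "y (1 + int n) \<in> {0..<int p}" by (auto simp: vnbhd_def vilenkin_def)
      moreover have "y \<in> vcoset p (?d (y (1 + int n))) (int (Suc n))"
        using y by (auto simp: vnbhd_def vcoset_def)
      ultimately show "y \<in> (\<Union>s\<in>{0..<int p}. vcoset p (?d s) (int (Suc n)))" by blast
    qed (auto simp: vnbhd_def vcoset_def)
    have "emeasure M (vnbhd p (int n)) = (\<Sum>s\<in>{0..<int p}. emeasure M (vcoset p (?d s) (int (Suc n))))"
      unfolding un
    proof (rule sum_emeasure[symmetric])
      show "disjoint_family_on (\<lambda>s. vcoset p (?d s) (int (Suc n))) {0..<int p}"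
        unfolding disjoint_family_on_def
      proof (intro ballI impI, rule ccontr)
        fix s t :: int assume st: "s \<noteq> t" "vcoset p (?d s) (int (Suc n)) \<inter> vcoset p (?d t) (int (Suc n)) \<noteq> {}"
        then obtain y where "y (1 + int n) = s" "y (1 + int n) = t" by (auto simp: vcoset_def)
        thus False using st by simp
      qed
      show "(\<lambda>s. vcoset p (?d s) (int (Suc n))) ` {0..<int p} \<subseteq> sets M"
        using M d coset_meas[OF p] by (auto simp: is_vhaar_def)
    qed simp
    also have "\<dots> = (\<Sum>s\<in>{0..<int p}. emeasure M (vnbhd p (int (Suc n))))"
      by (intro sum.cong refl tr d)
    also have "\<dots> = of_nat p * emeasure M (vnbhd p (int (Suc n)))" by simp
    finally have e: "of_nat p * emeasure M (vnbhd p (int (Suc n))) = ennreal (1 / real p ^ n)"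
      using Suc.IH by simp
    also have "\<dots> = of_nat p * ennreal (1 / real p ^ Suc n)"
      using p by (simp add: ennreal_of_nat_eq_real_of_nat ennreal_mult[symmetric])
    finally show ?case using p
      by (subst (asm) ennreal_mult_cancel_left) auto
  qed
  thus ?thesis using tr[OF x] by simp
qed

lemma haar_unique:
  assumes p: "p > 0" and M: "is_vhaar p M" and N: "is_vhaar p N" shows "M = N"
proof (rule vborel_eqI[OF p])
  fix x and l :: int assume "x \<in> vilenkin p" "l \<ge> 0"
  thus "emeasure M (vcoset p x l) = emeasure N (vcoset p x l)"
    using haar_coset[OF p M, of x "nat l"] haar_coset[OF p N, of x "nat l"] by simp
next
  fix x assume "x \<in> vilenkin p"
  thus "emeasure M (vcoset p x 0) \<noteq> \<infinity>" using haar_coset[OF p M, of x 0] by simp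
qed (use M N in \<open>auto simp: is_vhaar_def\<close>)

text \<open>Existence: the product of counting measure on \<open>vH p\<close> and the uniform measure on the digits \<open>j > 0\<close>.\<close>

lemma haar_exists:
  assumes p: "p > 0" shows "\<exists>M. is_vhaar p M"
proof -
  let ?D = "{0..<int p}"
  define P where "P = PiM {1::int..} (\<lambda>_. uniform_count_measure ?D)"
  define Q where "Q = count_space (vH p) \<Otimes>\<^sub>M P"
  define \<phi> where "\<phi> = (\<lambda>(h, u) (j::int). if j \<le> 0 then h j else u j :: int)"
  define M where "M = distr Q (vborel p) \<phi>"
  interpret prob_space "uniform_count_measure ?D"
    using p by (intro prob_space_uniform_count_measure) auto
  interpret PP: product_prob_space "\<lambda>_. uniform_count_measure ?D" "{1::int..}" ..
  have sP: "space P = {1..} \<rightarrow>\<^sub>E ?D" by (simp add: P_def space_PiM space_uniform_count_measure)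
  have phi_in: "\<phi> (h, u) \<in> vilenkin p" if hu: "h \<in> vH p" "u \<in> space P" for h u
  proof -
    obtain k where k: "\<forall>j<k. h j = 0" using hu by (auto simp: vH_def vilenkin_def)
    have 1: "\<forall>j. \<phi> (h, u) j \<in> ?D" 
      using hu by (auto simp: \<phi>_def vH_def vilenkin_def sP PiE_iff)
    have 2: "\<forall>j<min k 0. \<phi> (h, u) j = 0" using k by (simp add: \<phi>_def)
    show ?thesis unfolding vilenkin_def using 1 2 by blast
  qed
  have pre: "\<phi> -` vcoset p x (int n) \<inter> space Q
      = {vtrunc 0 x} \<times> {u \<in> space P. \<forall>i\<in>{1..int n}. u i \<in> {x i}}"
    if x: "x \<in> vilenkin p" for x n
  proof (intro equalityI subsetI)
    fix z assume z: "z \<in> \<phi> -` vcoset p x (int n) \<inter> space Q"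
    obtain h u where hu': "z = (h, u)" by (cases z)
    have hu: "\<phi> (h, u) \<in> vcoset p x (int n)" "(h, u) \<in> space Q" using z hu' by auto
    hence h: "h \<in> vH p" and u: "u \<in> space P" by (auto simp: Q_def space_pair_measure)
    have e: "\<phi> (h, u) j = x j" if "j \<le> int n" for j using hu that by (simp add: vcoset_def)
    have "h = vtrunc 0 x"
    proof
      fix j show "h j = vtrunc 0 x j" using e[of j] h
        by (auto simp: \<phi>_def vtrunc_def vH_def)
    qed
    moreover have "u i = x i" if "i \<in> {1..int n}" for i using e[of i] that by (simp add: \<phi>_def)
    ultimately show "z \<in> {vtrunc 0 x} \<times> {u \<in> space P. \<forall>i\<in>{1..int n}. u i \<in> {x i}}"
      using u hu' by auto
  next
    fix z assume z: "z \<in> {vtrunc 0 x} \<times> {u \<in> space P. \<forall>i\<in>{1..int n}. u i \<in> {x i}}"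
    then obtain u where zu: "z = (vtrunc 0 x, u)" and u: "u \<in> space P" "\<forall>i\<in>{1..int n}. u i \<in> {x i}"
      by blast
    have h: "vtrunc 0 x \<in> vH p" using vtrunc_in[OF p x] by (auto simp: vH_def vtrunc_def)
    have "\<phi> (vtrunc 0 x, u) \<in> vcoset p x (int n)"
      using phi_in[OF h u(1)] u(2) by (auto simp: vcoset_def) (auto simp: \<phi>_def vtrunc_def)
    thus "z \<in> \<phi> -` vcoset p x (int n) \<inter> space Q"
      using h u zu by (auto simp: Q_def space_pair_measure)
  qed
  have cyl: "{u \<in> space P. \<forall>i\<in>{1..int n}. u i \<in> {x i}} \<in> sets P" (is ?A)
    "emeasure P {u \<in> space P. \<forall>i\<in>{1..int n}. u i \<in> {x i}} = ennreal (1 / real p ^ n)" (is ?B)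
    if x: "x \<in> vilenkin p" for x n
  proof -
    have xi: "{x i} \<in> sets (uniform_count_measure ?D)" for i
      using x by (auto simp: vilenkin_def sets_uniform_count_measure)
    have "emeasure P {u \<in> space P. \<forall>i\<in>{1..int n}. u i \<in> {x i}}
       = (\<Prod>i\<in>{1..int n}. emeasure (uniform_count_measure ?D) {x i})"
      unfolding P_def by (rule PP.emeasure_PiM_Collect) (use xi in auto)
    also have "\<dots> = (\<Prod>i\<in>{1..int n}. ennreal (1 / real p))"
    proof (intro prod.cong refl)
      fix i have "{x i} \<subseteq> ?D" using x by (auto simp: vilenkin_def)
      thus "emeasure (uniform_count_measure ?D) {x i} = ennreal (1 / real p)"
        using p by (subst emeasure_uniform_count_measure) auto
    qed
    also have "\<dots> = ennreal (1 / real p ^ n)"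
      by (simp add: ennreal_power power_one_over)
    finally show ?B .
    have "{u \<in> space P. \<forall>i\<in>{1..int n}. u i \<in> {x i}} = (\<Inter>i\<in>{1..int n}. {u \<in> space P. u i \<in> {x i}}) \<inter> space P"
      by auto
    also have "\<dots> \<in> sets P"
    proof (cases "n = 0")
      case False
      show ?thesis
      proof (intro sets.Int sets.finite_INT sets.top)
        fix i assume "i \<in> {1..int n}"
        thus "{u \<in> space P. u i \<in> {x i}} \<in> sets P"
          unfolding P_def using xi[of i]
          by (intro sets_Collect_single) auto
      qed (use False in auto)
    qed simp
    finally show ?A .
  qed
  have phi_meas: "\<phi> \<in> measurable Q (vborel p)"
  proof (rule measurable_sigma_sets[OF sets_vborel[OF p] vcosets_sub])
    show "\<phi> \<in> space Q \<rightarrow> vilenkin p" using phi_in by (auto simp: Q_def space_pair_measure)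
    fix c assume "c \<in> vcosets p"
    then obtain x l where x: "x \<in> vilenkin p" "c = vcoset p x l" "l \<ge> 0" by (auto simp: vcosets_def)
    moreover have "vtrunc 0 x \<in> vH p" using vtrunc_in[OF p x(1)] by (auto simp: vH_def vtrunc_def)
    ultimately show "\<phi> -` c \<inter> space Q \<in> sets Q"
      using pre[of x "nat l"] cyl(1)[of x "nat l"] by (auto simp: Q_def)
  qed
  have sM: "sets M = sets (vborel p)" by (simp add: M_def)
  have spM: "space M = vilenkin p" by (simp add: M_def space_vborel p)
  interpret P: prob_space P unfolding P_def by (rule PP.P.prob_space_axioms)
  have cos: "emeasure M (vcoset p x (int n)) = ennreal (1 / real p ^ n)" if x: "x \<in> vilenkin p" for x n
  proof -
    have h: "vtrunc 0 x \<in> vH p" using vtrunc_in[OF p x] by (auto simp: vH_def vtrunc_def)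
    have "emeasure M (vcoset p x (int n)) = emeasure Q (\<phi> -` vcoset p x (int n) \<inter> space Q)"
      unfolding M_def using coset_meas[OF p x] phi_meas by (rule emeasure_distr[rotated])
    also have "\<dots> = emeasure (count_space (vH p)) {vtrunc 0 x} *
        emeasure P {u \<in> space P. \<forall>i\<in>{1..int n}. u i \<in> {x i}}"
      unfolding pre[OF x] unfolding Q_def using h cyl(1)[OF x]
      by (intro P.emeasure_pair_measure_Times) auto
    also have "\<dots> = ennreal (1 / real p ^ n)" using cyl(2)[OF x] h by simp
    finally show ?thesis .
  qed
  have "is_vhaar p M"
    unfolding is_vhaar_def
  proof (intro conjI ballI)
    show "sets M = sets (vborel p)" by fact
    show "emeasure M (vnbhd p 0) = 1"
      using cos[OF vzero_in[OF p], of 0] by (simp add: vnbhd_coset)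
    fix x E assume x: "x \<in> vilenkin p" and E: "E \<in> sets M"
    let ?t = "\<lambda>z. vsub p z x"
    have tpre: "?t -` F \<inter> vilenkin p = vadd p x ` F" if "F \<subseteq> vilenkin p" for F
      using vadd_image[OF p x that] by auto
    have t: "?t \<in> measurable M (vborel p)"
    proof (rule measurable_sigma_sets[OF sets_vborel[OF p] vcosets_sub])
      show "?t \<in> space M \<rightarrow> vilenkin p" using spM vsub_in[OF p _ x] by auto
      fix c assume "c \<in> vcosets p"
      then obtain y l where y: "y \<in> vilenkin p" "c = vcoset p y l" by (auto simp: vcosets_def)
      hence "c \<subseteq> vilenkin p" by (auto simp: vcoset_def)
      from tpre[OF this] show "?t -` c \<inter> space M \<in> sets M"
        using y x p by (simp add: spM sM vadd_coset coset_meas vadd_in)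
    qed
    have "M = distr M (vborel p) ?t"
    proof (rule vborel_eqI[OF p sM])
      fix y and l :: int assume y: "y \<in> vilenkin p" and l: "l \<ge> 0"
      have "vcoset p y l \<subseteq> vilenkin p" by (auto simp: vcoset_def)
      hence "emeasure (distr M (vborel p) ?t) (vcoset p y l) = emeasure M (vcoset p (vadd p x y) l)"
        using t coset_meas[OF p y, of l] tpre[of "vcoset p y l"]
        by (simp add: emeasure_distr spM vadd_coset p x y)
      thus "emeasure M (vcoset p y l) = emeasure (distr M (vborel p) ?t) (vcoset p y l)"
        using cos[OF y, of "nat l"] cos[OF vadd_in[OF p x y], of "nat l"] l by simp
    next
      fix y assume "y \<in> vilenkin p"
      thus "emeasure M (vcoset p y 0) \<noteq> \<infinity>" using cos[of y 0] by simp
    qed simp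
    hence "emeasure M E = emeasure (distr M (vborel p) ?t) E" by simp
    also have "\<dots> = emeasure M (?t -` E \<inter> space M)"
      using t E sM by (simp add: emeasure_distr)
    also have "?t -` E \<inter> space M = vadd p x ` E"
      unfolding spM using sets.sets_into_space[OF E] spM by (intro tpre) auto
    finally show "emeasure M (vadd p x ` E) = emeasure M E" by simp
  qed
  thus ?thesis by blast
qed

theorem ex1_vhaar: "p > 0 \<Longrightarrow> \<exists>!M. is_vhaar p M"
  using haar_exists haar_unique by blast

end

theory Submission
  imports Defs
begin

text \<open>
  The inverse Fourier transform is an isometry on \<open>L\<^sup>1 \<inter> L\<^sup>2\<close>: this is a computation on indicators of cosets, and
  extends to the limit by Fatou's lemma.  It carries the system
  \<open>p\<^sup>-\<^sup>j\<^sup>/\<^sup>2 1\<^sub>\<Omega>(B\<^sup>-\<^sup>j \<omega>) \<chi>(h, B\<^sup>-\<^sup>j \<omega>)\<^sup>*\<close> to the wavelet system of \<open>\<Omega>\<close>, so that \<open>\<Omega>\<close> is a wavelet set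
  iff its translates by \<open>H\<^sup>\<bottom>\<close> and its dilates by the powers of \<open>B\<close> both tile \<open>G\<^sup>*\<close> up to null sets.
  For \<open>\<Omega> = BS \<setminus> S\<close> with \<open>\<mu>\<^sup>*(S) = 1/(p - 1)\<close>, tiling by translations forces \<open>\<mu>\<^sup>*(\<Omega>) = 1\<close> and hence \<open>S \<subseteq> BS\<close>.
  Once \<open>S \<subseteq> BS\<close>, the sets \<open>B\<^sup>j \<Omega>\<close> are the successive differences of an increasing chain with null
  intersection, so they tile iff the chain exhausts \<open>G\<^sup>*\<close>, which is (iii); and counting the points of
  \<open>\<omega> \<oplus> H\<^sup>\<bottom>\<close> in \<open>BS = S \<union> \<Omega>\<close> turns tiling by translations into (iv), since \<open>B\<^sup>-\<^sup>1 H\<^sup>\<bottom>\<close> is the union of the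
  cosets \<open>0.\<sigma> \<oplus> H\<^sup>\<bottom>\<close>.
\<close>

section \<open>Square-integrable functions\<close>

text \<open>The inverse transform is given only by an integral, so it acts on integrable functions
  and no surjective operator on L^2 is at hand. Density therefore crosses between the two sides
  through explicit functions: to the frequency side through indicators of sets of finite measure,
  and back through integrable preimages of coset indicators. Within one scale, orthonormality says
  that 1_\<Omega> has the same integrals against the characters of H as the fundamental domain U of
  H^perp. These characters separate the cosets in U, so the image of \<Omega> in U has density 1,
  which is tiling by translations. The constant 1/(p - 1) is the mass m with pm - m = 1: B
  multiplies measure by p, and U has measure 1. As \<mu>(BS - S) - \<mu>(S - BS) = \<mu>(BS) -
  \<mu>(S) = 1, a difference BS - S of measure 1 leaves nothing for S - BS. Finite measure of S also
  makes \<eta> finite almost everywhere, which the cancellation behind (iv) requires in extended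
  nonnegative reals.\<close>

definition L2sq :: "'a measure \<Rightarrow> ('a \<Rightarrow> complex) \<Rightarrow> real" where
  "L2sq M f = (\<integral>x. (cmod (f x))\<^sup>2 \<partial>M)"

lemma L2norm_eq: "L2norm M f = sqrt (L2sq M f)"
  by (simp add: L2norm_def L2sq_def)

lemma L2sq_nonneg [simp]: "L2sq M f \<ge> 0"
  by (simp add: L2sq_def)

lemma L2norm_nonneg [simp]: "L2norm M f \<ge> 0"
  by (simp add: L2norm_eq)

lemma L2norm_sq: "(L2norm M f)\<^sup>2 = L2sq M f"
  by (simp add: L2norm_eq)

lemma L2fun_meas: "f \<in> L2fun M \<Longrightarrow> f \<in> borel_measurable M"
  by (simp add: L2fun_def)

lemma L2fun_int: "f \<in> L2fun M \<Longrightarrow> integrable M (\<lambda>x. (cmod (f x))\<^sup>2)"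
  by (simp add: L2fun_def)

lemma nn_integral_L2: "f \<in> L2fun M \<Longrightarrow> (\<integral>\<^sup>+x. ennreal ((cmod (f x))\<^sup>2) \<partial>M) = ennreal (L2sq M f)"
  unfolding L2sq_def by (rule nn_integral_eq_integral[OF L2fun_int]) auto

lemma L2fun_bound:
  assumes "g \<in> L2fun M" "f \<in> borel_measurable M" "AE x in M. cmod (f x) \<le> c * cmod (g x)"
  shows "f \<in> L2fun M"
proof -
  have "integrable M (\<lambda>x. (cmod (f x))\<^sup>2)"
  proof (rule Bochner_Integration.integrable_bound)
    show "integrable M (\<lambda>x. c\<^sup>2 * (cmod (g x))\<^sup>2)" using L2fun_int[OF assms(1)] by simp
    show "AE x in M. norm ((cmod (f x))\<^sup>2) \<le> norm (c\<^sup>2 * (cmod (g x))\<^sup>2)"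
      using assms(3)
    proof eventually_elim
      case (elim x)
      hence "(cmod (f x))\<^sup>2 \<le> (c * cmod (g x))\<^sup>2" by (intro power_mono) auto
      thus ?case by (simp add: power_mult_distrib)
    qed
  qed (use assms(2) in simp)
  thus ?thesis using assms(2) by (simp add: L2fun_def)
qed

text \<open>The cross term 2|a||b| is bounded by d|a|^2 + |b|^2/d. The weight d is left free: d = 1
  gives closure under addition, and an optimal d gives Minkowski's inequality.\<close>

lemma norm_add_sq_le:
  fixes a b :: complex
  assumes "d > 0"
  shows "(cmod (a + b))\<^sup>2 \<le> (1 + d) * (cmod a)\<^sup>2 + (1 + 1 / d) * (cmod b)\<^sup>2"
proof -
  have "(cmod (a + b))\<^sup>2 \<le> (cmod a + cmod b)\<^sup>2"
    by (intro power_mono norm_triangle_ineq) auto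
  moreover have "0 \<le> (d * cmod a - cmod b)\<^sup>2 / d" using assms by simp
  moreover have "(d * cmod a - cmod b)\<^sup>2 / d = d * (cmod a)\<^sup>2 - 2 * cmod a * cmod b + (cmod b)\<^sup>2 / d"
    using assms by (simp add: field_simps power2_eq_square)
  ultimately show ?thesis by (simp add: power2_sum algebra_simps)
qed

lemma L2fun_add:
  assumes f: "f \<in> L2fun M" and g: "g \<in> L2fun M"
  shows "(\<lambda>x. f x + g x) \<in> L2fun M"
proof -
  have "integrable M (\<lambda>x. (cmod (f x + g x))\<^sup>2)"
  proof (rule Bochner_Integration.integrable_bound)
    show "integrable M (\<lambda>x. (1 + 1) * (cmod (f x))\<^sup>2 + (1 + 1 / 1) * (cmod (g x))\<^sup>2)"
      using L2fun_int[OF f] L2fun_int[OF g] by auto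
    show "AE x in M. norm ((cmod (f x + g x))\<^sup>2) \<le> norm ((1 + 1) * (cmod (f x))\<^sup>2 + (1 + 1 / 1) * (cmod (g x))\<^sup>2)"
      using norm_add_sq_le[of 1 "f _" "g _"] by (intro AE_I2) (auto intro: order_trans[OF _ abs_ge_self])
  qed (use L2fun_meas[OF f] L2fun_meas[OF g] in simp)
  thus ?thesis using L2fun_meas[OF f] L2fun_meas[OF g] by (simp add: L2fun_def)
qed

lemma L2fun_cmult: "f \<in> L2fun M \<Longrightarrow> (\<lambda>x. c * f x) \<in> L2fun M"
  by (rule L2fun_bound[where c = "cmod c" and g = f]) (auto simp: norm_mult dest: L2fun_meas)

lemma L2fun_zero [simp]: "(\<lambda>x. 0) \<in> L2fun M"
  by (simp add: L2fun_def)

lemma L2fun_uminus: "f \<in> L2fun M \<Longrightarrow> (\<lambda>x. - f x) \<in> L2fun M"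
  using L2fun_cmult[of f M "-1"] by simp

lemma L2fun_diff: "f \<in> L2fun M \<Longrightarrow> g \<in> L2fun M \<Longrightarrow> (\<lambda>x. f x - g x) \<in> L2fun M"
  using L2fun_add[OF _ L2fun_uminus, of f M g] by simp

lemma L2fun_sum: "(\<And>i. i \<in> F \<Longrightarrow> f i \<in> L2fun M) \<Longrightarrow> (\<lambda>x. \<Sum>i\<in>F. f i x) \<in> L2fun M"
  by (induction F rule: infinite_finite_induct) (auto intro!: L2fun_add)

lemma L2fun_lincomb:
  "(\<And>i. i \<in> F \<Longrightarrow> e i \<in> L2fun M) \<Longrightarrow> (\<lambda>x. \<Sum>i\<in>F. c i * e i x) \<in> L2fun M"
  by (intro L2fun_sum L2fun_cmult)

lemma L2fun_indicator:
  assumes "E \<in> sets M" "emeasure M E < \<infinity>" shows "indicator E \<in> L2fun M"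
proof -
  have "(\<lambda>x. (cmod (indicator E x))\<^sup>2) = indicator E" by (auto simp: indicator_def fun_eq_iff)
  thus ?thesis using assms by (simp add: L2fun_def)
qed

lemma L2sq_indicator: "E \<in> sets M \<Longrightarrow> L2sq M (indicator E) = measure M E"
proof -
  assume E: "E \<in> sets M"
  have "(\<lambda>x. (cmod (indicator E x))\<^sup>2) = indicator E" by (auto simp: indicator_def fun_eq_iff)
  thus ?thesis using sets.sets_into_space[OF E] by (simp add: L2sq_def Int_absorb2)
qed

lemma L2norm_cong: "(\<And>x. x \<in> space M \<Longrightarrow> f x = g x) \<Longrightarrow> L2norm M f = L2norm M g"
  unfolding L2norm_def by (rule arg_cong[where f = sqrt], rule Bochner_Integration.integral_cong) auto

lemma L2norm_cmult: "L2norm M (\<lambda>x. c * f x) = cmod c * L2norm M f"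
  by (simp add: L2norm_def norm_mult power_mult_distrib real_sqrt_mult)

lemma L2norm_minus: "L2norm M (\<lambda>x. f x - g x) = L2norm M (\<lambda>x. g x - f x)"
  by (simp add: L2norm_def norm_minus_commute)

text \<open>Minkowski's inequality, from the weighted bound \<open>norm_add_sq_le\<close> with the ratio of the norms.\<close>

lemma L2norm_triangle:
  assumes f: "f \<in> L2fun M" and g: "g \<in> L2fun M"
  shows "L2norm M (\<lambda>x. f x + g x) \<le> L2norm M f + L2norm M g"
proof (rule field_le_epsilon)
  fix e :: real assume e: "e > 0"
  \<comment> \<open>The summand e / 2 keeps \<open>a\<close> and \<open>b\<close> positive, so that
    b / a is an admissible weight even when a norm is 0. With this weight the bound becomes exactly
    (a + b)^2.\<close>
  define a where "a = L2norm M f + e / 2"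
  define b where "b = L2norm M g + e / 2"
  have ab: "a > 0" "b > 0" using e L2norm_nonneg[of M f] L2norm_nonneg[of M g] by (auto simp: a_def b_def intro: add_nonneg_pos)
  have "L2sq M (\<lambda>x. f x + g x) \<le> (\<integral>x. (1 + b / a) * (cmod (f x))\<^sup>2 + (1 + 1 / (b / a)) * (cmod (g x))\<^sup>2 \<partial>M)"
    unfolding L2sq_def
  proof (rule integral_mono)
    show "integrable M (\<lambda>x. (cmod (f x + g x))\<^sup>2)" by (rule L2fun_int[OF L2fun_add[OF f g]])
    show "(cmod (f x + g x))\<^sup>2 \<le> (1 + b / a) * (cmod (f x))\<^sup>2 + (1 + 1 / (b / a)) * (cmod (g x))\<^sup>2" for x
      using ab by (intro norm_add_sq_le) auto
  qed (use L2fun_int[OF f] L2fun_int[OF g] in simp)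
  also have "\<dots> = (1 + b / a) * (L2norm M f)\<^sup>2 + (1 + a / b) * (L2norm M g)\<^sup>2"
    using L2fun_int[OF f] L2fun_int[OF g] by (simp add: L2norm_sq L2sq_def)
  also have "\<dots> \<le> (1 + b / a) * a\<^sup>2 + (1 + a / b) * b\<^sup>2"
    using ab e by (intro add_mono mult_left_mono power_mono) (auto simp: a_def b_def)
  also have "\<dots> = (a + b)\<^sup>2" using ab by (simp add: field_simps power2_eq_square)
  finally have "L2norm M (\<lambda>x. f x + g x) \<le> a + b"
    unfolding L2norm_eq using ab by (intro real_le_lsqrt) auto
  thus "L2norm M (\<lambda>x. f x + g x) \<le> L2norm M f + L2norm M g + e" by (simp add: a_def b_def)
qed

lemma L2norm_triangle_diff:
  assumes "f \<in> L2fun M" "g \<in> L2fun M" "h \<in> L2fun M"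
  shows "L2norm M (\<lambda>x. f x - h x) \<le> L2norm M (\<lambda>x. f x - g x) + L2norm M (\<lambda>x. g x - h x)"
  using L2norm_triangle[OF L2fun_diff[OF assms(1,2)] L2fun_diff[OF assms(2,3)]] by simp

lemma L2norm_triangle_minus:
  assumes "f \<in> L2fun M" "g \<in> L2fun M"
  shows "L2norm M f \<le> L2norm M g + L2norm M (\<lambda>x. f x - g x)"
  using L2norm_triangle[OF assms(2) L2fun_diff[OF assms]] by simp

lemma L2norm_dominated:
  assumes f: "\<And>n. f n \<in> L2fun M" and g: "g \<in> L2fun M" and w: "w \<in> L2fun M"
    and lim: "AE x in M. (\<lambda>n. f n x) \<longlonglongrightarrow> g x"
    and bnd: "\<And>n. AE x in M. cmod (f n x - g x) \<le> cmod (w x)"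
  shows "(\<lambda>n. L2norm M (\<lambda>x. g x - f n x)) \<longlonglongrightarrow> 0"
proof -
  have "(\<lambda>n. L2sq M (\<lambda>x. g x - f n x)) \<longlonglongrightarrow> (\<integral>x. 0 \<partial>M)"
    unfolding L2sq_def
  proof (rule integral_dominated_convergence)
    show "integrable M (\<lambda>x. (cmod (w x))\<^sup>2)" by (rule L2fun_int[OF w])
    show "AE x in M. (\<lambda>n. (cmod (g x - f n x))\<^sup>2) \<longlonglongrightarrow> 0"
      using lim
    proof eventually_elim
      case (elim x)
      have "(\<lambda>n. (cmod (g x - f n x))\<^sup>2) \<longlonglongrightarrow> (cmod (g x - g x))\<^sup>2" by (intro tendsto_intros elim)
      thus ?case by simp
    qed
    show "AE x in M. norm ((cmod (g x - f n x))\<^sup>2) \<le> (cmod (w x))\<^sup>2" for n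
      using bnd[of n]
    proof eventually_elim
      case (elim x)
      thus ?case by (simp add: norm_minus_commute power_mono)
    qed
  qed (use L2fun_meas[OF f] L2fun_meas[OF g] in simp_all)
  hence "(\<lambda>n. sqrt (L2sq M (\<lambda>x. g x - f n x))) \<longlonglongrightarrow> sqrt 0"
    by (intro tendsto_real_sqrt) simp
  thus ?thesis by (simp add: L2norm_eq)
qed

section \<open>Closed linear spans in L^2\<close>

lemma lincomb_add:
  fixes e :: "'i \<Rightarrow> 'a \<Rightarrow> 'b::comm_ring"
  assumes "finite F" "finite F'"
  shows "\<exists>d. \<forall>x. (\<Sum>i\<in>F. c i * e i x) + (\<Sum>i\<in>F'. c' i * e i x) = (\<Sum>i\<in>F \<union> F'. d i * e i x)"
proof (intro exI allI)
  fix x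
  let ?d = "\<lambda>i. (if i \<in> F then c i else 0) + (if i \<in> F' then c' i else 0)"
  have "(\<Sum>i\<in>F \<union> F'. ?d i * e i x) = (\<Sum>i\<in>F \<union> F'. if i \<in> F then c i * e i x else 0) + (\<Sum>i\<in>F \<union> F'. if i \<in> F' then c' i * e i x else 0)"
    unfolding sum.distrib[symmetric] by (intro sum.cong) (auto simp: algebra_simps)
  thus "(\<Sum>i\<in>F. c i * e i x) + (\<Sum>i\<in>F'. c' i * e i x) = (\<Sum>i\<in>F \<union> F'. ?d i * e i x)"
    using assms by (simp add: sum.If_cases Int_absorb1)
qed

text \<open>The density clause of an orthonormal basis, turned into a set of functions. Families
  that do not span everything, such as a single scale of the wavelet system, can then be treated
  with the same closure rules.\<close>

definition L2_closed_span :: "'a measure \<Rightarrow> 'i set \<Rightarrow> ('i \<Rightarrow> 'a \<Rightarrow> complex) \<Rightarrow> ('a \<Rightarrow> complex) set" where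
  "L2_closed_span M I e = {f \<in> L2fun M. \<forall>\<epsilon>>0. \<exists>F c. finite F \<and> F \<subseteq> I \<and>
     L2norm M (\<lambda>x. f x - (\<Sum>i\<in>F. c i * e i x)) < \<epsilon>}"

lemma L2_orthonormal_basis_iff:
  "L2_orthonormal_basis M I e \<longleftrightarrow> (\<forall>i\<in>I. e i \<in> L2fun M) \<and>
     (\<forall>i\<in>I. \<forall>k\<in>I. L2inner M (e i) (e k) = (if i = k then 1 else 0)) \<and> L2fun M \<subseteq> L2_closed_span M I e"
proof -
  have "L2fun M \<subseteq> {f \<in> L2fun M. P f} \<longleftrightarrow> (\<forall>f\<in>L2fun M. P f)" for P by blast
  thus ?thesis unfolding L2_orthonormal_basis_def L2_closed_span_def by presburger
qed

context
  fixes M :: "'a measure" and I :: "'i set" and e :: "'i \<Rightarrow> 'a \<Rightarrow> complex"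
  assumes e: "\<And>i. i \<in> I \<Longrightarrow> e i \<in> L2fun M"
begin

lemma L2_closed_span_D: "f \<in> L2_closed_span M I e \<Longrightarrow> f \<in> L2fun M"
  by (simp add: L2_closed_span_def)

lemma L2_closed_span_approx:
  assumes "f \<in> L2_closed_span M I e" "\<epsilon> > 0"
  obtains F c where "finite F" "F \<subseteq> I" "(\<lambda>x. \<Sum>i\<in>F. c i * e i x) \<in> L2fun M"
    "L2norm M (\<lambda>x. f x - (\<Sum>i\<in>F. c i * e i x)) < \<epsilon>"
proof -
  obtain F c where F: "finite F" "F \<subseteq> I" "L2norm M (\<lambda>x. f x - (\<Sum>i\<in>F. c i * e i x)) < \<epsilon>"
    using assms unfolding L2_closed_span_def by blast
  moreover have "(\<lambda>x. \<Sum>i\<in>F. c i * e i x) \<in> L2fun M"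
    using F(2) e by (intro L2fun_lincomb) auto
  ultimately show ?thesis using that by blast
qed

lemma L2_closed_span_base: "i \<in> I \<Longrightarrow> e i \<in> L2_closed_span M I e"
  unfolding L2_closed_span_def
proof (intro CollectI conjI allI impI)
  fix \<epsilon> :: real assume "i \<in> I" "\<epsilon> > 0"
  thus "\<exists>F c. finite F \<and> F \<subseteq> I \<and> L2norm M (\<lambda>x. e i x - (\<Sum>i\<in>F. c i * e i x)) < \<epsilon>"
    by (intro exI[of _ "{i}"] exI[of _ "\<lambda>_. 1"]) (simp add: L2norm_def)
qed (use e in auto)

lemma L2_closed_span_limit:
  assumes f: "f \<in> L2fun M"
    and g: "\<And>\<epsilon>. \<epsilon> > 0 \<Longrightarrow> \<exists>g\<in>L2_closed_span M I e. L2norm M (\<lambda>x. f x - g x) < \<epsilon>"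
  shows "f \<in> L2_closed_span M I e"
  unfolding L2_closed_span_def
proof (intro CollectI conjI allI impI)
  fix \<epsilon> :: real assume \<epsilon>: "\<epsilon> > 0"
  obtain g where g: "g \<in> L2_closed_span M I e" "L2norm M (\<lambda>x. f x - g x) < \<epsilon> / 2"
    using assms(2)[of "\<epsilon> / 2"] \<epsilon> by auto
  obtain F c where F: "finite F" "F \<subseteq> I" "(\<lambda>x. \<Sum>i\<in>F. c i * e i x) \<in> L2fun M"
    "L2norm M (\<lambda>x. g x - (\<Sum>i\<in>F. c i * e i x)) < \<epsilon> / 2"
    using L2_closed_span_approx[OF g(1), of "\<epsilon> / 2"] \<epsilon> by auto
  have "L2norm M (\<lambda>x. f x - (\<Sum>i\<in>F. c i * e i x)) < \<epsilon>"
    using L2norm_triangle_diff[OF f L2_closed_span_D[OF g(1)] F(3)] g(2) F(4) by linarith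
  thus "\<exists>F c. finite F \<and> F \<subseteq> I \<and> L2norm M (\<lambda>x. f x - (\<Sum>i\<in>F. c i * e i x)) < \<epsilon>"
    using F by blast
qed (rule f)

lemma L2_closed_span_dominated:
  assumes f: "\<And>n. f n \<in> L2_closed_span M I e" and g: "g \<in> L2fun M" and w: "w \<in> L2fun M"
    and lim: "AE x in M. (\<lambda>n. f n x) \<longlonglongrightarrow> g x"
    and bnd: "\<And>n. AE x in M. cmod (f n x - g x) \<le> cmod (w x)"
  shows "g \<in> L2_closed_span M I e"
proof (rule L2_closed_span_limit[OF g])
  fix \<epsilon> :: real assume "\<epsilon> > 0"
  have "(\<lambda>n. L2norm M (\<lambda>x. g x - f n x)) \<longlonglongrightarrow> 0"
    using L2norm_dominated[OF L2_closed_span_D[OF f] g w lim bnd] .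
  from order_tendstoD(2)[OF this \<open>\<epsilon> > 0\<close>]
  show "\<exists>h\<in>L2_closed_span M I e. L2norm M (\<lambda>x. g x - h x) < \<epsilon>"
    using f by (auto simp: eventually_sequentially)
qed

lemma L2_closed_span_cong_AE:
  assumes f: "f \<in> L2_closed_span M I e" and g: "g \<in> borel_measurable M" "AE x in M. f x = g x"
  shows "g \<in> L2_closed_span M I e"
proof -
  have gL: "g \<in> L2fun M"
    by (rule L2fun_bound[OF L2_closed_span_D[OF f] g(1), where c = 1]) (use g(2) in auto)
  show ?thesis
    \<comment> \<open>A constant sequence converges almost everywhere to \<open>g\<close>, and the
      differences are dominated by the zero function.\<close>
    by (rule L2_closed_span_dominated[where f = "\<lambda>_. f", OF f gL L2fun_zero]) (use g(2) in auto)
qed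

lemma L2_closed_span_cmult:
  assumes f: "f \<in> L2_closed_span M I e"
  shows "(\<lambda>x. a * f x) \<in> L2_closed_span M I e"
proof -
  have "\<exists>F c. finite F \<and> F \<subseteq> I \<and> L2norm M (\<lambda>x. a * f x - (\<Sum>i\<in>F. c i * e i x)) < \<epsilon>" if \<epsilon>: "\<epsilon> > 0" for \<epsilon>
  proof -
    have pos: "\<epsilon> / (cmod a + 1) > 0" using \<epsilon> by (simp add: add_nonneg_pos)
    obtain F c where F: "finite F" "F \<subseteq> I" "L2norm M (\<lambda>x. f x - (\<Sum>i\<in>F. c i * e i x)) < \<epsilon> / (cmod a + 1)"
      using L2_closed_span_approx[OF f pos] by metis
    have "(\<lambda>x. a * f x - (\<Sum>i\<in>F. (a * c i) * e i x)) = (\<lambda>x. a * (f x - (\<Sum>i\<in>F. c i * e i x)))"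
      by (simp add: right_diff_distrib sum_distrib_left mult.assoc)
    hence "L2norm M (\<lambda>x. a * f x - (\<Sum>i\<in>F. (a * c i) * e i x)) \<le> (cmod a + 1) * L2norm M (\<lambda>x. f x - (\<Sum>i\<in>F. c i * e i x))"
      by (simp add: L2norm_cmult mult_right_mono)
    also have "\<dots> < \<epsilon>" 
      using F(3) by (subst (asm) pos_less_divide_eq) (auto simp: mult.commute add_nonneg_pos)
    finally show ?thesis using F by (intro exI[of _ F] exI[of _ "\<lambda>i. a * c i"]) auto
  qed
  thus ?thesis using L2fun_cmult[OF L2_closed_span_D[OF f]] by (simp add: L2_closed_span_def)
qed

lemma L2_closed_span_add:
  assumes f: "f \<in> L2_closed_span M I e" and g: "g \<in> L2_closed_span M I e"
  shows "(\<lambda>x. f x + g x) \<in> L2_closed_span M I e"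
proof -
  have "\<exists>F c. finite F \<and> F \<subseteq> I \<and> L2norm M (\<lambda>x. (f x + g x) - (\<Sum>i\<in>F. c i * e i x)) < \<epsilon>" if \<epsilon>: "\<epsilon> > 0" for \<epsilon>
  proof -
    obtain F c where F: "finite F" "F \<subseteq> I" "(\<lambda>x. \<Sum>i\<in>F. c i * e i x) \<in> L2fun M"
      "L2norm M (\<lambda>x. f x - (\<Sum>i\<in>F. c i * e i x)) < \<epsilon> / 2"
      using L2_closed_span_approx[OF f, of "\<epsilon> / 2"] \<epsilon> by auto
    obtain F' c' where F': "finite F'" "F' \<subseteq> I" "(\<lambda>x. \<Sum>i\<in>F'. c' i * e i x) \<in> L2fun M"
      "L2norm M (\<lambda>x. g x - (\<Sum>i\<in>F'. c' i * e i x)) < \<epsilon> / 2"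
      using L2_closed_span_approx[OF g, of "\<epsilon> / 2"] \<epsilon> by auto
    obtain d where "\<And>x. (\<Sum>i\<in>F. c i * e i x) + (\<Sum>i\<in>F'. c' i * e i x) = (\<Sum>i\<in>F \<union> F'. d i * e i x)"
      using lincomb_add[OF F(1) F'(1)] by blast
    hence "L2norm M (\<lambda>x. (f x + g x) - (\<Sum>i\<in>F \<union> F'. d i * e i x)) < \<epsilon>"
      using L2norm_triangle[OF L2fun_diff[OF L2_closed_span_D[OF f] F(3)] L2fun_diff[OF L2_closed_span_D[OF g] F'(3)]] F(4) F'(4)
      by (simp add: algebra_simps)
    thus ?thesis using F F' by (intro exI[of _ "F \<union> F'"] exI[of _ d]) auto
  qed
  thus ?thesis using L2fun_add[OF L2_closed_span_D[OF f] L2_closed_span_D[OF g]] by (simp add: L2_closed_span_def)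
qed

lemma L2_closed_span_zero: "(\<lambda>x. 0) \<in> L2_closed_span M I e"
  unfolding L2_closed_span_def by (auto intro!: exI[of _ "{}"] simp: L2norm_def)

lemma L2_closed_span_sum:
  "(\<And>j. j \<in> J \<Longrightarrow> f j \<in> L2_closed_span M I e) \<Longrightarrow> (\<lambda>x. \<Sum>j\<in>J. f j x) \<in> L2_closed_span M I e"
  by (induction J rule: infinite_finite_induct) (auto intro!: L2_closed_span_add L2_closed_span_zero)

lemma L2_closed_span_diff:
  assumes "f \<in> L2_closed_span M I e" "g \<in> L2_closed_span M I e"
  shows "(\<lambda>x. f x - g x) \<in> L2_closed_span M I e"
  using L2_closed_span_add[OF assms(1) L2_closed_span_cmult[OF assms(2), of "-1"]] by simp

text \<open>Simple functions s_i with |s_i| \<le> 2|f| approximate f. The bound makes them vanish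
  where f does, so only indicators of sets inside the support of f have to be supplied; this is what
  keeps approximation local later.\<close>

lemma L2_closed_span_indicators:
  assumes f: "f \<in> L2fun M"
    and ind: "\<And>E. E \<in> sets M \<Longrightarrow> emeasure M E < \<infinity> \<Longrightarrow> E \<subseteq> {x. f x \<noteq> 0} \<Longrightarrow> indicator E \<in> L2_closed_span M I e"
  shows "f \<in> L2_closed_span M I e"
proof -
  have fm: "f \<in> borel_measurable M" using f by (rule L2fun_meas)
  obtain s where s: "\<And>i. simple_function M (s i)" 
    and lim: "\<And>x. x \<in> space M \<Longrightarrow> (\<lambda>i. s i x) \<longlonglongrightarrow> f x"
    and bnd: "\<And>i x. x \<in> space M \<Longrightarrow> dist (s i x) 0 \<le> 2 * dist (f x) 0"
    using borel_measurable_implies_sequence_metric[OF fm, of 0] by metis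
  have sL: "s i \<in> L2fun M" for i
    using bnd by (intro L2fun_bound[OF f, where c = 2] borel_measurable_simple_function s AE_I2) simp
  have "s i \<in> L2_closed_span M I e" for i
  proof -
    define E where "E y = s i -` {y} \<inter> space M" for y
    have "indicator (E y) \<in> L2_closed_span M I e" if y: "y \<noteq> 0" for y
    proof (rule ind)
      show Em: "E y \<in> sets M" unfolding E_def using simple_functionD(2)[OF s] by blast
      show "E y \<subseteq> {x. f x \<noteq> 0}" using bnd[of _ i] y by (fastforce simp: E_def)
      \<comment> \<open>Chebyshev's inequality: a level set of a square-integrable function at a
        nonzero value has finite measure.\<close>
      have "ennreal ((cmod y)\<^sup>2) * emeasure M (E y) = (\<integral>\<^sup>+x. ennreal ((cmod y)\<^sup>2) * indicator (E y) x \<partial>M)"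
        using Em by (simp add: nn_integral_cmult_indicator)
      also have "\<dots> \<le> (\<integral>\<^sup>+x. ennreal ((cmod (s i x))\<^sup>2) \<partial>M)"
        by (intro nn_integral_mono) (auto simp: E_def indicator_def)
      also have "\<dots> < \<infinity>" by (simp add: nn_integral_L2[OF sL])
      finally show "emeasure M (E y) < \<infinity>" using y by (auto simp: ennreal_mult_less_top)
    qed
    hence "(\<lambda>x. \<Sum>y\<in>s i ` space M - {0}. y * indicator (E y) x) \<in> L2_closed_span M I e"
      by (intro L2_closed_span_sum L2_closed_span_cmult) auto
    moreover have "(\<Sum>y\<in>s i ` space M - {0}. y * indicator (E y) x) = s i x" if x: "x \<in> space M" for x
    proof -
      have fin: "finite (s i ` space M - {0})" using simple_functionD(1)[OF s] by auto
      have "(\<Sum>y\<in>s i ` space M - {0}. y * indicator (E y) x) = (\<Sum>y\<in>s i ` space M - {0}. if y = s i x then y else 0)"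
        using x by (intro sum.cong) (auto simp: E_def indicator_def)
      thus ?thesis using fin x by (simp add: sum.delta)
    qed
    ultimately show ?thesis
      by (elim L2_closed_span_cong_AE) (auto intro: borel_measurable_simple_function s AE_I2)
  qed
  thus ?thesis
  proof (rule L2_closed_span_dominated[OF _ f, where f = s])
    \<comment> \<open>The constant 3 comes from |s_n - f| \<le> |s_n| + |f| \<le> 2|f| +
      |f|.\<close>
    show "(\<lambda>x. 3 * f x) \<in> L2fun M" by (rule L2fun_cmult[OF f])
    show "AE x in M. cmod (s n x - f x) \<le> cmod (3 * f x)" for n
    proof (rule AE_I2)
      fix x assume "x \<in> space M"
      thus "cmod (s n x - f x) \<le> cmod (3 * f x)"
        using bnd[of x n] norm_triangle_ineq4[of "s n x" "f x"] by (simp add: norm_mult)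
    qed
  qed (use lim in auto)
qed

end

section \<open>Inner products, limits and comparison of norms\<close>

lemma L2inner_integrable:
  assumes f: "f \<in> L2fun M" and g: "g \<in> L2fun M"
  shows "integrable M (\<lambda>x. f x * cnj (g x))"
proof (rule Bochner_Integration.integrable_bound)
  show "integrable M (\<lambda>x. (cmod (f x))\<^sup>2 + (cmod (g x))\<^sup>2)"
    using L2fun_int[OF f] L2fun_int[OF g] by simp
  have "cmod a * cmod b \<le> (cmod a)\<^sup>2 + (cmod b)\<^sup>2" for a b
  proof -
    have "0 \<le> (cmod a - cmod b)\<^sup>2 + (cmod a)\<^sup>2 + (cmod b)\<^sup>2" by simp
    thus ?thesis by (simp add: power2_diff)
  qed
  thus "AE x in M. norm (f x * cnj (g x)) \<le> norm ((cmod (f x))\<^sup>2 + (cmod (g x))\<^sup>2)"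
    by (intro AE_I2) (simp add: norm_mult)
qed (use L2fun_meas[OF f] L2fun_meas[OF g] in \<open>auto intro!: borel_measurable_times borel_measurable_continuous_on[OF continuous_on_cnj[OF continuous_on_id]]\<close>)

lemma L2inner_self: "L2inner M f f = of_real (L2sq M f)"
  unfolding L2inner_def L2sq_def complex_norm_square[symmetric] by (rule integral_complex_of_real)

lemma L2sq_add:
  assumes f: "f \<in> L2fun M" and g: "g \<in> L2fun M"
  shows "L2sq M (\<lambda>x. f x + g x) = L2sq M f + L2sq M g + 2 * Re (L2inner M f g)"
proof -
  have "(cmod (a + b))\<^sup>2 = (cmod a)\<^sup>2 + (cmod b)\<^sup>2 + 2 * Re (a * cnj b)" for a b
    unfolding cmod_power2 by (simp add: power2_eq_square algebra_simps)
  hence "L2sq M (\<lambda>x. f x + g x) = (\<integral>x. (cmod (f x))\<^sup>2 + (cmod (g x))\<^sup>2 + 2 * Re (f x * cnj (g x)) \<partial>M)"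
    unfolding L2sq_def by presburger
  also have "\<dots> = L2sq M f + L2sq M g + 2 * (\<integral>x. Re (f x * cnj (g x)) \<partial>M)"
  proof -
    have i3: "integrable M (\<lambda>x. 2 * Re (f x * cnj (g x)))"
      by (intro integrable_mult_right integrable_Re L2inner_integrable f g)
    show ?thesis
      unfolding L2sq_def Bochner_Integration.integral_add[OF L2fun_int[OF f] L2fun_int[OF g], symmetric]
        integral_mult_right_zero[symmetric]
      by (rule Bochner_Integration.integral_add[OF _ i3]) (intro Bochner_Integration.integrable_add L2fun_int f g)
  qed
  also have "(\<integral>x. Re (f x * cnj (g x)) \<partial>M) = Re (L2inner M f g)"
    unfolding L2inner_def by (rule integral_Re[OF L2inner_integrable[OF f g]])
  finally show ?thesis .
qed

lemma L2inner_cmult_right: "L2inner M f (\<lambda>x. c * g x) = cnj c * L2inner M f g"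
proof -
  have "(\<lambda>x. f x * cnj (c * g x)) = (\<lambda>x. cnj c * (f x * cnj (g x)))" by (simp add: mult_ac)
  thus ?thesis by (simp add: L2inner_def)
qed

text \<open>The real part comes from f + g, and the imaginary part from f + \<i>g because Re of the
  inner product of f with \<i>g is the imaginary part of that of f with g. Hence a linear map that
  preserves norms preserves inner products.\<close>

lemma L2inner_polarization:
  assumes "f \<in> L2fun M" "g \<in> L2fun M"
  shows "L2inner M f g = Complex ((L2sq M (\<lambda>x. f x + g x) - L2sq M f - L2sq M g) / 2)
     ((L2sq M (\<lambda>x. f x + \<i> * g x) - L2sq M f - L2sq M g) / 2)"
proof -
  have "L2sq M (\<lambda>x. \<i> * g x) = L2sq M g" by (simp add: L2sq_def norm_mult)
  thus ?thesis
    using L2sq_add[OF assms] L2sq_add[OF assms(1) L2fun_cmult[OF assms(2), of \<i>]]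
    by (simp add: L2inner_cmult_right complex_eq_iff)
qed

lemma L2sq_lincomb:
  assumes "finite F" and e: "\<And>i. i \<in> F \<Longrightarrow> e i \<in> L2fun M"
  shows "of_real (L2sq M (\<lambda>x. \<Sum>i\<in>F. c i * e i x)) = (\<Sum>i\<in>F. \<Sum>j\<in>F. c i * cnj (c j) * L2inner M (e i) (e j))"
proof -
  have "of_real (L2sq M (\<lambda>x. \<Sum>i\<in>F. c i * e i x)) = L2inner M (\<lambda>x. \<Sum>i\<in>F. c i * e i x) (\<lambda>x. \<Sum>i\<in>F. c i * e i x)"
    by (simp add: L2inner_self)
  also have "\<dots> = (\<integral>x. (\<Sum>i\<in>F. \<Sum>j\<in>F. c i * cnj (c j) * (e i x * cnj (e j x))) \<partial>M)"
    unfolding L2inner_def by (simp add: sum_product mult_ac)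
  also have "\<dots> = (\<Sum>i\<in>F. \<Sum>j\<in>F. c i * cnj (c j) * L2inner M (e i) (e j))"
    using e unfolding L2inner_def by (simp add: L2inner_integrable)
  finally show ?thesis .
qed

text \<open>Transforms of approximants are known to converge pointwise, not in norm. Fatou's lemma
  turns this into membership in L^2 and a one-sided norm bound; the bounds may vary with k, and only
  their limit enters.\<close>

lemma L2fun_Fatou:
  assumes u: "\<And>k. u k \<in> L2fun M" and b: "\<And>k. L2norm M (u k) \<le> b k" "b \<longlonglongrightarrow> B"
    and v: "v \<in> borel_measurable M" and lim: "AE x in M. (\<lambda>k. u k x) \<longlonglongrightarrow> v x"
  shows "v \<in> L2fun M" "L2norm M v \<le> B"
proof -
  have B: "B \<ge> 0" using b by (intro LIMSEQ_le_const[OF b(2)]) (metis L2norm_nonneg order_trans)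
  have "(\<integral>\<^sup>+x. ennreal ((cmod (v x))\<^sup>2) \<partial>M) = (\<integral>\<^sup>+x. liminf (\<lambda>k. ennreal ((cmod (u k x))\<^sup>2)) \<partial>M)"
  proof (rule nn_integral_cong_AE, use lim in eventually_elim)
    case (elim x)
    hence "(\<lambda>k. ennreal ((cmod (u k x))\<^sup>2)) \<longlonglongrightarrow> ennreal ((cmod (v x))\<^sup>2)"
      by (intro tendsto_intros tendsto_ennrealI)
    from lim_imp_Liminf[OF _ this] show ?case by simp
  qed
  also have "\<dots> \<le> liminf (\<lambda>k. \<integral>\<^sup>+x. ennreal ((cmod (u k x))\<^sup>2) \<partial>M)"
    using L2fun_meas[OF u] by (intro nn_integral_liminf) simp
  also have "\<dots> \<le> liminf (\<lambda>k. ennreal ((b k)\<^sup>2))"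
  proof (intro Liminf_mono always_eventually allI)
    fix k
    have "L2sq M (u k) \<le> (b k)\<^sup>2"
      unfolding L2norm_sq[symmetric] using b(1) by (intro power_mono) auto
    thus "(\<integral>\<^sup>+x. ennreal ((cmod (u k x))\<^sup>2) \<partial>M) \<le> ennreal ((b k)\<^sup>2)"
      by (simp add: nn_integral_L2[OF u] ennreal_leI)
  qed
  also have "\<dots> = ennreal (B\<^sup>2)"
    by (intro lim_imp_Liminf tendsto_ennrealI tendsto_intros b(2)) simp
  finally have le: "(\<integral>\<^sup>+x. ennreal ((cmod (v x))\<^sup>2) \<partial>M) \<le> ennreal (B\<^sup>2)" .
  have "integrable M (\<lambda>x. (cmod (v x))\<^sup>2)"
    using v le by (intro integrableI_nonneg) (auto simp: le_less_trans)
  thus vL: "v \<in> L2fun M" using v by (simp add: L2fun_def)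
  have "L2sq M v \<le> B\<^sup>2"
    using le by (simp add: nn_integral_L2[OF vL])
  thus "L2norm M v \<le> B" unfolding L2norm_eq using B by (intro real_le_lsqrt) auto
qed

text \<open>The inequality |g| \<le> (a + |g|^2/a)/2 on A replaces Cauchy-Schwarz; the parameter a
  is meant to be of the order of the L^2 error.\<close>

lemma L1_le_L2:
  assumes g: "g \<in> L2fun M" and A: "A \<in> sets M" "emeasure M A < \<infinity>"
    and z: "\<And>x. x \<in> space M \<Longrightarrow> x \<notin> A \<Longrightarrow> g x = 0" and a: "a > 0"
  shows "integrable M g" "(\<integral>x. cmod (g x) \<partial>M) \<le> (a * measure M A + L2sq M g / a) / 2"
proof -
  have int: "integrable M (\<lambda>x. (a * indicator A x + (cmod (g x))\<^sup>2 / a) / 2)"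
    using L2fun_int[OF g] A by simp
  have le: "cmod (g x) \<le> (a * indicator A x + (cmod (g x))\<^sup>2 / a) / 2" if "x \<in> space M" for x
  proof (cases "x \<in> A")
    case True
    have "0 \<le> (a - cmod (g x))\<^sup>2 / a" using a by simp
    also have "\<dots> = a - 2 * cmod (g x) + (cmod (g x))\<^sup>2 / a"
      using a by (simp add: field_simps power2_eq_square)
    finally show ?thesis using True by simp
  qed (use z that in simp)
  show gi: "integrable M g"
    by (rule Bochner_Integration.integrable_bound[OF int L2fun_meas[OF g]], rule AE_I2)
      (use le in \<open>auto intro: order_trans[OF _ abs_ge_self]\<close>)
  have "(\<integral>x. cmod (g x) \<partial>M) \<le> (\<integral>x. (a * indicator A x + (cmod (g x))\<^sup>2 / a) / 2 \<partial>M)"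
    by (rule integral_mono[OF _ int]) (use gi le in auto)
  also have "\<dots> = (a * measure M A + L2sq M g / a) / 2"
    using L2fun_int[OF g] A sets.sets_into_space[OF A(1)] by (simp add: L2sq_def Int_absorb2)
  finally show "(\<integral>x. cmod (g x) \<partial>M) \<le> (a * measure M A + L2sq M g / a) / 2" .
qed

section \<open>Invariance and scaling of the Haar measure\<close>

lemma Union_cosets_meas:
  assumes "p > 0" "E \<subseteq> vilenkin p" "\<And>x. x \<in> E \<Longrightarrow> \<exists>l. vcoset p x l \<subseteq> E"
  shows "E \<in> sets (vborel p)"
proof -
  have "E = \<Union>{V. openin (vtop p) V \<and> V \<subseteq> E}"
  proof (intro equalityI subsetI)
    fix x assume x: "x \<in> E"
    then obtain l where "vcoset p x l \<subseteq> E" using assms(3) by blast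
    moreover have "x \<in> vcoset p x l" "openin (vtop p) (vcoset p x l)"
      using x assms(2) openin_coset[OF assms(1), of x l] by (simp add: vcoset_def subset_iff, blast)
    ultimately show "x \<in> \<Union>{V. openin (vtop p) V \<and> V \<subseteq> E}" by blast
  qed auto
  moreover have "openin (vtop p) (\<Union>{V. openin (vtop p) V \<and> V \<subseteq> E})"
    by (rule openin_Union) auto
  ultimately have "openin (vtop p) E" by simp
  thus ?thesis unfolding vborel_def
    by (subst sets_measure_of[OF open_sub[OF assms(1)]]) auto
qed

text \<open>Every preimage, of whatever set, is a union of cosets and therefore open.\<close>

lemma locally_constant_measurable:
  assumes "p > 0" "f \<in> vilenkin p \<rightarrow> space N"
    "\<And>x. x \<in> vilenkin p \<Longrightarrow> \<exists>l. \<forall>y\<in>vcoset p x l. f y = f x"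
  shows "f \<in> measurable (vborel p) N"
proof (rule measurableI)
  fix A assume A: "A \<in> sets N"
  show "f -` A \<inter> space (vborel p) \<in> sets (vborel p)"
  proof (rule Union_cosets_meas[OF assms(1)])
    fix x assume x: "x \<in> f -` A \<inter> space (vborel p)"
    hence "x \<in> vilenkin p" using assms(1) by (simp add: space_vborel)
    then obtain l where l: "\<forall>y\<in>vcoset p x l. f y = f x" using assms(3) by blast
    have "vcoset p x l \<subseteq> f -` A \<inter> space (vborel p)"
      using l x assms(1) by (auto simp: space_vborel vcoset_def)
    thus "\<exists>l. vcoset p x l \<subseteq> f -` A \<inter> space (vborel p)" by blast
  qed (use assms(1) in \<open>auto simp: space_vborel\<close>)
qed (use assms in \<open>auto simp: space_vborel\<close>)

lemma vcoset_sub: "vcoset p x l \<subseteq> vilenkin p"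
  by (auto simp: vcoset_def)

lemma self_in_vcoset: "x \<in> vilenkin p \<Longrightarrow> x \<in> vcoset p x l"
  by (simp add: vcoset_def)

lemma coset_continuous_measurable:
  assumes "p > 0" "f \<in> vilenkin p \<rightarrow> vilenkin p"
    "\<And>x l. x \<in> vilenkin p \<Longrightarrow> \<exists>m. f ` vcoset p x m \<subseteq> vcoset p (f x) l"
  shows "f \<in> measurable (vborel p) (vborel p)"
proof (rule measurable_sigma_sets[OF sets_vborel[OF assms(1)] vcosets_sub])
  show "f \<in> space (vborel p) \<rightarrow> vilenkin p" using assms by (auto simp: space_vborel)
  fix c assume "c \<in> vcosets p"
  then obtain y l where c: "c = vcoset p y l" by (auto simp: vcosets_def)
  show "f -` c \<inter> space (vborel p) \<in> sets (vborel p)"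
  proof (rule Union_cosets_meas[OF assms(1)])
    fix x assume x: "x \<in> f -` c \<inter> space (vborel p)"
    hence xG: "x \<in> vilenkin p" using assms(1) by (simp add: space_vborel)
    then obtain m where m: "f ` vcoset p x m \<subseteq> vcoset p (f x) l" using assms(3) by blast
    have "vcoset p (f x) l = c" using x c by (auto simp: vcoset_def)
    hence "vcoset p x m \<subseteq> f -` c \<inter> space (vborel p)"
      using m vcoset_sub[of p x m] assms(1) by (auto simp: space_vborel)
    thus "\<exists>l. vcoset p x l \<subseteq> f -` c \<inter> space (vborel p)" by blast
  qed (use assms(1) in \<open>auto simp: space_vborel\<close>)
qed

lemma vshift_in: "x \<in> vilenkin p \<Longrightarrow> vshift k x \<in> vilenkin p"
  unfolding vilenkin_def vshift_def
proof clarsimp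
  fix l assume "\<forall>j<l. x j = 0"
  thus "\<exists>l. \<forall>j<l. x (j + k) = 0" by (intro exI[of _ "l - k"]) auto
qed

lemma vshift_inv [simp]: "vshift k (vshift (- k) x) = x" "vshift (- k) (vshift k x) = x"
  by (auto simp: vshift_def)

lemma vshift_vshift: "vshift k (vshift l x) = vshift (k + l) x"
  by (simp add: vshift_add)

lemma vshift_zero [simp]: "vshift 0 x = x"
  by (simp add: vshift_0)

lemma inj_vshift: "inj (vshift k)"
  by (rule inj_on_inverseI[where g = "vshift (- k)"]) simp

lemma vshift_image: "vshift k ` E = vshift (- k) -` E"
proof (intro equalityI subsetI)
  fix x assume "x \<in> vshift (- k) -` E"
  hence "vshift k (vshift (- k) x) \<in> vshift k ` E" by blast
  thus "x \<in> vshift k ` E" by simp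
qed auto

lemma vshift_image_iff: "x \<in> vshift k ` E \<longleftrightarrow> vshift (- k) x \<in> E"
  by (simp add: vshift_image)

lemma vshift_vimage:
  "E \<subseteq> vilenkin p \<Longrightarrow> vshift k -` E \<inter> vilenkin p = vshift (- k) ` E"
  by (auto simp: vshift_image_iff dest: vshift_in[where k = "- k"])

lemma vshift_vadd: "vshift k (vadd p x y) = vadd p (vshift k x) (vshift k y)"
  by (simp add: vshift_def vadd_def)

lemma vshift_coset: "vshift k ` vcoset p x l = vcoset p (vshift k x) (l - k)"
proof (intro equalityI subsetI)
  fix y assume y: "y \<in> vcoset p (vshift k x) (l - k)"
  have "vshift (- k) y j = x j" if "j \<le> l" for j
  proof -
    have "y (j - k) = x (j - k + k)" using y that by (auto simp: vcoset_def vshift_def)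
    thus ?thesis by (simp add: vshift_def)
  qed
  thus "y \<in> vshift k ` vcoset p x l"
    using y vshift_in[of y p "- k"] by (auto simp: vshift_image_iff vcoset_def)
next
  fix y assume "y \<in> vshift k ` vcoset p x l"
  thus "y \<in> vcoset p (vshift k x) (l - k)" 
    by (auto simp: vcoset_def vshift_in) (auto simp: vshift_def)
qed

section \<open>Group arithmetic and the splitting of G into U and H\<close>

definition vneg :: "nat \<Rightarrow> (int \<Rightarrow> int) \<Rightarrow> int \<Rightarrow> int" where
  "vneg p x = vsub p (\<lambda>_. 0) x"

lemma vneg_in: "p > 0 \<Longrightarrow> x \<in> vilenkin p \<Longrightarrow> vneg p x \<in> vilenkin p"
  by (simp add: vneg_def vsub_in vzero_in)

lemma vadd_comm: "vadd p x y = vadd p y x"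
  by (simp add: vadd_def add.commute)

lemma vadd_assoc: "vadd p (vadd p x y) z = vadd p x (vadd p y z)"
  by (simp add: vadd_def mod_simps add.assoc)

lemma vsub_eq_vadd_vneg: "vsub p x y = vadd p x (vneg p y)"
  by (simp add: vadd_def vneg_def vsub_def mod_simps)

lemma vadd_vneg: "vadd p x (vneg p x) = (\<lambda>_. 0)"
  by (rule ext) (simp add: vadd_def vneg_def vsub_def mod_simps)

lemma vadd_vneg_cancel: "y \<in> vilenkin p \<Longrightarrow> vadd p x (vadd p (vneg p x) y) = y"
  "y \<in> vilenkin p \<Longrightarrow> vadd p (vneg p x) (vadd p x y) = y"
  "y \<in> vilenkin p \<Longrightarrow> vadd p (vadd p y x) (vneg p x) = y"
  "y \<in> vilenkin p \<Longrightarrow> vadd p (vadd p y (vneg p x)) x = y"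
  by (rule ext, simp add: vadd_def vneg_def vsub_def mod_simps vil_mod)+

lemma vH_in: "h \<in> vH p \<Longrightarrow> h \<in> vilenkin p"
  by (simp add: vH_def)

lemma vH_vadd: "p > 0 \<Longrightarrow> h \<in> vH p \<Longrightarrow> k \<in> vH p \<Longrightarrow> vadd p h k \<in> vH p"
  by (auto simp: vH_def vadd_in) (auto simp: vadd_def)

lemma vH_vneg: "p > 0 \<Longrightarrow> h \<in> vH p \<Longrightarrow> vneg p h \<in> vH p"
  by (auto simp: vH_def vneg_in) (auto simp: vneg_def vsub_def)

lemma vH_zero: "p > 0 \<Longrightarrow> (\<lambda>_. 0) \<in> vH p"
  by (simp add: vH_def vzero_in)

lemma vH_trunc: "p > 0 \<Longrightarrow> x \<in> vilenkin p \<Longrightarrow> vtrunc 0 x \<in> vH p"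
  by (simp add: vH_def vtrunc_in) (simp add: vtrunc_def)

text \<open>Projection to the fundamental domain U = \<open>vnbhd p 0\<close> along H. Together with
  \<open>vtrunc 0\<close>, the projection to H, it splits every element uniquely, without carries
  because addition is coordinatewise.\<close>

definition vfrac :: "(int \<Rightarrow> int) \<Rightarrow> int \<Rightarrow> int" where
  "vfrac x = (\<lambda>j. if j \<le> 0 then 0 else x j)"

lemma vfrac_in: "p > 0 \<Longrightarrow> x \<in> vilenkin p \<Longrightarrow> vfrac x \<in> vnbhd p 0"
  by (auto simp: vnbhd_def vfrac_def vilenkin_def)

lemma vnbhd_in: "x \<in> vnbhd p l \<Longrightarrow> x \<in> vilenkin p"
  by (simp add: vnbhd_def)

lemma vadd_vfrac_vtrunc: "x \<in> vilenkin p \<Longrightarrow> vadd p (vfrac x) (vtrunc 0 x) = x"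
  by (rule ext) (auto simp: vadd_def vfrac_def vtrunc_def vil_mod)

lemma vfrac_vadd_vH:
  "x \<in> vilenkin p \<Longrightarrow> h \<in> vH p \<Longrightarrow> vfrac (vadd p x h) = vfrac x"
  by (rule ext) (auto simp: vfrac_def vadd_def vH_def vil_mod)

lemma vfrac_vnbhd: "x \<in> vnbhd p 0 \<Longrightarrow> vfrac x = x"
  by (auto simp: vfrac_def vnbhd_def)

section \<open>Translations and dilations on the completed Haar measure\<close>

locale vilenkin_group =
  fixes p :: nat
  assumes prime_p: "prime p"
begin

lemma p_gr_0: "p > 0" and p_gr_1: "p > 1"
  using prime_p prime_gt_0_nat prime_gt_1_nat by auto

abbreviation "G \<equiv> vilenkin p"
abbreviation "L \<equiv> vhaar p"

definition haar :: "(int \<Rightarrow> int) measure" where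
  "haar = (THE M. is_vhaar p M)"

lemma L_def: "L = completion haar"
  by (simp add: vhaar_def haar_def)

lemma is_vhaar_haar: "is_vhaar p haar"
  unfolding haar_def using ex1_vhaar[OF p_gr_0] by (rule theI')

lemma sets_haar: "sets haar = sets (vborel p)"
  using is_vhaar_haar by (simp add: is_vhaar_def)

lemma space_haar: "space haar = G"
  using sets_eq_imp_space_eq[OF sets_haar] by (simp add: space_vborel p_gr_0)

lemma space_L [simp]: "space L = G"
  by (simp add: L_def space_haar)

lemma borel_sets_L: "E \<in> sets (vborel p) \<Longrightarrow> E \<in> sets L"
  by (simp add: L_def sets_haar)

lemma borel_measurable_L: "f \<in> measurable (vborel p) N \<Longrightarrow> f \<in> measurable L N"
  unfolding L_def using measurable_cong_sets[OF sets_haar refl]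
  by (intro measurable_completion) blast

lemma emeasure_borel: "E \<in> sets (vborel p) \<Longrightarrow> emeasure L E = emeasure haar E"
  by (simp add: L_def sets_haar)

sublocale complete_measure L
  unfolding L_def by unfold_locales

text \<open>Cosets with a nonnegative index suffice, since \<open>vborel_eqI\<close> compares measures on these only.\<close>

lemma haar_scale_eqI:
  assumes T: "T \<in> measurable (vborel p) (vborel p)" and c: "c > 0"
    and eq: "\<And>x l. x \<in> G \<Longrightarrow> l \<ge> 0 \<Longrightarrow> emeasure haar (T -` vcoset p x l \<inter> G) = ennreal c * emeasure haar (vcoset p x l)"
  shows "distr haar haar T = density haar (\<lambda>_. ennreal c)"
proof (rule vborel_eqI[OF p_gr_0])
  have T': "T \<in> measurable haar haar"
    using T measurable_cong_sets[OF sets_haar sets_haar] by blast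
  fix x and l :: int assume x: "x \<in> G" "l \<ge> 0"
  show "emeasure (distr haar haar T) (vcoset p x l) = emeasure (density haar (\<lambda>_. ennreal c)) (vcoset p x l)"
    using T' coset_meas[OF p_gr_0 x(1), of l] eq[OF x]
    by (simp add: emeasure_distr sets_haar space_haar emeasure_density nn_integral_cmult_indicator)
next
  have T': "T \<in> measurable haar haar"
    using T measurable_cong_sets[OF sets_haar sets_haar] by blast
  fix x assume x: "x \<in> G"
  show "emeasure (distr haar haar T) (vcoset p x 0) \<noteq> \<infinity>"
    using T' coset_meas[OF p_gr_0 x, of 0] eq[OF x, of 0] haar_coset[OF p_gr_0 is_vhaar_haar x, of 0]
    by (simp add: emeasure_distr sets_haar space_haar)
qed (simp_all add: sets_haar)

text \<open>Since the image of Haar measure is a positive multiple of it, \<open>T\<close> pulls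
  null sets back to null sets, which is what measurability on the completion needs. The scaling
  identity follows by splitting a set into its Borel main part and a null part.\<close>

lemma distr_L_scale:
  assumes T: "T \<in> measurable (vborel p) (vborel p)" and c: "c > 0"
    and eq: "distr haar haar T = density haar (\<lambda>_. ennreal c)"
  shows "T \<in> measurable L L" "distr L L T = density L (\<lambda>_. ennreal c)"
proof -
  have T': "T \<in> measurable haar haar"
    using T measurable_cong_sets[OF sets_haar sets_haar] by blast
  have TL: "T \<in> measurable L haar" unfolding L_def using T' by (rule measurable_completion)
  have dL: "distr L haar T = density haar (\<lambda>_. ennreal c)"
    unfolding L_def distr_completion[OF T'] by (rule eq)
  have null: "null_sets (density haar (\<lambda>_. ennreal c)) = null_sets haar"
  proof -
    have "emeasure (density haar (\<lambda>_. ennreal c)) A = ennreal c * emeasure haar A" if "A \<in> sets haar" for A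
      using that by (simp add: emeasure_density nn_integral_cmult_indicator)
    thus ?thesis using c by (auto simp: null_sets_def)
  qed
  show TLL: "T \<in> measurable L L"
    unfolding L_def by (rule complete_measure.measurable_completion2)
      (use TL dL null in \<open>auto simp: L_def[symmetric] complete_measure_axioms\<close>)
  show "distr L L T = density L (\<lambda>_. ennreal c)"
  proof (rule measure_eqI)
    fix A assume "A \<in> sets (distr L L T)"
    hence A: "A \<in> sets L" by simp
    let ?m = "main_part haar A" and ?n = "null_part haar A"
    have m: "?m \<in> sets haar" and Aeq: "A = ?m \<union> ?n"
      using A by (auto simp: L_def main_part_null_part_Un)
    have n: "T -` ?n \<inter> space L \<in> null_sets L"
      using A TL dL null by (intro vimage_null_part_null_sets) (auto simp: L_def)
    have "emeasure (distr L L T) A = emeasure L (T -` A \<inter> space L)"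
      using TLL A by (simp add: emeasure_distr)
    also have "T -` A \<inter> space L = (T -` ?m \<inter> space L) \<union> (T -` ?n \<inter> space L)"
      by (subst Aeq) blast
    also have "emeasure L \<dots> = emeasure L (T -` ?m \<inter> space L)"
      using n measurable_sets[OF TL m] by (intro emeasure_Un_null_set) auto
    also have "\<dots> = emeasure (distr L haar T) ?m" using TL m by (simp add: emeasure_distr)
    also have "\<dots> = ennreal c * emeasure haar ?m"
      unfolding dL using m by (simp add: emeasure_density nn_integral_cmult_indicator)
    also have "emeasure haar ?m = emeasure L A" using A by (simp add: L_def)
    also have "ennreal c * emeasure L A = emeasure (density L (\<lambda>_. ennreal c)) A"
      using A by (simp add: emeasure_density nn_integral_cmult_indicator)
    finally show "emeasure (distr L L T) A = emeasure (density L (\<lambda>_. ennreal c)) A" .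
  qed simp
qed

lemma measurable_vadd_borel: "x \<in> G \<Longrightarrow> vadd p x \<in> measurable (vborel p) (vborel p)"
  using p_gr_0 by (intro coset_continuous_measurable) (auto simp: vadd_in vadd_coset intro!: exI)

lemma measurable_vshift_borel: "vshift k \<in> measurable (vborel p) (vborel p)"
proof (rule coset_continuous_measurable[OF p_gr_0])
  fix x l assume "x \<in> G"
  show "\<exists>m. vshift k ` vcoset p x m \<subseteq> vcoset p (vshift k x) l"
    by (rule exI[of _ "l + k"]) (simp add: vshift_coset)
qed (simp add: vshift_in)

lemma haar_coset': "x \<in> G \<Longrightarrow> l \<ge> 0 \<Longrightarrow> emeasure haar (vcoset p x l) = ennreal (1 / real p ^ nat l)"
  using haar_coset[OF p_gr_0 is_vhaar_haar, of x "nat l"] by simp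

lemma vadd_vimage: "x \<in> G \<Longrightarrow> E \<subseteq> G \<Longrightarrow> vadd p x -` E \<inter> G = vadd p (vneg p x) ` E"
proof (intro equalityI subsetI)
  fix y assume *: "y \<in> vadd p x -` E \<inter> G"
  hence "vadd p (vneg p x) (vadd p x y) \<in> vadd p (vneg p x) ` E" by blast
  thus "y \<in> vadd p (vneg p x) ` E" using * by (simp add: vadd_vneg_cancel)
next
  fix y assume "x \<in> G" "E \<subseteq> G" "y \<in> vadd p (vneg p x) ` E"
  thus "y \<in> vadd p x -` E \<inter> G"
    using p_gr_0 by (auto simp: vadd_vneg_cancel subset_iff intro!: vadd_in vneg_in)
qed

lemma
  assumes x: "x \<in> G"
  shows measurable_vadd: "vadd p x \<in> measurable L L"
    and distr_vadd: "distr L L (vadd p x) = L"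
proof -
  have "distr haar haar (vadd p x) = density haar (\<lambda>_. ennreal 1)"
  proof (rule haar_scale_eqI)
    fix y and l :: int assume y: "y \<in> G" "l \<ge> 0"
    show "emeasure haar (vadd p x -` vcoset p y l \<inter> G) = ennreal 1 * emeasure haar (vcoset p y l)"
      using x y p_gr_0
      by (simp add: vadd_vimage vcoset_sub vadd_coset vneg_in haar_coset' vadd_in)
  qed (use measurable_vadd_borel[OF x] in auto)
  from distr_L_scale[OF measurable_vadd_borel[OF x] _ this]
  show "vadd p x \<in> measurable L L" "distr L L (vadd p x) = L" by (auto simp: density_1)
qed

lemma vshift_scale_1:
  assumes E: "E \<in> sets L"
  shows "vshift 1 ` E \<in> sets L" "emeasure L (vshift 1 ` E) = ennreal (real p) * emeasure L E"
    "vshift (-1) ` E \<in> sets L" "emeasure L (vshift (-1) ` E) = ennreal (1 / real p) * emeasure L E"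
proof -
  have ES: "E \<subseteq> G" using sets.sets_into_space[OF E] by simp
  have d1: "distr haar haar (vshift 1) = density haar (\<lambda>_. ennreal (1 / real p))"
  proof (rule haar_scale_eqI)
    fix y and l :: int assume y: "y \<in> G" "l \<ge> 0"
    have "nat (l + 1) = Suc (nat l)" using y by simp
    thus "emeasure haar (vshift 1 -` vcoset p y l \<inter> G) = ennreal (1 / real p) * emeasure haar (vcoset p y l)"
      using y p_gr_0
      by (simp add: vshift_vimage vcoset_sub vshift_coset vshift_in haar_coset' ennreal_mult[symmetric] mult.commute)
  qed (use measurable_vshift_borel p_gr_0 in auto)
  have sc: "emeasure haar (vshift (-1) ` F) = ennreal (1 / real p) * emeasure haar F" if F: "F \<in> sets (vborel p)" for F
  proof -
    have "F \<subseteq> G" using sets.sets_into_space[OF F] by (simp add: space_vborel p_gr_0)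
    hence "emeasure haar (vshift (-1) ` F) = emeasure (distr haar haar (vshift 1)) F"
      using F measurable_vshift_borel[of 1]
      using vshift_vimage[of F p 1] measurable_cong_sets[OF sets_haar sets_haar]
      by (subst emeasure_distr) (simp_all add: sets_haar space_haar)
    also have "\<dots> = ennreal (1 / real p) * emeasure haar F"
      unfolding d1 using F by (simp add: emeasure_density nn_integral_cmult_indicator sets_haar)
    finally show ?thesis .
  qed
  \<comment> \<open>Here preimages of cosets have depth l - 1, which is -1 for l = 0 and thus
    outside the range where Haar values are known so far. The factor is obtained by inverting the
    result for the opposite shift.\<close>
  have d2: "distr haar haar (vshift (-1)) = density haar (\<lambda>_. ennreal (real p))"
  proof (rule haar_scale_eqI)
    fix y and l :: int assume y: "y \<in> G" "l \<ge> 0"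
    let ?c = "vcoset p y l"
    have "vshift (-1) ` vshift 1 ` ?c = ?c" by (simp add: image_image vshift_inv(2)[of 1])
    moreover have "vshift 1 ` ?c \<in> sets (vborel p)"
      using y p_gr_0 by (simp add: vshift_coset coset_meas vshift_in)
    ultimately have "emeasure haar ?c = ennreal (1 / real p) * emeasure haar (vshift 1 ` ?c)"
      using sc[of "vshift 1 ` ?c"] by simp
    hence "ennreal (real p) * emeasure haar ?c = (ennreal (real p) * ennreal (1 / real p)) * emeasure haar (vshift 1 ` ?c)"
      by (simp add: mult.assoc)
    thus "emeasure haar (vshift (-1) -` ?c \<inter> G) = ennreal (real p) * emeasure haar ?c"
      using p_gr_0 vshift_vimage[of ?c p "-1"] vcoset_sub[of p y l] by (simp add: ennreal_mult[symmetric])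
  qed (use measurable_vshift_borel p_gr_0 in auto)
  have r: "emeasure (density L (\<lambda>_. c)) E = c * emeasure L E" for c
    using E by (simp add: emeasure_density nn_integral_cmult_indicator)
  note d1' = distr_L_scale[OF measurable_vshift_borel _ d1] and d2' = distr_L_scale[OF measurable_vshift_borel _ d2]
  have v: "vshift 1 -` E \<inter> G = vshift (-1) ` E" "vshift (-1) -` E \<inter> G = vshift 1 ` E"
    using vshift_vimage[OF ES, of 1] vshift_vimage[OF ES, of "-1"] by auto
  show "vshift 1 ` E \<in> sets L" "vshift (-1) ` E \<in> sets L"
    using measurable_sets[OF d1'(1) E] measurable_sets[OF d2'(1) E] v p_gr_0 by auto
  show "emeasure L (vshift 1 ` E) = ennreal (real p) * emeasure L E"
    using emeasure_distr[OF d2'(1) E] r p_gr_0 v d2'(2) by simp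
  show "emeasure L (vshift (-1) ` E) = ennreal (1 / real p) * emeasure L E"
    using emeasure_distr[OF d1'(1) E] r p_gr_0 v d1'(2) by simp
qed

lemma vshift_scale:
  assumes "E \<in> sets L"
  shows "vshift k ` E \<in> sets L \<and> emeasure L (vshift k ` E) = ennreal (real p powr k) * emeasure L E"
proof (induction k rule: int_induct[where k = 0])
  case base
  thus ?case using assms p_gr_0 by (simp add: image_def)
next
  case (step1 i)
  have e: "vshift (i + 1) ` E = vshift 1 ` vshift i ` E"
    by (simp add: image_image vshift_vshift add.commute)
  have "ennreal (real p) * (ennreal (real p powr real_of_int i) * emeasure L E)
      = ennreal (real p * real p powr real_of_int i) * emeasure L E"
    by (simp only: mult.assoc[symmetric]) (subst ennreal_mult[symmetric], use p_gr_0 in auto)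
  also have "real p * real p powr real_of_int i = real p powr real_of_int (i + 1)"
    using p_gr_0 by (simp add: powr_add)
  finally show ?case unfolding e using vshift_scale_1(1,2)[of "vshift i ` E"] step1 by simp
next
  case (step2 i)
  have e: "vshift (i - 1) ` E = vshift (-1) ` vshift i ` E"
    by (simp add: image_image vshift_vshift)
  have "ennreal (1 / real p) * (ennreal (real p powr real_of_int i) * emeasure L E)
      = ennreal (1 / real p * real p powr real_of_int i) * emeasure L E"
    by (simp only: mult.assoc[symmetric]) (subst ennreal_mult[symmetric], use p_gr_0 in auto)
  also have "1 / real p * real p powr real_of_int i = real p powr real_of_int (i - 1)"
    using p_gr_0 by (simp add: powr_diff)
  finally show ?case unfolding e using vshift_scale_1(3,4)[of "vshift i ` E"] step2 by simp
qed

lemma measurable_vshift: "vshift k \<in> measurable L L"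
proof (rule measurableI)
  fix E assume "E \<in> sets L"
  thus "vshift k -` E \<inter> space L \<in> sets L"
    using vshift_vimage[of E p k] sets.sets_into_space[of E L] vshift_scale[of E "-k"] by simp
qed (simp add: vshift_in)

lemma distr_vshift: "distr L L (vshift k) = density L (\<lambda>_. ennreal (real p powr (- k)))"
proof (rule measure_eqI)
  fix E assume "E \<in> sets (distr L L (vshift k))"
  hence E: "E \<in> sets L" by simp
  thus "emeasure (distr L L (vshift k)) E = emeasure (density L (\<lambda>_. ennreal (real p powr (- k)))) E"
    using vshift_vimage[of E p k] sets.sets_into_space[OF E] vshift_scale[OF E, of "-k"]
    by (simp add: emeasure_distr measurable_vshift emeasure_density nn_integral_cmult_indicator)
qed simp

lemma coset_sets [measurable]: "x \<in> G \<Longrightarrow> vcoset p x l \<in> sets L"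
  by (intro borel_sets_L coset_meas p_gr_0)

lemma vnbhd_sets [measurable]: "vnbhd p l \<in> sets L"
  by (simp add: vnbhd_coset coset_sets vzero_in p_gr_0)

text \<open>A shift by l moves a coset of any depth, also a negative one, to depth 0, where the
  measure is 1.\<close>

lemma emeasure_coset:
  assumes x: "x \<in> G" shows "emeasure L (vcoset p x l) = ennreal (real p powr (- l))"
proof -
  have "vcoset p x l = vshift (-l) ` vcoset p (vshift l x) 0"
    by (simp add: vshift_coset)
  moreover have "emeasure L (vcoset p (vshift l x) 0) = 1"
    using x by (simp add: emeasure_borel coset_meas p_gr_0 vshift_in haar_coset')
  ultimately show ?thesis
    using vshift_scale[of "vcoset p (vshift l x) 0" "-l"] x by (simp add: coset_sets vshift_in)
qed

lemma emeasure_vnbhd: "emeasure L (vnbhd p l) = ennreal (real p powr (- l))"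
  by (simp add: vnbhd_coset emeasure_coset vzero_in p_gr_0)

sublocale sigma_finite_measure L
proof (standard, intro exI[of _ "(\<lambda>x. vcoset p x 0) ` vH p"] conjI ballI)
  show "countable ((\<lambda>x. vcoset p x 0) ` vH p)" using countable_vH by blast
  show "(\<lambda>x. vcoset p x 0) ` vH p \<subseteq> sets L" by (auto simp: vH_def)
  show "\<Union> ((\<lambda>x. vcoset p x 0) ` vH p) = space L"
  proof (intro equalityI subsetI)
    fix x assume "x \<in> space L"
    hence "vtrunc 0 x \<in> vH p" "x \<in> vcoset p (vtrunc 0 x) 0"
      using p_gr_0 by (auto simp: vH_trunc vcoset_trunc self_in_vcoset)
    thus "x \<in> \<Union> ((\<lambda>x. vcoset p x 0) ` vH p)" by blast
  qed (auto simp: vcoset_def)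
  show "\<And>a. a \<in> (\<lambda>x. vcoset p x 0) ` vH p \<Longrightarrow> emeasure L a \<noteq> \<infinity>"
    by (auto simp: vH_def emeasure_coset)
qed

lemma nn_integral_vadd:
  "x \<in> G \<Longrightarrow> f \<in> borel_measurable L \<Longrightarrow> (\<integral>\<^sup>+w. f (vadd p x w) \<partial>L) = (\<integral>\<^sup>+w. f w \<partial>L)"
  using nn_integral_distr[OF measurable_vadd, of x f] by (simp add: distr_vadd)

lemma integral_vadd:
  fixes f :: "_ \<Rightarrow> complex"
  shows "x \<in> G \<Longrightarrow> f \<in> borel_measurable L \<Longrightarrow> (\<integral>w. f (vadd p x w) \<partial>L) = (\<integral>w. f w \<partial>L)"
  using integral_distr[OF measurable_vadd, of x f] by (simp add: distr_vadd)

lemma integral_vshift: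
  fixes f :: "_ \<Rightarrow> 'b::{banach, second_countable_topology}"
  shows "f \<in> borel_measurable L \<Longrightarrow> (\<integral>w. f (vshift k w) \<partial>L) = (real p powr (- k)) *\<^sub>R (\<integral>w. f w \<partial>L)"
  using integral_distr[OF measurable_vshift, of f k]
  by (simp add: distr_vshift integral_density)

lemma integrable_vshift:
  fixes f :: "_ \<Rightarrow> 'b::{banach, second_countable_topology}"
  assumes "integrable L f"
  shows "integrable L (\<lambda>w. f (vshift k w))"
proof -
  have "integrable (distr L L (vshift k)) f"
    using assms by (simp add: distr_vshift integrable_density)
  thus ?thesis by (rule integrable_distr[OF measurable_vshift])
qed

lemma AE_vadd:
  assumes "x \<in> G" "AE w in L. P w" shows "AE w in L. P (vadd p x w)"
  by (rule AE_distrD[OF measurable_vadd]) (use assms distr_vadd[OF assms(1)] in metis)+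

lemma AE_vshift:
  assumes "AE w in L. P w" shows "AE w in L. P (vshift k w)"
proof (rule AE_distrD[OF measurable_vshift])
  show "AE w in distr L L (vshift k). P w"
    unfolding distr_vshift by (subst AE_density) (use assms in auto)
qed

end

section \<open>Sums over H and periodization\<close>

lemma infsum_ennreal_eq_nn_integral:
  fixes f :: "'a \<Rightarrow> ennreal"
  assumes "countable A"
  shows "(\<Sum>\<^sub>\<infinity>x\<in>A. f x) = (\<integral>\<^sup>+x. f x \<partial>count_space A)"
proof (cases "finite A")
  case False
  note b = bij_betw_from_nat_into[OF assms False]
  have "(\<Sum>\<^sub>\<infinity>x\<in>A. f x) = (\<Sum>\<^sub>\<infinity>n. f (from_nat_into A n))"
    using infsum_reindex_bij_betw[OF b, of f] by simp
  also have "\<dots> = (\<Sum>n. f (from_nat_into A n))"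
  proof -
    have "(\<lambda>n. f (from_nat_into A n)) summable_on UNIV" by (rule nonneg_summable_on_complete) simp
    from has_sum_imp_sums[OF has_sum_infsum[OF this]] show ?thesis by (simp add: sums_iff)
  qed
  also have "\<dots> = (\<integral>\<^sup>+x. f x \<partial>count_space A)"
    by (subst nn_integral_bij_count_space[symmetric, OF b]) (rule nn_integral_count_space_nat[symmetric])
  finally show ?thesis .
qed (simp add: nn_integral_count_space_finite)

context vilenkin_group
begin

lemma vcoset_vH: "x \<in> G \<Longrightarrow> h \<in> vH p \<Longrightarrow> x \<in> vcoset p h 0 \<longleftrightarrow> vtrunc 0 x = h"
  by (auto simp: vcoset_def vtrunc_def vH_def fun_eq_iff)

lemma vadd_mem_vcoset_vH:
  assumes "h \<in> vH p" "w \<in> G"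
  shows "vadd p h w \<in> vcoset p h 0 \<longleftrightarrow> w \<in> vnbhd p 0"
proof -
  have "(h j + w j) mod int p = h j \<longleftrightarrow> w j = 0" for j
    using assms vadd_eq_iff[of h p w h j] by (auto simp: vH_def vadd_def vsub_def)
  thus ?thesis using assms p_gr_0 vadd_in[OF p_gr_0, of h w] by (auto simp: vcoset_def vnbhd_def vadd_def vH_in)
qed

text \<open>On the coset h \<oplus> U the map \<open>vfrac\<close> is translation by the inverse of
  h, and there are countably many such cosets. Translations are already measurable on the
  completion, so no Borel approximation is involved.\<close>

lemma measurable_vfrac: "vfrac \<in> measurable L L"
proof (rule measurableI)
  fix E assume E: "E \<in> sets L"
  have "vfrac -` E \<inter> space L = (\<Union>h\<in>vH p. vadd p (vneg p h) -` (E \<inter> vnbhd p 0) \<inter> space L)"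
  proof (intro equalityI subsetI)
    fix x assume x: "x \<in> vfrac -` E \<inter> space L"
    have "vadd p (vneg p (vtrunc 0 x)) x = vfrac x"
      using x vadd_vneg_cancel(2)[of "vfrac x" p "vtrunc 0 x"] vadd_vfrac_vtrunc[of x p] vnbhd_in[OF vfrac_in[OF p_gr_0]]
      by (simp add: vadd_comm)
    thus "x \<in> (\<Union>h\<in>vH p. vadd p (vneg p h) -` (E \<inter> vnbhd p 0) \<inter> space L)"
      using x p_gr_0 by (auto intro!: bexI[of _ "vtrunc 0 x"] vfrac_in vH_trunc)
  next
    fix x assume "x \<in> (\<Union>h\<in>vH p. vadd p (vneg p h) -` (E \<inter> vnbhd p 0) \<inter> space L)"
    then obtain h where h: "h \<in> vH p" "vadd p (vneg p h) x \<in> E" "vadd p (vneg p h) x \<in> vnbhd p 0" "x \<in> G" by auto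
    have "vfrac x = vfrac (vadd p x (vneg p h))"
      using h p_gr_0 by (simp add: vfrac_vadd_vH vH_vneg)
    also have "\<dots> = vadd p (vneg p h) x"
      using vfrac_vnbhd[OF h(3)] by (simp add: vadd_comm)
    finally show "x \<in> vfrac -` E \<inter> space L" using h by simp
  qed
  also have "\<dots> \<in> sets L"
  proof (rule sets.countable_UN'[OF countable_vH], rule image_subsetI)
    fix h assume "h \<in> vH p"
    thus "vadd p (vneg p h) -` (E \<inter> vnbhd p 0) \<inter> space L \<in> sets L"
      using E p_gr_0 by (intro measurable_sets[OF measurable_vadd] sets.Int vnbhd_sets vneg_in vH_in)
  qed
  finally show "vfrac -` E \<inter> space L \<in> sets L" .
qed (use p_gr_0 in \<open>auto intro: vnbhd_in vfrac_in\<close>)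

text \<open>As an integral against counting measure, \<eta> becomes accessible to Tonelli's theorem,
  reindexing by bijections and monotonicity.\<close>

lemma veta_eq: "veta p S w = (\<integral>\<^sup>+h. indicator S (vadd p w h) \<partial>count_space (vH p))"
  by (simp add: veta_def infsum_ennreal_eq_nn_integral countable_vH)

lemma borel_measurable_nn_integral_vH:
  assumes "\<And>h. h \<in> vH p \<Longrightarrow> f h \<in> borel_measurable M"
  shows "(\<lambda>w. \<integral>\<^sup>+h. (f h w :: ennreal) \<partial>count_space (vH p)) \<in> borel_measurable M"
proof (cases "finite (vH p)")
  case True
  thus ?thesis using assms by (simp add: nn_integral_count_space_finite borel_measurable_sum)
next
  case False
  note b = bij_betw_from_nat_into[OF countable_vH False]
  have "(\<lambda>w. \<integral>\<^sup>+h. (f h w :: ennreal) \<partial>count_space (vH p)) = (\<lambda>w. \<Sum>n. f (from_nat_into (vH p) n) w)"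
    by (subst nn_integral_bij_count_space[symmetric, OF b]) (rule ext nn_integral_count_space_nat)+
  moreover have "from_nat_into (vH p) n \<in> vH p" for n
    using False by (intro from_nat_into) auto
  ultimately show ?thesis using assms by (simp add: borel_measurable_suminf)
qed

text \<open>The group is the disjoint union of the cosets h \<oplus> U. Each piece is translated
  back to U, and sum and integral are exchanged.\<close>

lemma nn_integral_periodize:
  assumes f: "f \<in> borel_measurable L"
  shows "(\<integral>\<^sup>+w. f w \<partial>L) = (\<integral>\<^sup>+w. (\<integral>\<^sup>+h. f (vadd p w h) \<partial>count_space (vH p)) * indicator (vnbhd p 0) w \<partial>L)"
proof -
  have fm: "(\<lambda>w. f (vadd p h w)) \<in> borel_measurable L" if "h \<in> vH p" for h
    using measurable_compose[OF measurable_vadd[OF vH_in[OF that]] f] .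
  have "(\<integral>\<^sup>+w. f w \<partial>L) = (\<integral>\<^sup>+w. (\<integral>\<^sup>+h. f w * indicator (vcoset p h 0) w \<partial>count_space (vH p)) \<partial>L)"
  proof (rule nn_integral_cong)
    fix w assume "w \<in> space L"
    hence "w \<in> G" by simp
    hence "(\<integral>\<^sup>+h. f w * indicator (vcoset p h 0) w \<partial>count_space (vH p)) = (\<integral>\<^sup>+h. f w * indicator {vtrunc 0 w} h \<partial>count_space (vH p))"
      by (intro nn_integral_cong) (auto simp: vcoset_vH indicator_def)
    also have "\<dots> = f w" using \<open>w \<in> G\<close> vH_trunc[OF p_gr_0] by (simp add: nn_integral_cmult)
    finally show "f w = (\<integral>\<^sup>+h. f w * indicator (vcoset p h 0) w \<partial>count_space (vH p))" by simp
  qed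
  also have "\<dots> = (\<integral>\<^sup>+h. (\<integral>\<^sup>+w. f w * indicator (vcoset p h 0) w \<partial>L) \<partial>count_space (vH p))"
    using f by (intro nn_integral_count_space_nn_integral countable_vH) (auto simp: vH_in)
  also have "\<dots> = (\<integral>\<^sup>+h. (\<integral>\<^sup>+w. f (vadd p h w) * indicator (vnbhd p 0) w \<partial>L) \<partial>count_space (vH p))"
  proof (rule nn_integral_cong)
    fix h assume "h \<in> space (count_space (vH p))"
    hence h: "h \<in> vH p" by simp
    have "(\<integral>\<^sup>+w. f w * indicator (vcoset p h 0) w \<partial>L) = (\<integral>\<^sup>+w. f (vadd p h w) * indicator (vcoset p h 0) (vadd p h w) \<partial>L)"
      using f h by (subst nn_integral_vadd[symmetric, of h]) (auto simp: vH_in)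
    also have "\<dots> = (\<integral>\<^sup>+w. f (vadd p h w) * indicator (vnbhd p 0) w \<partial>L)"
      using h by (intro nn_integral_cong) (auto simp: indicator_def vadd_mem_vcoset_vH)
    finally show "(\<integral>\<^sup>+w. f w * indicator (vcoset p h 0) w \<partial>L) = (\<integral>\<^sup>+w. f (vadd p h w) * indicator (vnbhd p 0) w \<partial>L)" .
  qed
  also have "\<dots> = (\<integral>\<^sup>+w. (\<integral>\<^sup>+h. f (vadd p h w) * indicator (vnbhd p 0) w \<partial>count_space (vH p)) \<partial>L)"
    using fm by (intro nn_integral_count_space_nn_integral[symmetric] countable_vH) auto
  also have "\<dots> = (\<integral>\<^sup>+w. (\<integral>\<^sup>+h. f (vadd p w h) \<partial>count_space (vH p)) * indicator (vnbhd p 0) w \<partial>L)"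
    by (intro nn_integral_cong) (simp add: nn_integral_multc vadd_comm)
  finally show ?thesis .
qed

end

section \<open>Characters\<close>

definition vdot :: "(int \<Rightarrow> int) \<Rightarrow> (int \<Rightarrow> int) \<Rightarrow> int" where
  "vdot x w = (\<Sum>j | x j * w (1 - j) \<noteq> 0. x j * w (1 - j))"

text \<open>The index set in \<open>vdot\<close> depends on both arguments. A common finite window J
  allows the sums for different arguments to be added term by term.\<close>

lemma vdot_eq:
  assumes "\<And>j. j < k \<Longrightarrow> x j = 0" "\<And>j. j < m \<Longrightarrow> w j = 0" "finite J" "{k..1 - m} \<subseteq> J"
  shows "vdot x w = (\<Sum>j\<in>J. x j * w (1 - j))"
  unfolding vdot_def
proof (rule sum.mono_neutral_left[OF assms(3)])
  show "{j. x j * w (1 - j) \<noteq> 0} \<subseteq> J"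
  proof
    fix j assume "j \<in> {j. x j * w (1 - j) \<noteq> 0}"
    hence "\<not> j < k" "\<not> 1 - j < m" using assms(1)[of j] assms(2)[of "1 - j"] by auto
    thus "j \<in> J" using assms(4) by auto
  qed
qed auto

lemma vdot_comm: "vdot x w = vdot w x"
  unfolding vdot_def
  by (rule sum.reindex_bij_witness[where i = "\<lambda>j. 1 - j" and j = "\<lambda>j. 1 - j"]) (auto simp: mult.commute)

lemma vdot_vshift: "vdot (vshift k x) w = vdot x (vshift k w)"
  unfolding vdot_def vshift_def
  by (rule sum.reindex_bij_witness[where i = "\<lambda>j. j - k" and j = "\<lambda>j. j + k"]) (auto simp: algebra_simps)

context vilenkin_group
begin

definition zeta :: "int \<Rightarrow> complex" where
  "zeta n = exp (2 * of_real pi * \<i> / of_nat p * of_int n)"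

lemma vchar_eq: "vchar p x w = zeta (vdot x w)"
  by (simp add: vchar_def zeta_def vdot_def)

lemma zeta_add: "zeta (m + n) = zeta m * zeta n"
  by (simp add: zeta_def exp_add[symmetric] distrib_left)

lemma zeta_eq_1_iff: "zeta n = 1 \<longleftrightarrow> int p dvd n"
proof -
  have "2 * of_real pi * \<i> / of_nat p * of_int n = of_real (2 * pi * (real_of_int n / real p)) * \<i>"
    by simp
  hence "zeta n = 1 \<longleftrightarrow> (\<exists>k::int. 2 * pi * (real_of_int n / real p) = of_int (2 * k) * pi)"
    unfolding zeta_def by (simp add: exp_eq_1)
  also have "\<dots> \<longleftrightarrow> (\<exists>k::int. real_of_int n = real_of_int (int p * k))"
  proof (intro ex_cong1)
    fix k :: int
    have "2 * pi * (real_of_int n / real p) = of_int (2 * k) * pi \<longleftrightarrow> real_of_int n / real p = of_int k"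
      using mult_left_cancel[of "2 * pi" "real_of_int n / real p" "of_int k"] by (simp add: mult_ac)
    also have "\<dots> \<longleftrightarrow> real_of_int n = real_of_int (int p * k)"
      using p_gr_0 by (auto simp: field_simps)
    finally show "2 * pi * (real_of_int n / real p) = of_int (2 * k) * pi \<longleftrightarrow> real_of_int n = real_of_int (int p * k)" .
  qed
  also have "\<dots> \<longleftrightarrow> int p dvd n" unfolding dvd_def of_int_eq_iff by simp
  finally show ?thesis .
qed

lemma zeta_cong: "m mod int p = n mod int p \<Longrightarrow> zeta m = zeta n"
proof -
  assume "m mod int p = n mod int p"
  hence "zeta (m - n) = 1" by (simp add: zeta_eq_1_iff mod_eq_dvd_iff)
  thus ?thesis using zeta_add[of "m - n" n] by simp
qed

lemma norm_vchar [simp]: "cmod (vchar p x w) = 1"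
proof -
  have "2 * of_real pi * \<i> / of_nat p * of_int n = \<i> * of_real (2 * pi / real p * real_of_int n)" for n
    by simp
  thus ?thesis unfolding vchar_eq zeta_def by (metis norm_exp_i_times)
qed

lemma vchar_cnj: "vchar p x w * cnj (vchar p x w) = 1"
  using complex_norm_square[of "vchar p x w"] by simp

lemma vchar_comm: "vchar p x w = vchar p w x"
  by (simp add: vchar_eq vdot_comm)

lemma vchar_vshift: "vchar p (vshift k x) w = vchar p x (vshift k w)"
  by (simp add: vchar_eq vdot_vshift)

lemma vchar_vadd_left:
  assumes "x \<in> G" "y \<in> G" "w \<in> G"
  shows "vchar p (vadd p x y) w = vchar p x w * vchar p y w"
proof -
  obtain k where k: "\<And>j. j < k \<Longrightarrow> x j = 0" using assms(1) by (auto simp: vilenkin_def)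
  obtain l where l: "\<And>j. j < l \<Longrightarrow> y j = 0" using assms(2) by (auto simp: vilenkin_def)
  obtain m where m: "\<And>j. j < m \<Longrightarrow> w j = 0" using assms(3) by (auto simp: vilenkin_def)
  define J where "J = {min k l..1 - m}"
  have J: "finite J" "{min k l..1 - m} \<subseteq> J" "{k..1-m} \<subseteq> J" "{l..1-m} \<subseteq> J" by (auto simp: J_def)
  have e: "vdot (vadd p x y) w = (\<Sum>j\<in>J. vadd p x y j * w (1 - j))"
    by (rule vdot_eq[OF _ m J(1,2)]) (use k l in \<open>auto simp: vadd_def\<close>)
  have "vdot (vadd p x y) w mod int p = (\<Sum>j\<in>J. vadd p x y j * w (1 - j) mod int p) mod int p"
    unfolding e by (simp add: mod_sum_eq)
  also have "\<dots> = (\<Sum>j\<in>J. (x j * w (1 - j) + y j * w (1 - j)) mod int p) mod int p"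
    by (simp add: vadd_def mod_simps distrib_right)
  also have "\<dots> = (vdot x w + vdot y w) mod int p"
    using vdot_eq[OF k m J(1,3)] vdot_eq[OF l m J(1,4)] by (simp add: mod_sum_eq sum.distrib)
  finally show ?thesis unfolding vchar_eq zeta_add[symmetric] by (rule zeta_cong)
qed

lemma vchar_vadd_right:
  "x \<in> G \<Longrightarrow> v \<in> G \<Longrightarrow> w \<in> G \<Longrightarrow> vchar p x (vadd p v w) = vchar p x v * vchar p x w"
  using vchar_vadd_left[of v w x] by (simp add: vchar_comm[of x])

text \<open>At every index j either j \<le> -l, where x_j = 0, or 1 - j \<le> l, where the matching
  digit of w is 0. The offset 1 - j is what pairs U_l with U_{-l} without a gap.\<close>

lemma vchar_trivial:
  assumes "x \<in> vnbhd p (- l)" "w \<in> vnbhd p l" shows "vchar p x w = 1"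
proof -
  have "x j * w (1 - j) = 0" for j
    using assms by (cases "j \<le> - l") (auto simp: vnbhd_def)
  thus ?thesis by (simp add: vchar_eq vdot_def zeta_def)
qed

lemma vchar_zero [simp]: "vchar p (\<lambda>_. 0) w = 1" "vchar p x (\<lambda>_. 0) = 1"
  by (simp_all add: vchar_eq vdot_def zeta_def)

lemma vchar_vneg_left:
  assumes "x \<in> G" "w \<in> G" shows "vchar p (vneg p x) w = cnj (vchar p x w)"
proof -
  have "vchar p x w * vchar p (vneg p x) w = 1"
    using vchar_vadd_left[of x "vneg p x" w] assms p_gr_0 by (simp add: vadd_vneg vneg_in)
  hence "cnj (vchar p x w) * (vchar p x w * vchar p (vneg p x) w) = cnj (vchar p x w)" by simp
  thus ?thesis using vchar_cnj[of x w] by (simp add: mult.assoc[symmetric] mult.commute)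
qed

lemma vchar_vneg_right:
  "x \<in> G \<Longrightarrow> w \<in> G \<Longrightarrow> vchar p x (vneg p w) = cnj (vchar p x w)"
  using vchar_vneg_left[of w x] by (simp add: vchar_comm[of x])

lemma vchar_vH: "h \<in> vH p \<Longrightarrow> k \<in> vH p \<Longrightarrow> vchar p h k = 1"
proof -
  assume *: "h \<in> vH p" "k \<in> vH p"
  have "h j * k (1 - j) = 0" for j
    using * by (cases "j \<le> 0") (auto simp: vH_def)
  thus ?thesis by (simp add: vchar_eq vdot_def zeta_def)
qed

text \<open>Pairing with a unit digit at index 1 - j isolates zeta(x_j), and 0 < x_j < p is not
  divisible by p. The witness is explicit because the orthogonality proofs must know which subgroup
  contains it.\<close>

lemma vchar_nontrivial:
  assumes x: "x \<in> G" "x j \<noteq> 0"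
  shows "(\<lambda>i. if i = 1 - j then 1 else 0) \<in> G" "vchar p x (\<lambda>i. if i = 1 - j then 1 else 0) \<noteq> 1"
proof -
  let ?w = "\<lambda>i. if i = 1 - j then 1 else 0 :: int"
  show "?w \<in> G" using p_gr_1 by (auto simp: vilenkin_def intro!: exI[of _ "1 - j"])
  have "{i. x i * ?w (1 - i) \<noteq> 0} = {j}" using x(2) by auto
  hence "vdot x ?w = x j" unfolding vdot_def by simp
  moreover have "\<not> int p dvd x j"
  proof
    assume "int p dvd x j"
    hence "x j mod int p = 0" by simp
    thus False using x vil_mod[OF x(1), of j] by simp
  qed
  ultimately show "vchar p x ?w \<noteq> 1" by (simp add: vchar_eq zeta_eq_1_iff)
qed

lemma vcoset_eq_vadd: "x \<in> G \<Longrightarrow> y \<in> vcoset p x l \<Longrightarrow> \<exists>u\<in>vnbhd p l. y = vadd p x u"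
  using vadd_nbhd[OF p_gr_0, of x l] by auto

lemma vchar_const_on_coset:
  assumes "x \<in> vnbhd p (- l)" "w \<in> G" "v \<in> vcoset p w l"
  shows "vchar p x v = vchar p x w"
proof -
  obtain u where "u \<in> vnbhd p l" "v = vadd p w u" using vcoset_eq_vadd assms by blast
  thus ?thesis using assms vchar_trivial[of x l u] by (simp add: vchar_vadd_right vnbhd_in)
qed

lemma in_some_vnbhd: "x \<in> G \<Longrightarrow> \<exists>l. x \<in> vnbhd p l"
proof -
  assume x: "x \<in> G"
  then obtain k where "\<forall>j<k. x j = 0" by (auto simp: vilenkin_def)
  hence "x \<in> vnbhd p (k - 1)" using x by (auto simp: vnbhd_def)
  thus ?thesis by blast
qed

lemma measurable_vchar: 
  assumes "x \<in> G" shows "vchar p x \<in> borel_measurable L"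
proof (rule borel_measurable_L, rule locally_constant_measurable[OF p_gr_0])
  obtain l where "x \<in> vnbhd p l" using in_some_vnbhd[OF assms] by blast
  thus "\<exists>l. \<forall>v\<in>vcoset p w l. vchar p x v = vchar p x w" if "w \<in> G" for w
    using that vchar_const_on_coset[of x "- l" w] by auto
qed auto

lemma integrable_vchar:
  assumes "x \<in> G" "integrable L f"
  shows "integrable L (\<lambda>w. f w * vchar p x w)"
  by (rule Bochner_Integration.integrable_bound[OF assms(2)])
    (use assms measurable_vchar[OF assms(1)] in \<open>auto simp: norm_mult\<close>)

lemma integral_ind_vchar_translate:
  assumes "x \<in> G" "y \<in> G"
  shows "(\<integral>w. indicator (vcoset p x l) w * vchar p y w \<partial>L) = vchar p y x * (\<integral>w. indicator (vnbhd p l) w * vchar p y w \<partial>L)"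
proof -
  have ind: "indicator (vcoset p x l) (vadd p x w) = (indicator (vnbhd p l) w :: complex)" if "w \<in> G" for w
  proof -
    have "vadd p x w \<in> vcoset p x l \<longleftrightarrow> w \<in> vnbhd p l"
      using vadd_nbhd[OF p_gr_0 assms(1), of l] vsub_vadd[of _ p x] that vnbhd_in
      by (metis (no_types, lifting) image_iff)
    thus ?thesis by (simp add: indicator_def)
  qed
  have "(\<integral>w. indicator (vcoset p x l) w * vchar p y w \<partial>L) = (\<integral>w. indicator (vcoset p x l) (vadd p x w) * vchar p y (vadd p x w) \<partial>L)"
    using assms measurable_vchar[OF assms(2)] by (intro integral_vadd[symmetric] borel_measurable_times) auto
  also have "\<dots> = (\<integral>w. vchar p y x * (indicator (vnbhd p l) w * vchar p y w) \<partial>L)"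
    by (intro Bochner_Integration.integral_cong) (use assms in \<open>auto simp: ind vchar_vadd_right\<close>)
  finally show ?thesis by simp
qed

text \<open>Orthogonality of characters on the compact subgroup U_l: when the character is
  nontrivial there, translating by an element of U_l where it differs from 1 multiplies the integral
  by that value, so the integral is 0.\<close>

lemma integral_vnbhd_vchar:
  assumes x: "x \<in> G"
  shows "(\<integral>w. indicator (vnbhd p l) w * vchar p x w \<partial>L) = (if x \<in> vnbhd p (- l) then of_real (real p powr (- l)) else 0)"
proof (cases "x \<in> vnbhd p (- l)")
  case True
  hence "(\<integral>w. indicator (vnbhd p l) w * vchar p x w \<partial>L) = (\<integral>w. complex_of_real (indicator (vnbhd p l) w) \<partial>L)"
    by (intro Bochner_Integration.integral_cong) (auto simp: indicator_def vchar_trivial)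
  also have "\<dots> = complex_of_real (measure L (vnbhd p l))"
  proof -
    have "vnbhd p l \<subseteq> space L" by (auto simp: vnbhd_def)
    thus ?thesis by (simp add: Int_absorb2 vnbhd_sets integral_complex_of_real)
  qed
  finally show ?thesis using True by (simp add: measure_def emeasure_vnbhd)
next
  case False
  then obtain j where j: "j \<le> - l" "x j \<noteq> 0" using x by (auto simp: vnbhd_def)
  let ?w = "\<lambda>i. if i = 1 - j then 1 else 0 :: int"
  note w = vchar_nontrivial[OF x j(2)]
  \<comment> \<open>The digit of \<open>?w\<close> sits at index 1 - j > l because j \<le> -l, so
    \<open>?w\<close> lies in the subgroup and translation by it changes nothing.\<close>
  have c: "vcoset p ?w l = vnbhd p l" using j by (auto simp: vcoset_def vnbhd_def)
  have "(1 - vchar p x ?w) * (\<integral>w. indicator (vnbhd p l) w * vchar p x w \<partial>L) = 0"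
    using integral_ind_vchar_translate[OF w(1) x, of l] unfolding c by (simp add: algebra_simps)
  hence "(\<integral>w. indicator (vnbhd p l) w * vchar p x w \<partial>L) = 0" using w(2) by simp
  thus ?thesis using False by simp
qed

text \<open>The finite subgroup of H with digits only at the indices -n+1 to 0. Under the pairing
  these indices face the digits 1 to n, so its characters see exactly the coset of depth n in
  U.\<close>

definition vH_trunc_set :: "nat \<Rightarrow> (int \<Rightarrow> int) set" where
  "vH_trunc_set n = {h \<in> vH p. \<forall>j\<le>- int n. h j = 0}"

lemma finite_vH_trunc_set: "finite (vH_trunc_set n)"
proof (rule finite_subset)
  show "vH_trunc_set n \<subseteq> {f. \<forall>x. (x \<in> {- int n..0} \<longrightarrow> f x \<in> {0..<int p}) \<and> (x \<notin> {- int n..0} \<longrightarrow> f x = 0)}"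
    by (auto simp: vH_trunc_set_def vH_def vilenkin_def not_le)
  show "finite {f. \<forall>x. (x \<in> {- int n..0} \<longrightarrow> f x \<in> {0..<int p}) \<and> (x \<notin> {- int n..0} \<longrightarrow> f x = (0::int))}"
    by (rule finite_set_of_finite_funs) auto
qed

lemma vH_trunc_set_zero: "(\<lambda>_. 0) \<in> vH_trunc_set n"
  by (simp add: vH_trunc_set_def vH_zero p_gr_0)

text \<open>The finite analogue of \<open>integral_vnbhd_vchar\<close>, by the same translation
  argument. Applied to the difference of w and x, it writes the condition that they share the digits
  1 to n as a trigonometric polynomial in w.\<close>

lemma sum_vchar:
  assumes w: "w \<in> G"
  shows "(\<Sum>h\<in>vH_trunc_set n. vchar p h w) = (if \<forall>j\<in>{1..int n}. w j = 0 then of_nat (card (vH_trunc_set n)) else 0)"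
proof (cases "\<forall>j\<in>{1..int n}. w j = 0")
  case True
  have "vchar p h w = 1" if "h \<in> vH_trunc_set n" for h
  proof -
    have "h j * w (1 - j) = 0" for j
    proof -
      consider "j > 0" | "j \<le> - int n" | "1 - j \<in> {1..int n}" by (auto simp: not_le not_less) linarith
      thus ?thesis using that True by cases (auto simp: vH_trunc_set_def vH_def)
    qed
    thus ?thesis by (simp add: vchar_eq vdot_def zeta_def)
  qed
  thus ?thesis using True by simp
next
  case False
  then obtain j where j: "j \<in> {1..int n}" "w j \<noteq> 0" by blast
  let ?h = "\<lambda>i. if i = 1 - j then 1 else 0 :: int"
  note h = vchar_nontrivial[OF w j(2)]
  have hH: "?h \<in> vH_trunc_set n" using h(1) j by (auto simp: vH_trunc_set_def vH_def)
  have tr: "vadd p k g \<in> vH_trunc_set n" if "k \<in> vH_trunc_set n" "g \<in> vH_trunc_set n" for k g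
    using that p_gr_0 by (auto simp: vH_trunc_set_def vH_vadd) (simp add: vadd_def)
  have ng: "vneg p k \<in> vH_trunc_set n" if "k \<in> vH_trunc_set n" for k
    using that p_gr_0 by (auto simp: vH_trunc_set_def vH_vneg) (simp add: vneg_def vsub_def)
  have G: "k \<in> G" if "k \<in> vH_trunc_set n" for k using that by (simp add: vH_trunc_set_def vH_def)
  have "(\<Sum>k\<in>vH_trunc_set n. vchar p k w) = (\<Sum>k\<in>vH_trunc_set n. vchar p (vadd p ?h k) w)"
    by (rule sum.reindex_bij_witness[where i = "vadd p ?h" and j = "vadd p (vneg p ?h)"])
      (use hH tr ng G in \<open>auto simp: vadd_vneg_cancel\<close>)
  also have "\<dots> = vchar p ?h w * (\<Sum>k\<in>vH_trunc_set n. vchar p k w)"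
    unfolding sum_distrib_left using hH G w by (intro sum.cong) (auto simp: vchar_vadd_left)
  finally have "(1 - vchar p ?h w) * (\<Sum>k\<in>vH_trunc_set n. vchar p k w) = 0" by (simp add: algebra_simps)
  thus ?thesis using h(2) False by (auto simp: vchar_comm)
qed

end

section \<open>Plancherel theorem\<close>

context vilenkin_group
begin

lemma Int_stable_vcosets: "Int_stable (insert {} (vcosets p))"
proof (rule Int_stableI)
  fix a b assume ab: "a \<in> insert {} (vcosets p)" "b \<in> insert {} (vcosets p)"
  show "a \<inter> b \<in> insert {} (vcosets p)"
  proof (cases "a \<inter> b = {}")
    case False
    then obtain z where z: "z \<in> a" "z \<in> b" by blast
    obtain x l where x: "l \<ge> 0" "a = vcoset p x l" using ab z by (auto simp: vcosets_def)
    obtain y m where y: "m \<ge> 0" "b = vcoset p y m" using ab z by (auto simp: vcosets_def)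
    have "a \<inter> b = vcoset p z (max l m)" "z \<in> G"
      using x y z by (auto simp: vcoset_def le_max_iff_disj)
    thus ?thesis using x(1) unfolding vcosets_def by fastforce
  qed simp
qed

lemma vcoset_Int:
  assumes "z \<in> vcoset p x l" "z \<in> vcoset p y m"
  shows "vcoset p x l \<inter> vcoset p y m = vcoset p z (max l m)"
  using assms by (auto simp: vcoset_def le_max_iff_disj)

text \<open>Dynkin's argument on the intersection-stable family of cosets. Everything is cut down to
  a set of finite measure, so that complements become differences of square-integrable indicators
  and disjoint unions become dominated limits. A coset that meets \<open>vnbhd p m\<close> meets it
  in a coset of depth at least m, which is why \<open>base\<close> is asked for those only.\<close>

lemma L2_closed_span_vnbhd_indicator:
  assumes e: "\<And>i. i \<in> I \<Longrightarrow> e i \<in> L2fun L"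
    and base: "\<And>x l. x \<in> vnbhd p m \<Longrightarrow> l \<ge> m \<Longrightarrow> indicator (vcoset p x l) \<in> L2_closed_span L I e"
    and E: "E \<in> sets L" "E \<subseteq> vnbhd p m"
  shows "indicator E \<in> L2_closed_span L I e"
proof -
  let ?V = "L2_closed_span L I e" and ?U = "vnbhd p m"
  have U: "indicator ?U \<in> ?V" 
    using base[of "\<lambda>_. 0" m] vzero_in[OF p_gr_0] by (simp add: vnbhd_coset vcoset_def)
  have UL: "indicator ?U \<in> L2fun L" by (rule L2fun_indicator) (auto simp: emeasure_vnbhd)
  have sub: "insert {} (vcosets p) \<subseteq> Pow G" using vcosets_sub by blast
  have borel: "indicator (A \<inter> ?U) \<in> ?V" if "A \<in> sigma_sets G (insert {} (vcosets p))" for A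
    using Int_stable_vcosets sub that
  proof (induction A rule: sigma_sets_induct_disjoint)
    case (basic A)
    show ?case
    proof (cases "A \<inter> ?U = {}")
      case True
      thus ?thesis using L2_closed_span_zero[of I e L] e by simp
    next
      case False
      then obtain z where z: "z \<in> A" "z \<in> ?U" by blast
      obtain x l where "A = vcoset p x l" using basic z by (auto simp: vcosets_def)
      hence "A \<inter> ?U = vcoset p z (max l m)" using z vcoset_Int by (simp add: vnbhd_coset)
      thus ?thesis using base[OF z(2), of "max l m"] by simp
    qed
  next
    case empty
    show ?case using L2_closed_span_zero[of I e L] e by simp
  next
    case (compl A)
    have "indicator ((G - A) \<inter> ?U) = (\<lambda>x. indicator ?U x - indicator (A \<inter> ?U) x :: complex)"
      by (auto simp: indicator_def vnbhd_def)
    thus ?case using L2_closed_span_diff[OF e U compl(2)] by simp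
  next
    case (union A)
    have Am: "A i \<in> sets L" for i
    proof (rule borel_sets_L)
      have "A i \<in> sigma_sets G (insert {} (vcosets p))" using union by blast
      moreover have "sigma_sets G (insert {} (vcosets p)) = sigma_sets G (vcosets p)"
        by (rule sigma_sets_eqI) (auto intro: sigma_sets.Basic sigma_sets.Empty)
      ultimately show "A i \<in> sets (vborel p)" by (simp add: sets_vborel p_gr_0)
    qed
    have ind: "indicator ((\<Union>i<n. A i) \<inter> ?U) \<in> ?V" for n :: nat
    proof -
      have "indicator ((\<Union>i<n. A i) \<inter> ?U) = (\<lambda>x. \<Sum>i<n. indicator (A i \<inter> ?U) x :: complex)"
      proof
        fix x
        have "indicator (\<Union>i\<in>{..<n}. A i \<inter> ?U) x = (\<Sum>i<n. indicator (A i \<inter> ?U) x :: complex)"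
          using union(1) by (intro indicator_UN_disjoint) (auto simp: disjoint_family_on_def)
        thus "indicator ((\<Union>i<n. A i) \<inter> ?U) x = (\<Sum>i<n. indicator (A i \<inter> ?U) x :: complex)" by simp
      qed
      thus ?thesis using L2_closed_span_sum[of I e L "{..<n}" "\<lambda>i. indicator (A i \<inter> vnbhd p m)"] union(3) e by simp
    qed
    have m: "(\<Union>i. A i) \<inter> ?U \<in> sets L" using Am by auto
    show ?case
    proof (rule L2_closed_span_dominated[OF e ind _ UL])
      show "indicator ((\<Union>i. A i) \<inter> ?U) \<in> L2fun L"
        by (rule L2fun_bound[OF UL, where c = 1]) (use m in \<open>auto simp: indicator_def\<close>)
      show "AE x in L. (\<lambda>n. indicator ((\<Union>i<n. A i) \<inter> ?U) x :: complex) \<longlonglongrightarrow> indicator ((\<Union>i. A i) \<inter> ?U) x"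
      proof (rule AE_I2)
        fix x
        have "eventually (\<lambda>n. indicator ((\<Union>i. A i) \<inter> ?U) x = (indicator ((\<Union>i<n. A i) \<inter> ?U) x :: complex)) sequentially"
        proof (cases "\<exists>i. x \<in> A i")
          case True
          then obtain i where "x \<in> A i" by blast
          thus ?thesis by (intro eventually_sequentiallyI[of "Suc i"]) (auto simp: indicator_def)
        qed (auto simp: indicator_def)
        thus "(\<lambda>n. indicator ((\<Union>i<n. A i) \<inter> ?U) x :: complex) \<longlonglongrightarrow> indicator ((\<Union>i. A i) \<inter> ?U) x"
          by (rule Lim_transform_eventually[OF tendsto_const])
      qed
    qed (auto simp: indicator_def)
  qed
  \<comment> \<open>The induction reaches Borel sets only. A set of the completion agrees almost
    everywhere with its Borel main part, and closed spans ignore null sets.\<close>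
  let ?m = "main_part haar E"
  have "?m \<in> sets haar" and ae: "AE x in haar. x \<in> ?m \<longleftrightarrow> x \<in> E"
    using E AE_in_main_part[of E haar] by (auto simp: L_def)
  hence "?m \<in> sigma_sets G (vcosets p)" by (simp add: sets_haar sets_vborel p_gr_0)
  hence "?m \<in> sigma_sets G (insert {} (vcosets p))"
    by (rule rev_subsetD[OF _ sigma_sets_mono']) auto
  from borel[OF this] have m: "indicator (?m \<inter> ?U) \<in> ?V" .
  have "AE x in L. x \<in> ?m \<longleftrightarrow> x \<in> E" unfolding L_def by (rule AE_completion[OF ae])
  hence "AE x in L. indicator (?m \<inter> ?U) x = (indicator E x :: complex)"
    by eventually_elim (use E(2) in \<open>auto simp: indicator_def\<close>)
  thus ?thesis using E(1) by (intro L2_closed_span_cong_AE[OF e m]) auto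
qed

lemma vnbhd_finite: "emeasure L (vnbhd p m) < \<infinity>"
  by (simp add: emeasure_vnbhd)

lemma L2_closed_span_vnbhd:
  assumes e: "\<And>i. i \<in> I \<Longrightarrow> e i \<in> L2fun L"
    and base: "\<And>x l. x \<in> vnbhd p m \<Longrightarrow> l \<ge> m \<Longrightarrow> indicator (vcoset p x l) \<in> L2_closed_span L I e"
    and f: "f \<in> L2fun L" "\<And>x. x \<notin> vnbhd p m \<Longrightarrow> f x = 0"
  shows "f \<in> L2_closed_span L I e"
  by (rule L2_closed_span_indicators[OF e f(1)], assumption,
      rule L2_closed_span_vnbhd_indicator[OF e base]) (use f(2) in auto)

lemma L2fun_restrict:
  assumes "f \<in> L2fun L" "A \<in> sets L"
  shows "(\<lambda>x. f x * indicator A x) \<in> L2fun L"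
  by (rule L2fun_bound[OF assms(1), where c = 1])
    (use assms L2fun_meas[OF assms(1)] in \<open>auto simp: indicator_def intro!: borel_measurable_times borel_measurable_indicator\<close>)

lemma vnbhd_exhausts:
  assumes "x \<in> G" shows "eventually (\<lambda>n. x \<in> vnbhd p (- int n)) sequentially"
proof -
  obtain l where "x \<in> vnbhd p l" using in_some_vnbhd[OF assms] by blast
  thus ?thesis by (intro eventually_sequentiallyI[of "nat (- l)"]) (auto simp: vnbhd_def)
qed

lemma restrict_vnbhd_lim:
  fixes f :: "_ \<Rightarrow> complex"
  assumes "x \<in> G" shows "(\<lambda>n. f x * indicator (vnbhd p (- int n)) x) \<longlonglongrightarrow> f x"
  by (rule Lim_transform_eventually[OF tendsto_const], use vnbhd_exhausts[OF assms] in eventually_elim) simp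

lemma L2norm_restrict_lim:
  assumes f: "f \<in> L2fun L"
  shows "(\<lambda>n. L2norm L (\<lambda>x. f x - f x * indicator (vnbhd p (- int n)) x)) \<longlonglongrightarrow> 0"
  by (rule L2norm_dominated[OF L2fun_restrict[OF f vnbhd_sets] f f])
    (use restrict_vnbhd_lim in \<open>auto simp: indicator_def\<close>)

lemma L2_closed_span_dense:
  assumes e: "\<And>i. i \<in> I \<Longrightarrow> e i \<in> L2fun L"
    and base: "\<And>x l. x \<in> G \<Longrightarrow> indicator (vcoset p x l) \<in> L2_closed_span L I e"
  shows "L2fun L \<subseteq> L2_closed_span L I e"
proof
  fix f assume f: "f \<in> L2fun L"
  show "f \<in> L2_closed_span L I e"
  proof (rule L2_closed_span_limit[OF e f])
    fix \<epsilon> :: real assume "\<epsilon> > 0"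
    from order_tendstoD(2)[OF L2norm_restrict_lim[OF f] this]
    obtain n where "L2norm L (\<lambda>x. f x - f x * indicator (vnbhd p (- int n)) x) < \<epsilon>"
      by (auto simp: eventually_sequentially)
    moreover have "(\<lambda>x. f x * indicator (vnbhd p (- int n)) x) \<in> L2_closed_span L I e"
      by (rule L2_closed_span_vnbhd[where m = "- int n", OF e base L2fun_restrict[OF f vnbhd_sets]]) (auto simp: vnbhd_in)
    ultimately show "\<exists>g\<in>L2_closed_span L I e. L2norm L (\<lambda>x. f x - g x) < \<epsilon>" by (rule bexI)
  qed
qed

section \<open>Isometry on step functions and its extension\<close>

definition coset_ind :: "(int \<Rightarrow> int) \<times> int \<Rightarrow> (int \<Rightarrow> int) \<Rightarrow> complex" where
  "coset_ind c = indicator (vcoset p (fst c) (snd c))"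

lemma coset_ind_L2: "fst c \<in> G \<Longrightarrow> coset_ind c \<in> L2fun L"
  unfolding coset_ind_def by (rule L2fun_indicator) (auto simp: emeasure_coset)

lemma coset_ind_integrable: "fst c \<in> G \<Longrightarrow> integrable L (coset_ind c)"
proof -
  assume "fst c \<in> G"
  hence "integrable L (\<lambda>x. complex_of_real (indicator (vcoset p (fst c) (snd c)) x))"
    by (intro integrable_of_real integrable_real_indicator) (auto simp: emeasure_coset)
  thus ?thesis by (simp add: coset_ind_def of_real_indicator)
qed

text \<open>The indicator of U_l goes to p^{-l} times the indicator of its annihilator U_{-l};
  moving the subgroup to the coset of x becomes multiplication by a character.\<close>

lemma inv_fourier_coset_ind:
  assumes "x \<in> G" "y \<in> G"
  shows "inv_fourier p (coset_ind (x, l)) y = of_real (real p powr (- l)) * (vchar p y x * indicator (vnbhd p (- l)) y)"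
  using assms integral_ind_vchar_translate[of x y l] integral_vnbhd_vchar[of y l]
  by (simp add: inv_fourier_def coset_ind_def indicator_def)

lemma vsub_nth_eq_0_iff: "x \<in> G \<Longrightarrow> y \<in> G \<Longrightarrow> vsub p x y j = 0 \<longleftrightarrow> x j = y j"
  using vadd_eq_iff[of y p "\<lambda>_. 0" x j] p_gr_0 by (auto simp: vzero_in vadd_0)

lemma vsub_mem_vnbhd_iff:
  assumes "x \<in> G" "y \<in> G" shows "vsub p x y \<in> vnbhd p l \<longleftrightarrow> (\<forall>j\<le>l. x j = y j)"
  using assms p_gr_0 by (auto simp: vnbhd_def vsub_in vsub_nth_eq_0_iff)

lemma vchar_vsub_right:
  "x \<in> G \<Longrightarrow> v \<in> G \<Longrightarrow> w \<in> G \<Longrightarrow> vchar p x (vsub p v w) = vchar p x v * cnj (vchar p x w)"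
  using p_gr_0 by (simp add: vsub_eq_vadd_vneg vchar_vadd_right vneg_in vchar_vneg_right)

lemma vchar_vsub_left:
  "v \<in> G \<Longrightarrow> w \<in> G \<Longrightarrow> x \<in> G \<Longrightarrow> vchar p (vsub p v w) x = vchar p v x * cnj (vchar p w x)"
  using vchar_vsub_right[of x v w] by (simp add: vchar_comm[of _ x])

text \<open>Two cosets are either disjoint or nested. They are nested when their centres agree up to
  the smaller depth, and the intersection then has the larger depth.\<close>

lemma L2inner_coset_ind:
  assumes "x \<in> G" "y \<in> G"
  shows "L2inner L (coset_ind (x, l)) (coset_ind (y, m)) =
    (if vsub p x y \<in> vnbhd p (min l m) then of_real (real p powr (- max l m)) else 0)"
proof -
  let ?c = "vcoset p x l \<inter> vcoset p y m"
  have "L2inner L (coset_ind (x, l)) (coset_ind (y, m)) = (\<integral>w. complex_of_real (indicator ?c w) \<partial>L)"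
    unfolding L2inner_def coset_ind_def by (intro Bochner_Integration.integral_cong) (auto simp: indicator_def)
  also have "\<dots> = complex_of_real (measure L ?c)"
  proof -
    have "?c \<subseteq> space L" by (auto simp: vcoset_def)
    thus ?thesis by (simp add: Int_absorb2 integral_complex_of_real)
  qed
  also have "measure L ?c = (if vsub p x y \<in> vnbhd p (min l m) then real p powr (- max l m) else 0)"
  proof (cases "vsub p x y \<in> vnbhd p (min l m)")
    case True
    hence "\<forall>j\<le>min l m. x j = y j" by (simp add: vsub_mem_vnbhd_iff assms)
    hence "(if l \<le> m then y else x) \<in> ?c" using assms by (auto simp: vcoset_def)
    then obtain z where z: "z \<in> vcoset p x l" "z \<in> vcoset p y m" by blast
    hence "?c = vcoset p z (max l m)" "z \<in> G" using vcoset_Int by (auto simp: vcoset_def)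
    thus ?thesis using True by (simp add: measure_def emeasure_coset)
  next
    case False
    hence "?c = {}" using assms by (auto simp: vsub_mem_vnbhd_iff vcoset_def)
    thus ?thesis using False by simp
  qed
  finally show ?thesis by simp
qed

text \<open>The product is a character of the difference of x and y on U_{-min l m}, with integral
  p^{min l m} or 0. The factors p^{-l} and p^{-m} turn this into p^{-max l m}, the measure of the
  intersection of nested cosets.\<close>

lemma L2inner_inv_fourier_coset_ind:
  assumes "x \<in> G" "y \<in> G"
  shows "L2inner L (inv_fourier p (coset_ind (x, l))) (inv_fourier p (coset_ind (y, m))) =
    L2inner L (coset_ind (x, l)) (coset_ind (y, m))"
proof -
  let ?c = "complex_of_real (real p powr (- l) * real p powr (- m))"
  have "L2inner L (inv_fourier p (coset_ind (x, l))) (inv_fourier p (coset_ind (y, m)))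
     = (\<integral>w. ?c * (indicator (vnbhd p (- min l m)) w * vchar p (vsub p x y) w) \<partial>L)"
    unfolding L2inner_def
  proof (rule Bochner_Integration.integral_cong)
    fix w assume "w \<in> space L"
    hence w: "w \<in> G" by simp
    have "indicator (vnbhd p (- min l m)) w = (indicator (vnbhd p (- l)) w * indicator (vnbhd p (- m)) w :: complex)"
      by (cases "l \<le> m") (auto simp: indicator_def vnbhd_def)
    thus "inv_fourier p (coset_ind (x, l)) w * cnj (inv_fourier p (coset_ind (y, m)) w) =
      ?c * (indicator (vnbhd p (- min l m)) w * vchar p (vsub p x y) w)"
      using assms w
      by (simp only: inv_fourier_coset_ind vchar_vsub_left vchar_comm[of w]) (simp add: indicator_def mult_ac)
  qed simp
  also have "\<dots> = ?c * (if vsub p x y \<in> vnbhd p (min l m) then of_real (real p powr (min l m)) else 0)"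
    using integral_vnbhd_vchar[OF vsub_in[OF p_gr_0 assms], of "- min l m"] by simp
  also have "\<dots> = (if vsub p x y \<in> vnbhd p (min l m) then of_real (real p powr (- max l m)) else 0)"
    using p_gr_0 by (simp add: of_real_mult[symmetric] powr_add[symmetric] del: of_real_mult) 
      (auto simp: min_def max_def)
  finally show ?thesis by (simp add: L2inner_coset_ind assms)
qed

lemma inv_fourier_coset_ind_L2:
  assumes "fst c \<in> G" shows "inv_fourier p (coset_ind c) \<in> L2fun L"
proof -
  obtain x l where c: "c = (x, l)" by (cases c)
  have U: "indicator (vnbhd p (- l)) \<in> L2fun L"
    by (rule L2fun_indicator) (auto simp: emeasure_vnbhd)
  have x: "x \<in> G" using assms c by simp
  have m: "inv_fourier p (coset_ind c) \<in> borel_measurable L \<longleftrightarrow>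
     (\<lambda>y. of_real (real p powr (- l)) * (vchar p x y * indicator (vnbhd p (- l)) y) :: complex) \<in> borel_measurable L"
    using x by (intro measurable_cong) (simp add: c inv_fourier_coset_ind vchar_comm[of _ x])
  show ?thesis
  proof (rule L2fun_bound[OF U, where c = "real p powr (- l)"])
    show "inv_fourier p (coset_ind c) \<in> borel_measurable L"
      unfolding m using measurable_vchar[OF x] by (intro borel_measurable_times) auto
  qed (use x in \<open>auto simp: c inv_fourier_coset_ind norm_mult intro!: AE_I2\<close>)
qed

lemma inv_fourier_lincomb:
  assumes "\<And>i. i \<in> F \<Longrightarrow> integrable L (e i)" "y \<in> G"
  shows "inv_fourier p (\<lambda>w. \<Sum>i\<in>F. c i * e i w) y = (\<Sum>i\<in>F. c i * inv_fourier p (e i) y)"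
proof -
  have "inv_fourier p (\<lambda>w. \<Sum>i\<in>F. c i * e i w) y = (\<integral>w. (\<Sum>i\<in>F. c i * (e i w * vchar p y w)) \<partial>L)"
    by (simp add: inv_fourier_def sum_distrib_right mult.assoc)
  also have "\<dots> = (\<Sum>i\<in>F. \<integral>w. c i * (e i w * vchar p y w) \<partial>L)"
    using integrable_vchar[OF assms(2) assms(1)] by (intro Bochner_Integration.integral_sum) auto
  finally show ?thesis by (simp add: inv_fourier_def)
qed

lemma inv_fourier_add:
  assumes "integrable L f" "integrable L g" "y \<in> G"
  shows "inv_fourier p (\<lambda>w. f w + a * g w) y = inv_fourier p f y + a * inv_fourier p g y"
  using integrable_vchar[OF assms(3,1)] integrable_vchar[OF assms(3,2)]
  by (simp add: inv_fourier_def distrib_right mult.assoc)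

lemma inv_fourier_diff_bound:
  assumes "integrable L f" "integrable L g" "y \<in> G"
  shows "cmod (inv_fourier p f y - inv_fourier p g y) \<le> (\<integral>w. cmod (f w - g w) \<partial>L)"
proof -
  have "inv_fourier p f y - inv_fourier p g y = (\<integral>w. (f w - g w) * vchar p y w \<partial>L)"
    using integrable_vchar[OF assms(3,1)] integrable_vchar[OF assms(3,2)]
    by (simp add: inv_fourier_def left_diff_distrib)
  also have "cmod \<dots> \<le> (\<integral>w. cmod ((f w - g w) * vchar p y w) \<partial>L)" by (rule integral_norm_bound)
  finally show ?thesis by (simp add: norm_mult)
qed

lemma inv_fourier_step_isometry:
  fixes a :: "(int \<Rightarrow> int) \<times> int \<Rightarrow> complex"
  assumes F: "finite F" "\<And>c. c \<in> F \<Longrightarrow> fst c \<in> G"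
  defines "t \<equiv> (\<lambda>w. \<Sum>c\<in>F. a c * coset_ind c w)"
  shows "inv_fourier p t \<in> L2fun L" "L2norm L (inv_fourier p t) = L2norm L t"
proof -
  let ?u = "\<lambda>y. \<Sum>c\<in>F. a c * inv_fourier p (coset_ind c) y"
  have eq: "inv_fourier p t y = ?u y" if "y \<in> G" for y
    unfolding t_def by (rule inv_fourier_lincomb[OF _ that]) (use F coset_ind_integrable in auto)
  have u: "?u \<in> L2fun L" using F inv_fourier_coset_ind_L2 by (intro L2fun_lincomb) auto
  have "inv_fourier p t \<in> borel_measurable L \<longleftrightarrow> ?u \<in> borel_measurable L"
    by (rule measurable_cong) (simp add: eq)
  thus "inv_fourier p t \<in> L2fun L" 
    using L2fun_meas[OF u] by (intro L2fun_bound[OF u, where c = 1] AE_I2) (auto simp: eq)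
  \<comment> \<open>The norm of a linear combination depends only on the Gram matrix of its terms,
    and the two Gram matrices agree.\<close>
  have "complex_of_real (L2sq L ?u) = of_real (L2sq L t)"
  proof -
    have "L2inner L (inv_fourier p (coset_ind c)) (inv_fourier p (coset_ind d)) = L2inner L (coset_ind c) (coset_ind d)"
      if "c \<in> F" "d \<in> F" for c d
      using L2inner_inv_fourier_coset_ind[of "fst c" "fst d" "snd c" "snd d"] F(2) that by simp
    thus ?thesis unfolding t_def using F
      by (subst (1 2) L2sq_lincomb) (auto simp: inv_fourier_coset_ind_L2 coset_ind_L2 intro!: sum.cong)
  qed
  hence "L2norm L ?u = L2norm L t" by (simp add: L2norm_eq)
  thus "L2norm L (inv_fourier p t) = L2norm L t" using L2norm_cong[of L "inv_fourier p t" ?u] eq by simp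
qed

definition coset_steps :: "((int \<Rightarrow> int) \<Rightarrow> complex) set" where
  "coset_steps = {(\<lambda>w. \<Sum>c\<in>F. a c * coset_ind c w) | F a. finite F \<and> (\<forall>c\<in>F. fst c \<in> G)}"

lemma coset_steps_diff:
  assumes "s \<in> coset_steps" "t \<in> coset_steps" shows "(\<lambda>w. s w - t w) \<in> coset_steps"
proof -
  obtain F a where s: "finite F" "\<forall>c\<in>F. fst c \<in> G" "s = (\<lambda>w. \<Sum>c\<in>F. a c * coset_ind c w)"
    using assms(1) by (auto simp: coset_steps_def)
  obtain F' b where t: "finite F'" "\<forall>c\<in>F'. fst c \<in> G" "t = (\<lambda>w. \<Sum>c\<in>F'. b c * coset_ind c w)"
    using assms(2) by (auto simp: coset_steps_def)
  obtain d where "\<forall>w. (\<Sum>c\<in>F. a c * coset_ind c w) + (\<Sum>c\<in>F'. - b c * coset_ind c w) = (\<Sum>c\<in>F \<union> F'. d c * coset_ind c w)"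
    using lincomb_add[OF s(1) t(1), of a coset_ind "\<lambda>c. - b c"] by blast
  hence "(\<lambda>w. s w - t w) = (\<lambda>w. \<Sum>c\<in>F \<union> F'. d c * coset_ind c w)"
    by (simp add: s(3) t(3) sum_negf)
  thus ?thesis using s t unfolding coset_steps_def by blast
qed

lemma coset_steps_isometry:
  assumes "t \<in> coset_steps"
  shows "t \<in> L2fun L" "integrable L t" "inv_fourier p t \<in> L2fun L" "L2norm L (inv_fourier p t) = L2norm L t"
proof -
  obtain F a where t: "finite F" "\<And>c. c \<in> F \<Longrightarrow> fst c \<in> G" "t = (\<lambda>w. \<Sum>c\<in>F. a c * coset_ind c w)"
    using assms by (auto simp: coset_steps_def)
  show "t \<in> L2fun L" unfolding t(3) by (intro L2fun_lincomb coset_ind_L2 t)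
  show "integrable L t" unfolding t(3) using t coset_ind_integrable by auto
  show "inv_fourier p t \<in> L2fun L" "L2norm L (inv_fourier p t) = L2norm L t"
    unfolding t(3) by (rule inv_fourier_step_isometry[OF t(1,2)], assumption)+
qed

lemma coset_span_vnbhd:
  assumes f: "f \<in> L2fun L" "\<And>x. x \<notin> vnbhd p m \<Longrightarrow> f x = 0"
  shows "f \<in> L2_closed_span L {c. fst c \<in> vnbhd p m \<and> snd c \<ge> m} coset_ind"
proof -
  define I where "I = {c. fst c \<in> vnbhd p m \<and> snd c \<ge> m}"
  have I: "coset_ind c \<in> L2fun L" if "c \<in> I" for c
    using that by (intro coset_ind_L2) (auto simp: I_def vnbhd_in)
  have "f \<in> L2_closed_span L I coset_ind"
  proof (rule L2_closed_span_vnbhd[OF I _ f])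
    fix x l assume "x \<in> vnbhd p m" "l \<ge> m"
    hence "coset_ind (x, l) \<in> L2_closed_span L I coset_ind"
      by (intro L2_closed_span_base I) (auto simp: I_def)
    thus "indicator (vcoset p x l) \<in> L2_closed_span L I coset_ind" by (simp add: coset_ind_def)
  qed
  thus ?thesis by (simp add: I_def)
qed

text \<open>The approximant keeps the support of f. Without this control an L^2 error could not be
  converted into an L^1 error.\<close>

lemma coset_steps_approx_vnbhd:
  assumes f: "f \<in> L2fun L" "\<And>x. x \<notin> vnbhd p m \<Longrightarrow> f x = 0" and "\<epsilon> > 0"
  shows "\<exists>t\<in>coset_steps. (\<forall>x. x \<notin> vnbhd p m \<longrightarrow> t x = 0) \<and> L2norm L (\<lambda>x. f x - t x) < \<epsilon>"
proof -
  define I where "I = {c. fst c \<in> vnbhd p m \<and> snd c \<ge> m}"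
  have "f \<in> L2_closed_span L I coset_ind" unfolding I_def by (rule coset_span_vnbhd[OF f])
  then obtain F a where
    F: "finite F" "F \<subseteq> I" "L2norm L (\<lambda>x. f x - (\<Sum>c\<in>F. a c * coset_ind c x)) < \<epsilon>"
    using \<open>\<epsilon> > 0\<close> unfolding L2_closed_span_def by blast
  have "(\<Sum>c\<in>F. a c * coset_ind c x) = 0" if "x \<notin> vnbhd p m" for x
    using F(2) that by (intro sum.neutral) (auto simp: I_def coset_ind_def indicator_def vcoset_def vnbhd_def)
  moreover have "(\<lambda>x. \<Sum>c\<in>F. a c * coset_ind c x) \<in> coset_steps"
    unfolding coset_steps_def using F(1,2) vnbhd_in
    by (intro CollectI exI[of _ F] exI[of _ a]) (auto simp: I_def)
  ultimately show ?thesis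
    using F(3) by (intro bexI[of _ "\<lambda>x. \<Sum>c\<in>F. a c * coset_ind c x"] conjI allI impI)
qed

lemma measure_vnbhd: "measure L (vnbhd p l) = real p powr (- l)"
  by (simp add: measure_def emeasure_vnbhd)

text \<open>Pointwise convergence of the transforms comes from L^1 convergence, which L^2
  convergence does not give on a space of infinite measure. Hence the approximant at stage k lives
  on U_{-k}, with an L^2 error small enough to beat the measure p^k of that set.\<close>

lemma coset_steps_approx:
  assumes f: "f \<in> L2fun L" "integrable L f"
  shows "\<exists>t. (\<forall>k. t k \<in> coset_steps) \<and> (\<lambda>k. L2norm L (\<lambda>x. f x - t k x)) \<longlonglongrightarrow> 0 \<and>
    (\<forall>y\<in>G. (\<lambda>k. inv_fourier p (t k) y) \<longlonglongrightarrow> inv_fourier p f y)"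
proof -
  define u where "u k = (\<lambda>x. f x * indicator (vnbhd p (- int k)) x)" for k :: nat
  \<comment> \<open>In \<open>L1_le_L2\<close> with a = \<delta>, the first term is p^{-2k} times
    p^k and the second is at most p^{-2k}, so the L^1 error is at most p^{-k}.\<close>
  define \<delta> where "\<delta> k = (1 / real p) ^ (2 * k)" for k :: nat
  have \<delta>: "\<delta> k > 0" for k using p_gr_0 by (simp add: \<delta>_def)
  have uL: "u k \<in> L2fun L" for k unfolding u_def by (rule L2fun_restrict[OF f(1) vnbhd_sets])
  have "\<exists>t\<in>coset_steps. (\<forall>x. x \<notin> vnbhd p (- int k) \<longrightarrow> t x = 0) \<and> L2norm L (\<lambda>x. u k x - t x) < \<delta> k" for k
    by (rule coset_steps_approx_vnbhd[OF uL _ \<delta>]) (simp add: u_def)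
  then obtain t where t: "\<And>k. t k \<in> coset_steps" "\<And>k x. x \<notin> vnbhd p (- int k) \<Longrightarrow> t k x = 0"
    "\<And>k. L2norm L (\<lambda>x. u k x - t k x) < \<delta> k" by metis
  note tI = coset_steps_isometry[OF t(1)]
  have lim1: "(\<lambda>k. L2norm L (\<lambda>x. f x - u k x)) \<longlonglongrightarrow> 0"
    unfolding u_def by (rule L2norm_restrict_lim[OF f(1)])
  have p1: "norm (1 / real p) < 1" using p_gr_1 by simp
  have \<delta>0: "\<delta> \<longlonglongrightarrow> 0"
    unfolding \<delta>_def power_mult by (rule LIMSEQ_power_zero) (use p_gr_1 in \<open>simp add: power_one_over[symmetric] power_less_one_iff\<close>)
  have L2: "(\<lambda>k. L2norm L (\<lambda>x. f x - t k x)) \<longlonglongrightarrow> 0"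
  proof (rule tendsto_sandwich[OF _ _ tendsto_const])
    show "(\<lambda>k. L2norm L (\<lambda>x. f x - u k x) + \<delta> k) \<longlonglongrightarrow> 0"
      using tendsto_add[OF lim1 \<delta>0] by simp
    show "eventually (\<lambda>k. L2norm L (\<lambda>x. f x - t k x) \<le> L2norm L (\<lambda>x. f x - u k x) + \<delta> k) sequentially"
      using L2norm_triangle_diff[OF f(1) uL tI(1)] t(3) by (intro always_eventually allI) (meson add_left_mono less_imp_le order_trans)
  qed simp
  have L1: "(\<integral>x. cmod (u k x - t k x) \<partial>L) \<le> (1 / real p) ^ k" for k
  proof -
    let ?g = "\<lambda>x. u k x - t k x"
    have "(\<integral>x. cmod (?g x) \<partial>L) \<le> (\<delta> k * measure L (vnbhd p (- int k)) + L2sq L ?g / \<delta> k) / 2"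
      by (rule L1_le_L2(2)[OF L2fun_diff[OF uL tI(1)] vnbhd_sets vnbhd_finite _ \<delta>]) (auto simp: u_def t(2))
    also have "L2sq L ?g \<le> (\<delta> k)\<^sup>2"
      unfolding L2norm_sq[symmetric] using t(3)[of k] by (intro power_mono) auto
    hence "L2sq L ?g / \<delta> k \<le> \<delta> k"
      using \<delta>[of k] by (simp add: divide_le_eq power2_eq_square)
    also have "\<delta> k * measure L (vnbhd p (- int k)) = (1 / real p) ^ k"
      using p_gr_0 by (simp add: measure_vnbhd powr_realpow \<delta>_def power_one_over power_mult power2_eq_square power_mult_distrib field_simps power_add[symmetric] mult_2)
    also have "\<delta> k \<le> (1 / real p) ^ k"
      unfolding \<delta>_def using p_gr_1 by (intro power_decreasing) auto
    finally show ?thesis by simp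
  qed
  have L1': "(\<lambda>k. \<integral>x. cmod (f x - u k x) \<partial>L) \<longlonglongrightarrow> (\<integral>x. 0 \<partial>L)"
  proof (rule integral_dominated_convergence)
    show "integrable L (\<lambda>x. cmod (f x))" using f(2) by simp
    show "AE x in L. (\<lambda>k. cmod (f x - u k x)) \<longlonglongrightarrow> 0"
    proof (rule AE_I2)
      fix x assume "x \<in> space L"
      hence "(\<lambda>k. cmod (f x - u k x)) \<longlonglongrightarrow> cmod (f x - f x)"
        unfolding u_def using restrict_vnbhd_lim[of x f] by (intro tendsto_intros) simp
      thus "(\<lambda>k. cmod (f x - u k x)) \<longlonglongrightarrow> 0" by simp
    qed
    show "AE x in L. norm (cmod (f x - u k x)) \<le> cmod (f x)" for k
      by (auto simp: u_def indicator_def)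
  qed (use L2fun_meas[OF f(1)] L2fun_meas[OF uL] in auto)
  have ui: "integrable L (u k)" for k
    by (rule Bochner_Integration.integrable_bound[OF f(2) L2fun_meas[OF uL]]) (auto simp: u_def indicator_def)
  have "(\<lambda>k. inv_fourier p (t k) y) \<longlonglongrightarrow> inv_fourier p f y" if y: "y \<in> G" for y
  proof (rule Lim_null_comparison[THEN LIM_zero_cancel])
    show "(\<lambda>k. (\<integral>x. cmod (f x - u k x) \<partial>L) + (1 / real p) ^ k) \<longlonglongrightarrow> 0"
      using tendsto_add[OF L1' LIMSEQ_power_zero[OF p1]] by simp
    show "eventually (\<lambda>k. norm (inv_fourier p (t k) y - inv_fourier p f y) \<le> (\<integral>x. cmod (f x - u k x) \<partial>L) + (1 / real p) ^ k) sequentially"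
    proof (intro always_eventually allI)
      fix k
      have "norm (inv_fourier p (t k) y - inv_fourier p f y) \<le> 
        norm (inv_fourier p f y - inv_fourier p (u k) y) + norm (inv_fourier p (u k) y - inv_fourier p (t k) y)"
        by (metis norm_minus_commute norm_diff_triangle_le order_refl)
      thus "norm (inv_fourier p (t k) y - inv_fourier p f y) \<le> (\<integral>x. cmod (f x - u k x) \<partial>L) + (1 / real p) ^ k"
        using inv_fourier_diff_bound[OF f(2) ui y, of k] inv_fourier_diff_bound[OF ui tI(2) y, of k k] L1[of k] by linarith
    qed
  qed
  thus ?thesis using t(1) L2 by blast
qed

text \<open>Fatou's lemma alone shows that the norm does not increase. For equality the transforms
  of the approximants must converge in norm, which Fatou's lemma also yields when applied to
  differences of approximants.\<close>

theorem inv_fourier_isometry: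
  assumes f: "f \<in> L2fun L" "integrable L f"
  shows "inv_fourier p f \<in> L2fun L" "L2norm L (inv_fourier p f) = L2norm L f"
proof -
  obtain t where t: "\<And>k. t k \<in> coset_steps" and L2: "(\<lambda>k. L2norm L (\<lambda>x. f x - t k x)) \<longlonglongrightarrow> 0"
    and lim: "\<And>y. y \<in> G \<Longrightarrow> (\<lambda>k. inv_fourier p (t k) y) \<longlonglongrightarrow> inv_fourier p f y"
    using coset_steps_approx[OF f] by blast
  note tI = coset_steps_isometry[OF t]
  have meas: "inv_fourier p f \<in> borel_measurable L"
    by (rule borel_measurable_LIMSEQ_metric[where f = "\<lambda>k. inv_fourier p (t k)"])
      (simp_all add: lim L2fun_meas tI(3))
  have *: "L2norm L (inv_fourier p (t k)) \<le> L2norm L f + L2norm L (\<lambda>x. f x - t k x)" for k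
    using L2norm_triangle_minus[OF tI(1) f(1), of k] L2norm_minus[of L f "t k"] tI(4) by simp
  have lim': "(\<lambda>k. L2norm L f + L2norm L (\<lambda>x. f x - t k x)) \<longlonglongrightarrow> L2norm L f"
    using tendsto_add[OF tendsto_const L2, of "L2norm L f"] by simp
  note contr = L2fun_Fatou[OF tI(3) * lim' meas AE_I2]
  show FL: "inv_fourier p f \<in> L2fun L" by (rule contr(1)) (simp add: lim)
  have le: "L2norm L (inv_fourier p f) \<le> L2norm L f" by (rule contr(2)) (simp add: lim)
  \<comment> \<open>The stage m is fixed and k tends to infinity: the transforms of t_k - t_m
    converge pointwise to that of f minus that of t_m.\<close>
  have D: "L2norm L (\<lambda>y. inv_fourier p f y - inv_fourier p (t m) y) \<le> L2norm L (\<lambda>x. f x - t m x)" for m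
  proof (rule L2fun_Fatou(2))
    note dI = coset_steps_isometry[OF coset_steps_diff[OF t t]]
    show "inv_fourier p (\<lambda>w. t k w - t m w) \<in> L2fun L" for k by (rule dI)
    show "L2norm L (inv_fourier p (\<lambda>w. t k w - t m w)) \<le> L2norm L (\<lambda>x. f x - t k x) + L2norm L (\<lambda>x. f x - t m x)" for k
      using L2norm_triangle_diff[OF tI(1) f(1) tI(1), of k m] L2norm_minus[of L f "t k"] dI(4)[of k m] by simp
    show "(\<lambda>k. L2norm L (\<lambda>x. f x - t k x) + L2norm L (\<lambda>x. f x - t m x)) \<longlonglongrightarrow> L2norm L (\<lambda>x. f x - t m x)"
      using tendsto_add[OF L2 tendsto_const, of "L2norm L (\<lambda>x. f x - t m x)"] by simp
    show "(\<lambda>y. inv_fourier p f y - inv_fourier p (t m) y) \<in> borel_measurable L"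
      using meas L2fun_meas[OF tI(3)] by simp
    show "AE y in L. (\<lambda>k. inv_fourier p (\<lambda>w. t k w - t m w) y) \<longlonglongrightarrow> inv_fourier p f y - inv_fourier p (t m) y"
    proof (rule AE_I2)
      fix y assume "y \<in> space L"
      hence y: "y \<in> G" by simp
      have "inv_fourier p (\<lambda>w. t k w - t m w) y = inv_fourier p (t k) y - inv_fourier p (t m) y" for k
        using inv_fourier_add[OF tI(2) tI(2) y, of k "-1" m] by simp
      thus "(\<lambda>k. inv_fourier p (\<lambda>w. t k w - t m w) y) \<longlonglongrightarrow> inv_fourier p f y - inv_fourier p (t m) y"
        using tendsto_diff[OF lim[OF y] tendsto_const] by simp
    qed
  qed
  have "L2norm L f \<le> L2norm L (inv_fourier p f) + 2 * L2norm L (\<lambda>x. f x - t k x)" for k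
    using L2norm_triangle_minus[OF f(1) tI(1), of k] tI(4)[of k] D[of k]
      L2norm_triangle_minus[OF tI(3) FL, of k] L2norm_minus[of L "inv_fourier p f" "inv_fourier p (t k)"] by linarith
  moreover have "(\<lambda>k. L2norm L (inv_fourier p f) + 2 * L2norm L (\<lambda>x. f x - t k x)) \<longlonglongrightarrow> L2norm L (inv_fourier p f) + 2 * 0"
    by (intro tendsto_intros L2)
  ultimately have "L2norm L f \<le> L2norm L (inv_fourier p f)"
    using LIMSEQ_le_const by fastforce
  thus "L2norm L (inv_fourier p f) = L2norm L f" using le by simp
qed

lemma L2inner_inv_fourier:
  assumes f: "f \<in> L2fun L" "integrable L f" and g: "g \<in> L2fun L" "integrable L g"
  shows "L2inner L (inv_fourier p f) (inv_fourier p g) = L2inner L f g"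
proof -
  have *: "L2sq L (\<lambda>x. inv_fourier p f x + a * inv_fourier p g x) = L2sq L (\<lambda>x. f x + a * g x)" for a
  proof -
    have "L2norm L (\<lambda>x. inv_fourier p f x + a * inv_fourier p g x) = L2norm L (inv_fourier p (\<lambda>x. f x + a * g x))"
      by (rule L2norm_cong) (simp add: inv_fourier_add f g)
    also have "\<dots> = L2norm L (\<lambda>x. f x + a * g x)"
      using f g by (intro inv_fourier_isometry L2fun_add L2fun_cmult) auto
    finally show ?thesis by (simp add: L2norm_eq)
  qed
  have "L2sq L (inv_fourier p f) = L2sq L f" "L2sq L (inv_fourier p g) = L2sq L g"
    using inv_fourier_isometry(2)[OF f] inv_fourier_isometry(2)[OF g] by (simp_all add: L2norm_eq)
  thus ?thesis
    using *[of 1] *[of \<i>] inv_fourier_isometry(1) f g by (simp add: L2inner_polarization)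
qed

end

section \<open>Wavelet sets and tilings\<close>

context vilenkin_group
begin

definition wfreq :: "(int \<Rightarrow> int) set \<Rightarrow> (int \<Rightarrow> int) \<Rightarrow> (int \<Rightarrow> int) \<Rightarrow> complex" where
  "wfreq \<Omega> h w = indicator \<Omega> w * cnj (vchar p h w)"

definition wfam :: "(int \<Rightarrow> int) set \<Rightarrow> int \<times> (int \<Rightarrow> int) \<Rightarrow> (int \<Rightarrow> int) \<Rightarrow> complex" where
  "wfam \<Omega> i w = of_real (real p powr (- of_int (fst i) / 2)) * wfreq \<Omega> (snd i) (vshift (- fst i) w)"

text \<open>The system in the definition of \<open>wavelet\<close> for the transform of 1_\<Omega>,
  given a name and kept in the same form so that unfolding identifies the two.\<close>

definition wsys :: "(int \<Rightarrow> int) set \<Rightarrow> int \<times> (int \<Rightarrow> int) \<Rightarrow> (int \<Rightarrow> int) \<Rightarrow> complex" where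
  "wsys \<Omega> = (\<lambda>(j, h) x. of_real (real p powr (of_int j / 2)) * inv_fourier p (indicator \<Omega>) (vsub p (vshift j x) h))"

text \<open>Modulo H only the digits 1 to n matter, so membership takes the form in which
  \<open>sum_vchar\<close> applies to the difference of w and x.\<close>

lemma vfrac_mem_vcoset_iff:
  assumes x: "x \<in> vnbhd p 0" and w: "w \<in> G"
  shows "vfrac w \<in> vcoset p x (int n) \<longleftrightarrow> (\<forall>j\<in>{1..int n}. vsub p w x j = 0)"
proof -
  have "vfrac w \<in> G" using vfrac_in[OF p_gr_0 w] by (rule vnbhd_in)
  thus ?thesis using x vnbhd_in[OF x] w
    by (auto simp: vsub_nth_eq_0_iff) (auto simp: vcoset_def vfrac_def vnbhd_def)
qed

lemma measurable_vchar_cnj: "h \<in> G \<Longrightarrow> (\<lambda>w. cnj (vchar p h w)) \<in> borel_measurable L"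
  using measurable_vchar by (intro borel_measurable_continuous_on[OF continuous_on_cnj[OF continuous_on_id]]) simp

lemma L2sq_vshift: "f \<in> borel_measurable L \<Longrightarrow> L2sq L (\<lambda>w. f (vshift k w)) = real p powr (- k) * L2sq L f"
  unfolding L2sq_def using integral_vshift[of "\<lambda>w. (cmod (f w))\<^sup>2" k] by simp

lemma L2fun_vshift: "f \<in> L2fun L \<Longrightarrow> (\<lambda>w. f (vshift k w)) \<in> L2fun L"
  unfolding L2fun_def using integrable_vshift[of "\<lambda>w. (cmod (f w))\<^sup>2" k] measurable_compose[OF measurable_vshift] by auto

context
  fixes \<Omega> :: "(int \<Rightarrow> int) set"
  assumes \<Omega>: "\<Omega> \<in> sets L" "emeasure L \<Omega> < \<infinity>"
begin

lemma ind_\<Omega>_L2: "indicator \<Omega> \<in> L2fun L"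
  using \<Omega> by (rule L2fun_indicator)

lemma ind_\<Omega>_integrable: "integrable L (indicator \<Omega> :: _ \<Rightarrow> complex)"
proof -
  have "integrable L (\<lambda>x. complex_of_real (indicator \<Omega> x))"
    using \<Omega> by (intro integrable_of_real integrable_real_indicator) auto
  thus ?thesis by (simp add: of_real_indicator)
qed

lemma wfreq_L2: "h \<in> G \<Longrightarrow> wfreq \<Omega> h \<in> L2fun L"
  unfolding wfreq_def using \<Omega>(1) measurable_vchar_cnj
  by (intro L2fun_bound[OF ind_\<Omega>_L2, where c = 1] borel_measurable_times) (auto simp: norm_mult)

lemma wfreq_integrable: "h \<in> G \<Longrightarrow> integrable L (wfreq \<Omega> h)"
  by (rule Bochner_Integration.integrable_bound[OF ind_\<Omega>_integrable L2fun_meas[OF wfreq_L2]])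
    (auto simp: norm_mult wfreq_def)

lemma wfam_L2: "snd i \<in> G \<Longrightarrow> wfam \<Omega> i \<in> L2fun L"
  unfolding wfam_def[abs_def] by (intro L2fun_cmult L2fun_vshift wfreq_L2)

lemma wfam_integrable: "snd i \<in> G \<Longrightarrow> integrable L (wfam \<Omega> i)"
  unfolding wfam_def[abs_def] by (intro integrable_mult_right integrable_vshift wfreq_integrable)

text \<open>Substituting the shifted variable moves j into the character as
  \<open>vshift j x\<close> and contributes p^j, which turns p^{-j/2} into p^{j/2}. The conjugate
  character of h becomes the translation by h.\<close>

lemma inv_fourier_wfam:
  assumes "h \<in> G" "x \<in> G"
  shows "inv_fourier p (wfam \<Omega> (j, h)) x = wsys \<Omega> (j, h) x"
proof -
  let ?c = "complex_of_real (real p powr (- of_int j / 2))"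
  let ?g = "\<lambda>v. wfreq \<Omega> h v * vchar p (vshift j x) v"
  have gm: "?g \<in> borel_measurable L"
    using assms measurable_vchar L2fun_meas[OF wfreq_L2] by (intro borel_measurable_times) (auto simp: vshift_in)
  have "inv_fourier p (wfam \<Omega> (j, h)) x = (\<integral>w. ?c * ?g (vshift (- j) w) \<partial>L)"
    unfolding inv_fourier_def
    by (intro Bochner_Integration.integral_cong) (auto simp: wfam_def vchar_vshift)
  also have "\<dots> = ?c * ((real p powr j) *\<^sub>R (\<integral>w. ?g w \<partial>L))"
    using integral_vshift[OF gm, of "- j"] by simp
  also have "\<dots> = of_real (real p powr (- of_int j / 2) * real p powr j) * (\<integral>w. ?g w \<partial>L)"
    by (simp add: scaleR_conv_of_real mult.assoc)
  also have "real p powr (- of_int j / 2) * real p powr j = real p powr (of_int j / 2)"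
    by (simp add: powr_add[symmetric] field_simps)
  also have "(\<integral>w. ?g w \<partial>L) = inv_fourier p (indicator \<Omega>) (vsub p (vshift j x) h)"
    unfolding inv_fourier_def using assms
    by (intro Bochner_Integration.integral_cong) (auto simp: wfreq_def vchar_vsub_left vshift_in)
  finally show ?thesis by (simp add: wsys_def)
qed

text \<open>The two factors p^{-j/2} cancel against the Jacobian p^j. Orthonormality inside one
  scale is therefore the same condition for every j, namely one on the Fourier coefficients of
  1_\<Omega>.\<close>

lemma L2inner_wfam_same:
  assumes "h \<in> G" "k \<in> G"
  shows "L2inner L (wfam \<Omega> (j, h)) (wfam \<Omega> (j, k)) = (\<integral>w. indicator \<Omega> w * vchar p (vsub p k h) w \<partial>L)"
proof -
  let ?c = "real p powr (- of_int j / 2)"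
  let ?g = "\<lambda>v. indicator \<Omega> v * vchar p (vsub p k h) v"
  have gm: "?g \<in> borel_measurable L"
    using assms measurable_vchar[OF vsub_in[OF p_gr_0]] \<Omega> by (intro borel_measurable_times) auto
  have "L2inner L (wfam \<Omega> (j, h)) (wfam \<Omega> (j, k)) = (\<integral>w. of_real (?c * ?c) * ?g (vshift (- j) w) \<partial>L)"
    unfolding L2inner_def using assms
    by (intro Bochner_Integration.integral_cong) 
      (auto simp: wfam_def wfreq_def vchar_vsub_left vshift_in indicator_def)
  also have "\<dots> = of_real (?c * ?c) * (real p powr j *\<^sub>R (\<integral>w. ?g w \<partial>L))"
    using integral_vshift[OF gm, of "- j"] by simp
  also have "\<dots> = of_real (?c * ?c * real p powr j) * (\<integral>w. ?g w \<partial>L)"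
    by (simp add: scaleR_conv_of_real mult.assoc)
  also have "?c * ?c * real p powr j = 1"
    using p_gr_0 by (simp add: powr_add[symmetric])
  finally show ?thesis by simp
qed

lemma L2inner_wsys:
  assumes "snd i \<in> G" "snd k \<in> G"
  shows "L2inner L (wsys \<Omega> i) (wsys \<Omega> k) = L2inner L (wfam \<Omega> i) (wfam \<Omega> k)"
proof -
  have "L2inner L (wsys \<Omega> i) (wsys \<Omega> k) = L2inner L (inv_fourier p (wfam \<Omega> i)) (inv_fourier p (wfam \<Omega> k))"
    unfolding L2inner_def using assms inv_fourier_wfam[of "snd i" _ "fst i"] inv_fourier_wfam[of "snd k" _ "fst k"]
    by (intro Bochner_Integration.integral_cong) auto
  also have "\<dots> = L2inner L (wfam \<Omega> i) (wfam \<Omega> k)"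
    using assms by (intro L2inner_inv_fourier wfam_L2 wfam_integrable)
  finally show ?thesis .
qed

lemma wsys_L2: "snd i \<in> G \<Longrightarrow> wsys \<Omega> i \<in> L2fun L"
proof -
  assume i: "snd i \<in> G"
  have F: "inv_fourier p (wfam \<Omega> i) \<in> L2fun L"
    by (rule inv_fourier_isometry(1)[OF wfam_L2[OF i] wfam_integrable[OF i]])
  have eq: "inv_fourier p (wfam \<Omega> i) x = wsys \<Omega> i x" if "x \<in> G" for x
    using inv_fourier_wfam[OF i that, of "fst i"] by simp
  have "inv_fourier p (wfam \<Omega> i) \<in> borel_measurable L \<longleftrightarrow> wsys \<Omega> i \<in> borel_measurable L"
    by (rule measurable_cong) (simp add: eq)
  thus ?thesis using L2fun_meas[OF F]
    by (intro L2fun_bound[OF F, where c = 1] AE_I2) (auto simp: eq)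
qed

text \<open>Approximation errors are equal on both sides of the transform. This is applied to the
  indicator of an uncovered set for necessity and to the preimage of a coset indicator for
  sufficiency.\<close>

lemma L2norm_wsys_lincomb:
  assumes f: "f \<in> L2fun L" "integrable L f" and F: "finite F" "\<And>i. i \<in> F \<Longrightarrow> snd i \<in> G"
  shows "L2norm L (\<lambda>x. inv_fourier p f x - (\<Sum>i\<in>F. c i * wsys \<Omega> i x)) = L2norm L (\<lambda>x. f x - (\<Sum>i\<in>F. c i * wfam \<Omega> i x))"
proof -
  let ?s = "\<lambda>x. \<Sum>i\<in>F. c i * wfam \<Omega> i x"
  have s: "?s \<in> L2fun L" "integrable L ?s"
    by (intro L2fun_lincomb wfam_L2 F(2), assumption)
      (intro Bochner_Integration.integrable_sum integrable_mult_right wfam_integrable F(2))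
  have "inv_fourier p f x - (\<Sum>i\<in>F. c i * wsys \<Omega> i x) = inv_fourier p (\<lambda>w. f w + (-1) * ?s w) x" if x: "x \<in> G" for x
  proof -
    have "inv_fourier p ?s x = (\<Sum>i\<in>F. c i * inv_fourier p (wfam \<Omega> i) x)"
      using F wfam_integrable by (intro inv_fourier_lincomb x) auto
    also have "\<dots> = (\<Sum>i\<in>F. c i * wsys \<Omega> i x)"
      using F inv_fourier_wfam[of "snd _" x "fst _"] x by (intro sum.cong) auto
    finally show ?thesis using inv_fourier_add[OF f(2) s(2) x, of "-1"] by simp
  qed
  hence "L2norm L (\<lambda>x. inv_fourier p f x - (\<Sum>i\<in>F. c i * wsys \<Omega> i x)) = L2norm L (inv_fourier p (\<lambda>w. f w + (-1) * ?s w))"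
    by (intro L2norm_cong) simp
  also have "\<dots> = L2norm L (\<lambda>w. f w + (-1) * ?s w)"
    using f s by (intro inv_fourier_isometry(2) L2fun_add L2fun_cmult) auto
  finally show ?thesis by simp
qed

section \<open>Tiling by translations and Fourier coefficients\<close>

lemma vfrac_vimage_sets: "E \<in> sets L \<Longrightarrow> \<Omega> \<inter> vfrac -` E \<in> sets L"
proof -
  assume E: "E \<in> sets L"
  have "\<Omega> \<inter> vfrac -` E = \<Omega> \<inter> (vfrac -` E \<inter> space L)" using sets.sets_into_space[OF \<Omega>(1)] by auto
  thus ?thesis using measurable_sets[OF measurable_vfrac E] \<Omega>(1) by (metis sets.Int)
qed

lemma measurable_veta: "veta p \<Omega> \<in> borel_measurable L"
proof -
  have "(\<lambda>w. indicator \<Omega> (vadd p w h) :: ennreal) \<in> borel_measurable L" if "h \<in> vH p" for h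
    using measurable_compose[OF measurable_vadd[OF vH_in[OF that]] borel_measurable_indicator[OF \<Omega>(1)]]
    by (simp add: vadd_comm)
  thus ?thesis unfolding veta_eq[abs_def] by (rule borel_measurable_nn_integral_vH)
qed

text \<open>On U the function \<eta> of \<Omega> is the density of the image under
  \<open>vfrac\<close> of Haar measure restricted to \<Omega>. This follows by unfolding over U,
  where \<open>vfrac\<close> sends w \<oplus> h back to w.\<close>

lemma emeasure_veta:
  assumes E: "E \<in> sets L"
  shows "emeasure L (\<Omega> \<inter> vfrac -` E) = (\<integral>\<^sup>+w. veta p \<Omega> w * indicator (vnbhd p 0) w * indicator E w \<partial>L)"
proof -
  have "emeasure L (\<Omega> \<inter> vfrac -` E) = (\<integral>\<^sup>+w. indicator (\<Omega> \<inter> vfrac -` E) w \<partial>L)"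
    using vfrac_vimage_sets[OF E] by simp
  also have "\<dots> = (\<integral>\<^sup>+w. (\<integral>\<^sup>+h. indicator (\<Omega> \<inter> vfrac -` E) (vadd p w h) \<partial>count_space (vH p)) * indicator (vnbhd p 0) w \<partial>L)"
    using vfrac_vimage_sets[OF E] by (intro nn_integral_periodize) auto
  also have "\<dots> = (\<integral>\<^sup>+w. veta p \<Omega> w * indicator (vnbhd p 0) w * indicator E w \<partial>L)"
  proof (intro nn_integral_cong)
    fix w assume "w \<in> space L"
    show "(\<integral>\<^sup>+h. indicator (\<Omega> \<inter> vfrac -` E) (vadd p w h) \<partial>count_space (vH p)) * indicator (vnbhd p 0) w =
      veta p \<Omega> w * indicator (vnbhd p 0) w * indicator E w"
    proof (cases "w \<in> vnbhd p 0")
      case True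
      have "(\<integral>\<^sup>+h. indicator (\<Omega> \<inter> vfrac -` E) (vadd p w h) \<partial>count_space (vH p)) = (\<integral>\<^sup>+h. indicator \<Omega> (vadd p w h) * indicator E w \<partial>count_space (vH p))"
        using True by (intro nn_integral_cong) (auto simp: indicator_def vfrac_vadd_vH vfrac_vnbhd vnbhd_in)
      also have "\<dots> = veta p \<Omega> w * indicator E w" by (simp add: veta_eq nn_integral_multc)
      finally show ?thesis using True by simp
    qed simp
  qed
  finally show ?thesis .
qed

text \<open>Translation tilings are handled through the image of the restricted measure on the fractional parts.\<close>

lemma tile_distr:
  assumes T: "AE w in L. veta p \<Omega> w = 1"
  shows "distr (density L (indicator \<Omega>)) L vfrac = density L (indicator (vnbhd p 0))"
proof (rule measure_eqI)
  fix E assume "E \<in> sets (distr (density L (indicator \<Omega>)) L vfrac)"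
  hence E: "E \<in> sets L" by simp
  have "emeasure (distr (density L (indicator \<Omega>)) L vfrac) E = emeasure (density L (indicator \<Omega>)) (vfrac -` E \<inter> space L)"
    using E measurable_vfrac by (subst emeasure_distr) auto
  also have "\<dots> = emeasure L (\<Omega> \<inter> vfrac -` E)"
  proof -
    have "\<Omega> \<inter> (vfrac -` E \<inter> space L) = \<Omega> \<inter> vfrac -` E" using sets.sets_into_space[OF \<Omega>(1)] by auto
    thus ?thesis using E \<Omega>(1) measurable_sets[OF measurable_vfrac E] by (subst emeasure_restricted) auto
  qed
  also have "\<dots> = (\<integral>\<^sup>+w. indicator (vnbhd p 0) w * indicator E w \<partial>L)"
    unfolding emeasure_veta[OF E] by (rule nn_integral_cong_AE, use T in eventually_elim) simp
  also have "\<dots> = emeasure (density L (indicator (vnbhd p 0))) E"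
    using E by (simp add: emeasure_density)
  finally show "emeasure (distr (density L (indicator \<Omega>)) L vfrac) E = emeasure (density L (indicator (vnbhd p 0))) E" .
qed simp

text \<open>For functions that are constant modulo H, a tile serves as well as U. Applied to squared
  moduli, this makes passage from U to \<Omega> an isometry.\<close>

lemma tile_integral:
  fixes k :: "_ \<Rightarrow> 'b::{banach, second_countable_topology}"
  assumes T: "AE w in L. veta p \<Omega> w = 1" and k: "k \<in> borel_measurable L"
  shows "(\<integral>w. indicator \<Omega> w *\<^sub>R k (vfrac w) \<partial>L) = (\<integral>w. indicator (vnbhd p 0) w *\<^sub>R k w \<partial>L)"
proof -
  have km: "(\<lambda>w. k (vfrac w)) \<in> borel_measurable L" by (rule measurable_compose[OF measurable_vfrac k])
  have e: "density L (\<lambda>w. ennreal (indicator A w)) = density L (indicator A)" for A :: "(int \<Rightarrow> int) set"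
    by (simp add: ennreal_indicator)
  have "(\<integral>w. indicator \<Omega> w *\<^sub>R k (vfrac w) \<partial>L) = (\<integral>w. k (vfrac w) \<partial>density L (indicator \<Omega>))"
    using \<Omega>(1) km unfolding e[symmetric] by (subst integral_density) auto
  also have "\<dots> = (\<integral>w. k w \<partial>distr (density L (indicator \<Omega>)) L vfrac)"
    using measurable_vfrac k by (subst integral_distr) auto
  also have "\<dots> = (\<integral>w. k w \<partial>density L (indicator (vnbhd p 0)))" unfolding tile_distr[OF T] ..
  also have "\<dots> = (\<integral>w. indicator (vnbhd p 0) w *\<^sub>R k w \<partial>L)"
    using k unfolding e[symmetric] by (subst integral_density) auto
  finally show ?thesis .
qed

lemma vchar_vfrac: "h \<in> vH p \<Longrightarrow> w \<in> G \<Longrightarrow> vchar p h (vfrac w) = vchar p h w"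
proof -
  assume hw: "h \<in> vH p" "w \<in> G"
  have "vchar p h (vadd p (vfrac w) (vtrunc 0 w)) = vchar p h (vfrac w)"
    using hw p_gr_0 vnbhd_in[OF vfrac_in[OF p_gr_0]] vH_trunc[OF p_gr_0]
    by (subst vchar_vadd_right) (auto simp: vH_in vchar_vH)
  thus ?thesis using hw by (simp add: vadd_vfrac_vtrunc)
qed

lemma vH_vnbhd_0: "h \<in> vH p \<Longrightarrow> h \<in> vnbhd p 0 \<longleftrightarrow> h = (\<lambda>_. 0)"
  by (auto simp: vH_def vnbhd_def fun_eq_iff) (metis linorder_not_le)

lemma integral_vnbhd_vchar_vH:
  assumes "h \<in> vH p"
  shows "(\<integral>w. indicator (vnbhd p 0) w * vchar p h w \<partial>L) = (if h = (\<lambda>_. 0) then 1 else 0)"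
  using integral_vnbhd_vchar[OF vH_in[OF assms], of 0] p_gr_0 by (simp add: vH_vnbhd_0[OF assms])

text \<open>The character of an element of H depends on w only through \<open>vfrac\<close>, so the
  integral over the tile equals the one over U, where orthogonality is known.\<close>

lemma tile_vchar:
  assumes T: "AE w in L. veta p \<Omega> w = 1" and h: "h \<in> vH p"
  shows "(\<integral>w. indicator \<Omega> w * vchar p h w \<partial>L) = (if h = (\<lambda>_. 0) then 1 else 0)"
proof -
  have "(\<integral>w. indicator \<Omega> w * vchar p h w \<partial>L) = (\<integral>w. indicator \<Omega> w *\<^sub>R vchar p h (vfrac w) \<partial>L)"
    by (intro Bochner_Integration.integral_cong) (use h in \<open>auto simp: vchar_vfrac indicator_def\<close>)
  also have "\<dots> = (\<integral>w. indicator (vnbhd p 0) w *\<^sub>R vchar p h w \<partial>L)"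
    by (rule tile_integral[OF T measurable_vchar[OF vH_in[OF h]]])
  also have "\<dots> = (\<integral>w. indicator (vnbhd p 0) w * vchar p h w \<partial>L)"
    by (intro Bochner_Integration.integral_cong) (auto simp: indicator_def)
  finally show ?thesis by (simp add: integral_vnbhd_vchar_vH[OF h])
qed

text \<open>The value does not depend on \<open>\<Omega>\<close>, because the indicator of a coset is a trigonometric polynomial.\<close>

lemma measure_vfrac_coset:
  assumes ch: "\<And>h. h \<in> vH p \<Longrightarrow> (\<integral>w. indicator \<Omega> w * vchar p h w \<partial>L) = (if h = (\<lambda>_. 0) then 1 else 0)"
    and x: "x \<in> G"
  shows "measure L (\<Omega> \<inter> vfrac -` vcoset p x (int n)) = (if x \<in> vnbhd p 0 then 1 / real (card (vH_trunc_set n)) else 0)"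
proof (cases "x \<in> vnbhd p 0")
  case True
  let ?c = "of_nat (card (vH_trunc_set n)) :: complex"
  have c0: "?c \<noteq> 0" using vH_trunc_set_zero finite_vH_trunc_set[of n] by (auto simp: card_eq_0_iff)
  have H: "h \<in> G" "h \<in> vH p" if "h \<in> vH_trunc_set n" for h using that by (auto simp: vH_trunc_set_def vH_def)
  have int: "integrable L (\<lambda>w. indicator \<Omega> w * vchar p h w)" if "h \<in> G" for h
    using integrable_vchar[OF that ind_\<Omega>_integrable] .
  have "?c * of_real (measure L (\<Omega> \<inter> vfrac -` vcoset p x (int n))) = (\<integral>w. ?c * complex_of_real (indicator (\<Omega> \<inter> vfrac -` vcoset p x (int n)) w) \<partial>L)"
  proof -
    have "\<Omega> \<inter> vfrac -` vcoset p x (int n) \<subseteq> space L" using sets.sets_into_space[OF \<Omega>(1)] by auto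
    thus ?thesis by (simp add: Int_absorb2 integral_complex_of_real)
  qed
  also have "\<dots> = (\<integral>w. (\<Sum>h\<in>vH_trunc_set n. cnj (vchar p h x) * (indicator \<Omega> w * vchar p h w)) \<partial>L)"
  proof (rule Bochner_Integration.integral_cong)
    fix w assume "w \<in> space L"
    hence w: "w \<in> G" by simp
    have iff: "vfrac w \<in> vcoset p x (int n) \<longleftrightarrow> (\<forall>j\<in>{1..int n}. vsub p w x j = 0)"
      by (rule vfrac_mem_vcoset_iff[OF True w])
    have "(\<Sum>h\<in>vH_trunc_set n. cnj (vchar p h x) * (indicator \<Omega> w * vchar p h w)) = indicator \<Omega> w * (\<Sum>h\<in>vH_trunc_set n. vchar p h (vsub p w x))"
      unfolding sum_distrib_left by (intro sum.cong) (use H w x in \<open>auto simp: vchar_vsub_right mult_ac\<close>)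
    thus "?c * complex_of_real (indicator (\<Omega> \<inter> vfrac -` vcoset p x (int n)) w) = (\<Sum>h\<in>vH_trunc_set n. cnj (vchar p h x) * (indicator \<Omega> w * vchar p h w))"
      using iff w x by (simp add: sum_vchar vsub_in p_gr_0 indicator_def)
  qed simp
  also have "\<dots> = (\<Sum>h\<in>vH_trunc_set n. cnj (vchar p h x) * (\<integral>w. indicator \<Omega> w * vchar p h w \<partial>L))"
    using int H by (subst Bochner_Integration.integral_sum) auto
  also have "\<dots> = (\<Sum>h\<in>vH_trunc_set n. if h = (\<lambda>_. 0) then 1 else 0)"
    using H by (intro sum.cong) (auto simp: ch)
  also have "\<dots> = 1" using vH_trunc_set_zero finite_vH_trunc_set by simp
  finally have "complex_of_real (measure L (\<Omega> \<inter> vfrac -` vcoset p x (int n))) = of_real (1 / real (card (vH_trunc_set n)))"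
    using c0 by (simp add: field_simps)
  thus ?thesis using True by (simp only: of_real_eq_iff if_True)
next
  case False
  hence "\<Omega> \<inter> vfrac -` vcoset p x (int n) = {}"
    using x by (auto simp: vcoset_def vnbhd_def vfrac_def)
  thus ?thesis using False by simp
qed

end

lemma veta_periodic:
  assumes "k \<in> vH p" "w \<in> G"
  shows "veta p S (vadd p k w) = veta p S w"
proof -
  have b: "bij_betw (vadd p k) (vH p) (vH p)"
    by (rule bij_betw_byWitness[where f' = "vadd p (vneg p k)"])
      (use assms p_gr_0 in \<open>auto simp: vadd_vneg_cancel vH_in vH_vadd vH_vneg\<close>)
  have "veta p S w = (\<integral>\<^sup>+h. indicator S (vadd p w (vadd p k h)) \<partial>count_space (vH p))"
    unfolding veta_eq by (rule nn_integral_bij_count_space[OF b, symmetric])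
  also have "\<dots> = veta p S (vadd p k w)"
    unfolding veta_eq by (simp add: vadd_assoc[symmetric] vadd_comm[of p w k])
  finally show ?thesis by simp
qed

text \<open>Countably many translates of U cover the group, so the exceptional set is contained in a
  countable union of null sets.\<close>

lemma AE_periodic:
  assumes AEU: "AE w in L. w \<in> vnbhd p 0 \<longrightarrow> P w"
    and per: "\<And>h w. h \<in> vH p \<Longrightarrow> w \<in> G \<Longrightarrow> P (vadd p h w) = P w"
  shows "AE w in L. P w"
proof -
  have "AE w in L. \<forall>h\<in>vH p. vadd p h w \<in> vnbhd p 0 \<longrightarrow> P (vadd p h w)"
    using AE_vadd[OF vH_in AEU] by (simp add: AE_ball_countable countable_vH)
  thus ?thesis using AE_space
  proof eventually_elim
    case (elim w)
    hence w: "w \<in> G" by simp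
    let ?h = "vneg p (vtrunc 0 w)"
    have h: "?h \<in> vH p" using w p_gr_0 by (simp add: vH_vneg vH_trunc)
    have eq: "vadd p ?h w = vfrac w"
      using w vadd_vneg_cancel(2)[of "vfrac w" p "vtrunc 0 w"] vadd_vfrac_vtrunc[of w p] vnbhd_in[OF vfrac_in[OF p_gr_0]]
      by (simp add: vadd_comm)
    have "P (vadd p ?h w)"
      using bspec[OF elim(1) h] vfrac_in[OF p_gr_0 w] unfolding eq by blast
    thus ?case using per[OF h w] by simp
  qed
qed

text \<open>Uniqueness of Fourier coefficients. By \<open>measure_vfrac_coset\<close>, applied both
  to \<Omega> and to U, the two image measures under \<open>vfrac\<close> agree on all cosets of
  nonnegative depth, hence on Borel sets. One has density \<eta> on U and the other density 1;
  periodicity does the rest.\<close>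

lemma vchar_imp_tile:
  assumes \<Omega>: "\<Omega> \<in> sets L" "emeasure L \<Omega> < \<infinity>"
    and ch: "\<And>h. h \<in> vH p \<Longrightarrow> (\<integral>w. indicator \<Omega> w * vchar p h w \<partial>L) = (if h = (\<lambda>_. 0) then 1 else 0)"
  shows "AE w in L. veta p \<Omega> w = 1"
proof -
  let ?U = "vnbhd p 0"
  define \<nu> where "\<nu> A = distr (density L (indicator A)) (vborel p) vfrac" for A
  have vf: "vfrac \<in> measurable L (vborel p)"
  proof -
    have "vfrac \<in> measurable (vborel p) (vborel p)"
    proof (rule coset_continuous_measurable[OF p_gr_0])
      show "vfrac \<in> G \<rightarrow> G" using vfrac_in[OF p_gr_0] vnbhd_in by auto
      fix x l assume "x \<in> G"
      have "vfrac ` vcoset p x l \<subseteq> vcoset p (vfrac x) l"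
        using vfrac_in[OF p_gr_0] by (auto simp: vcoset_def vnbhd_def) (auto simp: vfrac_def)
      thus "\<exists>m. vfrac ` vcoset p x m \<subseteq> vcoset p (vfrac x) l" by blast
    qed
    thus ?thesis by (rule borel_measurable_L)
  qed
  have \<nu>: "emeasure (\<nu> A) E = emeasure L (A \<inter> vfrac -` E)" if A: "A \<in> sets L" and E: "E \<in> sets (vborel p)" for A E
  proof -
    have "A \<inter> (vfrac -` E \<inter> space L) = A \<inter> vfrac -` E" using sets.sets_into_space[OF A] by auto
    thus ?thesis unfolding \<nu>_def using A E vf measurable_sets[OF vf E]
      by (subst emeasure_distr) (auto simp: emeasure_restricted)
  qed
  have U: "?U \<in> sets L" "emeasure L ?U < \<infinity>" by (auto simp: emeasure_vnbhd)
  have fin: "emeasure L (A \<inter> B) = ennreal (measure L (A \<inter> B))" if "A \<in> sets L" "emeasure L A < \<infinity>" for A B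
  proof -
    have "emeasure L (A \<inter> B) \<le> emeasure L A" using that by (intro emeasure_mono) auto
    thus ?thesis using that by (intro emeasure_eq_ennreal_measure) (auto simp: top_unique)
  qed
  have \<nu>eq: "\<nu> \<Omega> = \<nu> ?U"
  proof (rule vborel_eqI[OF p_gr_0])
    fix x and l :: int assume x: "x \<in> G" "l \<ge> 0"
    have "measure L (A \<inter> vfrac -` vcoset p x (int (nat l))) = (if x \<in> ?U then 1 / real (card (vH_trunc_set (nat l))) else 0)"
      if "A = \<Omega> \<or> A = ?U" for A
      using measure_vfrac_coset[OF \<Omega> _ x(1)] measure_vfrac_coset[OF U _ x(1)] ch integral_vnbhd_vchar_vH[OF U] that by blast
    hence "measure L (\<Omega> \<inter> vfrac -` vcoset p x (int (nat l))) = measure L (?U \<inter> vfrac -` vcoset p x (int (nat l)))"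
      by presburger
    thus "emeasure (\<nu> \<Omega>) (vcoset p x l) = emeasure (\<nu> ?U) (vcoset p x l)"
      using x \<Omega> U by (simp add: \<nu> coset_meas p_gr_0 fin)
  next
    fix x assume "x \<in> G"
    thus "emeasure (\<nu> \<Omega>) (vcoset p x 0) \<noteq> \<infinity>" using \<Omega> by (simp add: \<nu> coset_meas p_gr_0 fin)
  qed (simp_all add: \<nu>_def)
  have "density L (\<lambda>w. veta p \<Omega> w * indicator ?U w) = density L (indicator ?U)"
  proof (rule measure_eqI)
    fix E assume "E \<in> sets (density L (\<lambda>w. veta p \<Omega> w * indicator ?U w))"
    hence E: "E \<in> sets L" by simp
    let ?m = "main_part haar E"
    have m: "?m \<in> sets (vborel p)" and ae0: "AE x in haar. x \<in> ?m \<longleftrightarrow> x \<in> E"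
      using E AE_in_main_part[of E haar] by (auto simp: L_def sets_haar[symmetric])
    have ae: "AE x in L. x \<in> ?m \<longleftrightarrow> x \<in> E" unfolding L_def by (rule AE_completion[OF ae0])
    have "emeasure (density L (\<lambda>w. veta p \<Omega> w * indicator ?U w)) E = (\<integral>\<^sup>+w. veta p \<Omega> w * indicator ?U w * indicator E w \<partial>L)"
      using E measurable_veta[OF \<Omega>] by (simp add: emeasure_density)
    also have "\<dots> = (\<integral>\<^sup>+w. veta p \<Omega> w * indicator ?U w * indicator ?m w \<partial>L)"
      by (rule nn_integral_cong_AE, use ae in eventually_elim) (auto simp: indicator_def)
    also have "\<dots> = emeasure (\<nu> ?U) ?m"
      unfolding emeasure_veta[OF \<Omega> borel_sets_L[OF m], symmetric] using \<nu>[OF \<Omega>(1) m] \<nu>eq by simp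
    also have "\<dots> = emeasure L (?U \<inter> vfrac -` ?m)" by (rule \<nu>[OF U(1) m])
    also have "?U \<inter> vfrac -` ?m = ?U \<inter> ?m" by (auto simp: vfrac_vnbhd)
    also have "emeasure L (?U \<inter> ?m) = (\<integral>\<^sup>+w. indicator ?U w * indicator ?m w \<partial>L)"
      using U borel_sets_L[OF m] by (simp add: indicator_inter_arith[symmetric])
    also have "\<dots> = (\<integral>\<^sup>+w. indicator ?U w * indicator E w \<partial>L)"
      by (rule nn_integral_cong_AE, use ae in eventually_elim) (auto simp: indicator_def)
    also have "\<dots> = emeasure (density L (indicator ?U)) E" using E by (simp add: emeasure_density)
    finally show "emeasure (density L (\<lambda>w. veta p \<Omega> w * indicator ?U w)) E = emeasure (density L (indicator ?U)) E" .
  qed simp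
  hence "AE w in L. veta p \<Omega> w * indicator ?U w = indicator ?U w"
    using measurable_veta[OF \<Omega>] U by (intro density_unique) auto
  hence AEU: "AE w in L. w \<in> ?U \<longrightarrow> veta p \<Omega> w = 1"
    by eventually_elim (auto simp: indicator_def)
  thus ?thesis by (rule AE_periodic) (simp add: veta_periodic)
qed

section \<open>Wavelet systems and the two tilings\<close>

lemma veta_eq_1_unique:
  assumes "veta p \<Omega> w = 1" "h \<in> vH p" "k \<in> vH p" "vadd p w h \<in> \<Omega>" "vadd p w k \<in> \<Omega>"
  shows "h = k"
proof (rule ccontr)
  assume "h \<noteq> k"
  hence "(2 :: ennreal) = (\<integral>\<^sup>+x. indicator {h, k} x \<partial>count_space (vH p))"
    using assms by (subst nn_integral_indicator) (auto simp: emeasure_count_space_finite)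
  also have "\<dots> \<le> veta p \<Omega> w"
    unfolding veta_eq using assms by (intro nn_integral_mono) (auto simp: indicator_def)
  finally show False using assms(1) by simp
qed

lemma vsub_eq_zero_iff: "h \<in> G \<Longrightarrow> k \<in> G \<Longrightarrow> vsub p k h = (\<lambda>_. 0) \<longleftrightarrow> h = k"
  using vsub_nth_eq_0_iff[of k h] by (auto simp: fun_eq_iff)

lemma vH_vsub: "h \<in> vH p \<Longrightarrow> k \<in> vH p \<Longrightarrow> vsub p k h \<in> vH p"
  unfolding vsub_eq_vadd_vneg by (intro vH_vadd vH_vneg p_gr_0)

context
  fixes \<Omega> :: "(int \<Rightarrow> int) set"
  assumes \<Omega>: "\<Omega> \<in> sets L" "emeasure L \<Omega> < \<infinity>"
begin

text \<open>Orthonormality at scale 0 gives the translation tiling, orthogonality between scales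
  gives disjoint dilates, and density gives covering.\<close>

lemma wsys_onb_imp:
  assumes onb: "L2_orthonormal_basis L (UNIV \<times> vH p) (wsys \<Omega>)"
  shows "AE w in L. veta p \<Omega> w = 1"
    and "j \<noteq> 0 \<Longrightarrow> AE w in L. \<not> (w \<in> \<Omega> \<and> vshift (- j) w \<in> \<Omega>)"
    and "AE w in L. \<exists>j. vshift (- j) w \<in> \<Omega>"
proof -
  have orth: "L2inner L (wfam \<Omega> i) (wfam \<Omega> k) = (if i = k then 1 else 0)" if "i \<in> UNIV \<times> vH p" "k \<in> UNIV \<times> vH p" for i k
  proof -
    have "L2inner L (wsys \<Omega> i) (wsys \<Omega> k) = (if i = k then 1 else 0)"
      using onb that unfolding L2_orthonormal_basis_iff by blast
    moreover have "snd i \<in> G" "snd k \<in> G" using that by (auto simp: vH_in)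
    ultimately show ?thesis using L2inner_wsys[OF \<Omega>, of i k] by simp
  qed
  have z: "(\<lambda>_. 0) \<in> vH p" by (rule vH_zero[OF p_gr_0])
  show "AE w in L. veta p \<Omega> w = 1"
  proof (rule vchar_imp_tile[OF \<Omega>])
    fix h assume h: "h \<in> vH p"
    have "vsub p h (\<lambda>_. 0) = h" using h by (auto simp: vsub_def vil_mod vH_in)
    thus "(\<integral>w. indicator \<Omega> w * vchar p h w \<partial>L) = (if h = (\<lambda>_. 0) then 1 else 0)"
      using L2inner_wfam_same[OF \<Omega> vH_in[OF z] vH_in[OF h], of 0] orth[of "(0, \<lambda>_. 0)" "(0, h)"] h z by auto
  qed
  show "AE w in L. \<not> (w \<in> \<Omega> \<and> vshift (- j) w \<in> \<Omega>)" if j: "j \<noteq> 0"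
  proof -
    let ?A = "\<Omega> \<inter> (vshift (- j) -` \<Omega> \<inter> space L)"
    have A: "?A \<in> sets L" using \<Omega>(1) measurable_sets[OF measurable_vshift \<Omega>(1)] by (rule sets.Int)
    \<comment> \<open>With h = 0 the characters are 1, so the inner product between the scales 0 and
      j is a positive multiple of the measure of the overlap of \<Omega> with its dilate.\<close>
    have "0 = L2inner L (wfam \<Omega> (0, \<lambda>_. 0)) (wfam \<Omega> (j, \<lambda>_. 0))" using orth z j by simp
    also have "\<dots> = (\<integral>w. of_real (real p powr (- of_int j / 2)) * complex_of_real (indicator ?A w) \<partial>L)"
      unfolding L2inner_def using p_gr_0
      by (intro Bochner_Integration.integral_cong) (auto simp: wfam_def wfreq_def indicator_def)
    also have "\<dots> = of_real (real p powr (- of_int j / 2)) * complex_of_real (measure L ?A)"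
    proof -
      have "?A \<subseteq> space L" by auto
      thus ?thesis by (simp add: Int_absorb2 integral_complex_of_real)
    qed
    finally have "measure L ?A = 0" using p_gr_0 by simp
    moreover have "emeasure L ?A \<le> emeasure L \<Omega>" by (rule emeasure_mono) (use \<Omega> in auto)
    hence "emeasure L ?A < \<infinity>" using \<Omega>(2) by (rule le_less_trans)
    ultimately have "?A \<in> null_sets L" using A by (auto simp: measure_def enn2real_eq_0_iff)
    from AE_not_in[OF this] AE_space show ?thesis
      by eventually_elim auto
  qed
  show "AE w in L. \<exists>j. vshift (- j) w \<in> \<Omega>"
  proof -
    \<comment> \<open>The set missed by all dilates. It may have infinite measure, so it is cut down
      by U_{-n} to make its indicator integrable before transforming.\<close>
    let ?N = "{w \<in> G. \<forall>j. vshift (- j) w \<notin> \<Omega>}"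
    have eq: "?N = space L - (\<Union>j. vshift (- j) -` \<Omega> \<inter> space L)" by auto
    have "(\<Union>j. vshift (- j) -` \<Omega> \<inter> space L) \<in> sets L"
      by (rule sets.countable_UN', rule countableI_type, rule image_subsetI, rule measurable_sets[OF measurable_vshift \<Omega>(1)])
    hence N: "?N \<in> sets L" unfolding eq by (rule sets.compl_sets)
    have "?N \<inter> vnbhd p (- int n) \<in> null_sets L" for n
    proof -
      let ?E = "?N \<inter> vnbhd p (- int n)"
      have E: "?E \<in> sets L" using N vnbhd_sets by (rule sets.Int)
      have "emeasure L ?E \<le> emeasure L (vnbhd p (- int n))" by (rule emeasure_mono) auto
      hence fin: "emeasure L ?E < \<infinity>" using vnbhd_finite by (rule le_less_trans)
      have f: "indicator ?E \<in> L2fun L" "integrable L (indicator ?E :: _ \<Rightarrow> complex)"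
        using ind_\<Omega>_L2[OF E fin] ind_\<Omega>_integrable[OF E fin] by auto
      have "L2norm L (indicator ?E) < \<epsilon>" if \<epsilon>: "\<epsilon> > 0" for \<epsilon>
      proof -
        have "inv_fourier p (indicator ?E) \<in> L2_closed_span L (UNIV \<times> vH p) (wsys \<Omega>)"
          using onb inv_fourier_isometry(1)[OF f] unfolding L2_orthonormal_basis_iff by blast
        then obtain F c where F: "finite F" "F \<subseteq> UNIV \<times> vH p"
          and less: "L2norm L (\<lambda>x. inv_fourier p (indicator ?E) x - (\<Sum>i\<in>F. c i * wsys \<Omega> i x)) < \<epsilon>"
          using \<epsilon> unfolding L2_closed_span_def by blast
        have FG: "snd i \<in> G" if "i \<in> F" for i using F(2) that by (auto simp: vH_in)
        let ?s = "\<lambda>x. \<Sum>i\<in>F. c i * wfam \<Omega> i x"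
        have s: "?s \<in> L2fun L" by (intro L2fun_lincomb wfam_L2 \<Omega> FG)
        \<comment> \<open>All dilates of \<Omega> miss \<open>?E\<close>, so \<open>?s\<close>
          vanishes there, and the approximation error is at least the norm of the indicator
          itself.\<close>
        have "L2sq L (indicator ?E) \<le> L2sq L (\<lambda>x. indicator ?E x - ?s x)"
          unfolding L2sq_def
        proof (rule integral_mono)
          fix w assume "w \<in> space L"
          show "(cmod (indicator ?E w))\<^sup>2 \<le> (cmod (indicator ?E w - ?s w))\<^sup>2"
          proof (cases "w \<in> ?E")
            case True
            hence "?s w = 0" by (intro sum.neutral) (auto simp: wfam_def wfreq_def)
            thus ?thesis by simp
          qed simp
        qed (intro L2fun_int L2fun_diff f s)+
        hence "L2norm L (indicator ?E) \<le> L2norm L (\<lambda>x. indicator ?E x - ?s x)" by (simp add: L2norm_eq)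
        thus ?thesis using less L2norm_wsys_lincomb[OF \<Omega> f F(1) FG, of c] by simp
      qed
      hence "L2norm L (indicator ?E) \<le> 0" by (meson dense_ge le_less_linear less_le_not_le not_le)
      hence "measure L ?E \<le> 0" using E by (simp add: L2norm_eq L2sq_indicator)
      hence "measure L ?E = 0" using measure_nonneg[of L ?E] by linarith
      thus ?thesis using E fin by (auto simp: measure_def enn2real_eq_0_iff)
    qed
    hence "(\<Union>n. ?N \<inter> vnbhd p (- int n)) \<in> null_sets L" by (rule null_sets_UN)
    from AE_not_in[OF this] AE_space show ?thesis
    proof eventually_elim
      case (elim w)
      then obtain n where "w \<in> vnbhd p (- int n)"
        using vnbhd_exhausts[of w] by (auto simp: eventually_sequentially)
      thus ?case using elim by auto
    qed
  qed
qed

context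
  assumes T: "AE w in L. veta p \<Omega> w = 1"
    and D: "\<And>j. j \<noteq> 0 \<Longrightarrow> AE w in L. \<not> (w \<in> \<Omega> \<and> vshift (- j) w \<in> \<Omega>)"
    and C: "AE w in L. \<exists>j. vshift (- j) w \<in> \<Omega>"
begin

text \<open>Dilation preserves null sets, which reduces any pair of scales to the scales 0 and j -
  i.\<close>

lemma dilates_disjoint:
  assumes "i \<noteq> j" shows "AE w in L. \<not> (vshift (- i) w \<in> \<Omega> \<and> vshift (- j) w \<in> \<Omega>)"
proof -
  have "AE w in L. \<not> (vshift (- i) w \<in> \<Omega> \<and> vshift (- (j - i)) (vshift (- i) w) \<in> \<Omega>)"
    by (rule AE_vshift[OF D]) (use assms in simp)
  thus ?thesis by (simp add: vshift_vshift)
qed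

lemma wfam_orthonormal:
  assumes "i \<in> UNIV \<times> vH p" "k \<in> UNIV \<times> vH p"
  shows "L2inner L (wfam \<Omega> i) (wfam \<Omega> k) = (if i = k then 1 else 0)"
proof (cases "fst i = fst k")
  case True
  obtain j h where i: "i = (j, h)" "h \<in> vH p" using assms(1) by auto
  obtain h' where k: "k = (j, h')" "h' \<in> vH p" using assms(2) True i by auto
  have "L2inner L (wfam \<Omega> i) (wfam \<Omega> k) = (if vsub p h' h = (\<lambda>_. 0) then 1 else 0)"
    unfolding i(1) k(1) using i k tile_vchar[OF \<Omega> T vH_vsub[OF i(2) k(2)]]
    by (simp add: L2inner_wfam_same[OF \<Omega>] vH_in)
  thus ?thesis using i k by (simp add: vsub_eq_zero_iff vH_in)
next
  case False
  have "AE w in L. wfam \<Omega> i w * cnj (wfam \<Omega> k w) = 0"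
    using dilates_disjoint[OF False] by eventually_elim (auto simp: wfam_def wfreq_def indicator_def)
  hence "L2inner L (wfam \<Omega> i) (wfam \<Omega> k) = 0"
    unfolding L2inner_def by (rule integral_eq_zero_AE)
  thus ?thesis using False by auto
qed

text \<open>By \<open>tile_integral\<close> the error on \<Omega> of an approximation by functions
  of \<open>vfrac w\<close> is its error on U. There 1_E is approximated by coset indicators, each
  of which is a trigonometric polynomial with frequencies in H.\<close>

lemma tile_approx_periodic:
  assumes E: "E \<in> sets L" "E \<subseteq> vnbhd p 0"
  shows "(\<lambda>w. indicator \<Omega> w * indicator E (vfrac w)) \<in> L2_closed_span L (vH p) (wfreq \<Omega>)"
proof -
  let ?W = "L2_closed_span L (vH p) (wfreq \<Omega>)"
  have W: "wfreq \<Omega> h \<in> L2fun L" if "h \<in> vH p" for h by (rule wfreq_L2[OF \<Omega> vH_in[OF that]])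
  have base: "wfreq \<Omega> h \<in> ?W" if "h \<in> vH p" for h
    by (rule L2_closed_span_base[OF W that])
  have fm: "(\<lambda>w. indicator \<Omega> w * k (vfrac w)) \<in> borel_measurable L" if "k \<in> borel_measurable L" for k :: "_ \<Rightarrow> complex"
    using \<Omega>(1) measurable_compose[OF measurable_vfrac that] by simp
  have pw: "(\<lambda>w. indicator \<Omega> w * coset_ind c (vfrac w)) \<in> ?W" if c: "fst c \<in> vnbhd p 0" "snd c \<ge> 0" for c
  proof -
    obtain x n where xn: "c = (x, int n)" using c(2) by (metis nonneg_int_cases prod.collapse)
    have x: "x \<in> vnbhd p 0" "x \<in> G" using c xn vnbhd_in by auto
    let ?c = "of_nat (card (vH_trunc_set n)) :: complex"
    have c0: "?c \<noteq> 0" using vH_trunc_set_zero finite_vH_trunc_set[of n] by (auto simp: card_eq_0_iff)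
    have H: "h \<in> G" "h \<in> vH p" if "h \<in> vH_trunc_set n" for h using that by (auto simp: vH_trunc_set_def vH_def)
    \<comment> \<open>\<open>wfreq\<close> carries a conjugate character; inverting h undoes the
      conjugation. The factor 1 / \<open>?c\<close> turns the character sum, which is 0 or
      \<open>?c\<close>, into an indicator.\<close>
    let ?g = "\<lambda>w. \<Sum>h\<in>vH_trunc_set n. (1 / ?c * cnj (vchar p h x)) * wfreq \<Omega> (vneg p h) w"
    have gW: "?g \<in> ?W"
      by (intro L2_closed_span_sum L2_closed_span_cmult base W) (auto intro: vH_vneg p_gr_0 H)
    show ?thesis
    proof (rule L2_closed_span_cong_AE[OF W gW])
      show "AE w in L. ?g w = indicator \<Omega> w * coset_ind c (vfrac w)"
      proof (rule AE_I2)
        fix w assume "w \<in> space L"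
        hence w: "w \<in> G" by simp
        have iff: "vfrac w \<in> vcoset p x (int n) \<longleftrightarrow> (\<forall>j\<in>{1..int n}. vsub p w x j = 0)"
          by (rule vfrac_mem_vcoset_iff[OF x(1) w])
        have "?g w = (\<Sum>h\<in>vH_trunc_set n. (1 / ?c * indicator \<Omega> w) * vchar p h (vsub p w x))"
          by (intro sum.cong) (use H w x in \<open>auto simp: wfreq_def vchar_vsub_right vchar_vneg_left mult_ac\<close>)
        also have "\<dots> = (1 / ?c * indicator \<Omega> w) * (if vfrac w \<in> vcoset p x (int n) then ?c else 0)"
          unfolding sum_distrib_left[symmetric] iff using w x by (simp add: sum_vchar vsub_in p_gr_0)
        also have "\<dots> = indicator \<Omega> w * coset_ind c (vfrac w)"
          using c0 by (simp add: xn coset_ind_def indicator_def)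
        finally show "?g w = indicator \<Omega> w * coset_ind c (vfrac w)" .
      qed
      show "(\<lambda>w. indicator \<Omega> w * coset_ind c (vfrac w)) \<in> borel_measurable L"
        by (rule fm) (use x xn in \<open>auto simp: coset_ind_def\<close>)
    qed
  qed
  have fin: "emeasure L E < \<infinity>"
    using emeasure_mono[OF E(2) vnbhd_sets] vnbhd_finite[of 0] by (rule le_less_trans)
  have ind: "indicator E \<in> L2fun L" by (rule L2fun_indicator[OF E(1) fin])
  let ?I = "{c. fst c \<in> vnbhd p 0 \<and> snd c \<ge> 0}"
  have span: "indicator E \<in> L2_closed_span L ?I coset_ind"
    by (rule coset_span_vnbhd[OF ind]) (use E(2) in \<open>auto simp: indicator_def\<close>)
  show ?thesis
  proof (rule L2_closed_span_limit[OF W])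
    show "(\<lambda>w. indicator \<Omega> w * indicator E (vfrac w)) \<in> L2fun L"
      by (rule L2fun_bound[OF ind_\<Omega>_L2[OF \<Omega>], where c = 1]) (use fm[of "indicator E"] E in \<open>auto simp: indicator_def\<close>)
    fix \<epsilon> :: real assume "\<epsilon> > 0"
    then obtain F a where F: "finite F" "F \<subseteq> ?I"
      and less: "L2norm L (\<lambda>x. indicator E x - (\<Sum>c\<in>F. a c * coset_ind c x)) < \<epsilon>"
      using span unfolding L2_closed_span_def by blast
    let ?t = "\<lambda>x. \<Sum>c\<in>F. a c * coset_ind c x"
    let ?g = "\<lambda>w. \<Sum>c\<in>F. a c * (indicator \<Omega> w * coset_ind c (vfrac w))"
    have t: "?t \<in> L2fun L" by (intro L2fun_lincomb coset_ind_L2) (use F(2) vnbhd_in in auto)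
    let ?d = "\<lambda>x. indicator E x - ?t x"
    have d: "?d \<in> L2fun L" by (rule L2fun_diff[OF ind t])
    have "L2sq L (\<lambda>w. indicator \<Omega> w * indicator E (vfrac w) - ?g w) = (\<integral>w. indicator \<Omega> w *\<^sub>R (cmod (?d (vfrac w)))\<^sup>2 \<partial>L)"
      unfolding L2sq_def
    proof (rule Bochner_Integration.integral_cong)
      fix w
      have "indicator \<Omega> w * indicator E (vfrac w) - ?g w = indicator \<Omega> w * ?d (vfrac w)"
        by (simp add: right_diff_distrib sum_distrib_left mult_ac)
      thus "(cmod (indicator \<Omega> w * indicator E (vfrac w) - ?g w))\<^sup>2 = indicator \<Omega> w *\<^sub>R (cmod (?d (vfrac w)))\<^sup>2"
        by (simp add: norm_mult indicator_def)
    qed simp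
    also have "\<dots> = (\<integral>w. indicator (vnbhd p 0) w *\<^sub>R (cmod (?d w))\<^sup>2 \<partial>L)"
      by (rule tile_integral[OF \<Omega> T]) (use L2fun_meas[OF d] in simp)
    also have "\<dots> \<le> L2sq L ?d"
      unfolding L2sq_def
      by (rule integral_mono[OF integrable_mult_indicator[OF vnbhd_sets L2fun_int[OF d]] L2fun_int[OF d]])
        (simp add: indicator_def)
    finally have "L2norm L (\<lambda>w. indicator \<Omega> w * indicator E (vfrac w) - ?g w) \<le> L2norm L ?d"
      by (simp add: L2norm_eq)
    hence "L2norm L (\<lambda>w. indicator \<Omega> w * indicator E (vfrac w) - ?g w) < \<epsilon>" using less by simp
    moreover have "?g \<in> ?W"
      by (intro L2_closed_span_sum L2_closed_span_cmult W pw) (use F(2) in auto)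
    ultimately show "\<exists>g\<in>?W. L2norm L (\<lambda>w. indicator \<Omega> w * indicator E (vfrac w) - g w) < \<epsilon>"
      by (rule bexI)
  qed
qed

text \<open>Almost every class modulo H meets \<Omega> in one point, so any subset E of \<Omega> is
  cut out of \<Omega> by a periodic set: the points congruent to a point of E.\<close>

lemma tile_approx:
  assumes E: "E \<in> sets L" "E \<subseteq> \<Omega>"
  shows "indicator E \<in> L2_closed_span L (vH p) (wfreq \<Omega>)"
proof -
  \<comment> \<open>E folded into U. A point of \<Omega> with fractional part in \<open>?E\<close>
    is congruent to a point of E, and uniqueness in the tile makes the two equal.\<close>
  let ?E = "(\<Union>h\<in>vH p. vadd p h -` E \<inter> space L) \<inter> vnbhd p 0"
  have W: "wfreq \<Omega> h \<in> L2fun L" if "h \<in> vH p" for h by (rule wfreq_L2[OF \<Omega> vH_in[OF that]])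
  have "(\<Union>h\<in>vH p. vadd p h -` E \<inter> space L) \<in> sets L"
    by (rule sets.countable_UN'[OF countable_vH], rule image_subsetI, rule measurable_sets[OF measurable_vadd E(1)], rule vH_in)
  hence E': "?E \<in> sets L" using vnbhd_sets by (rule sets.Int)
  have "AE w in L. indicator \<Omega> w * indicator ?E (vfrac w) = (indicator E w :: complex)"
    using T AE_space
  proof eventually_elim
    case (elim w)
    hence w: "w \<in> G" by simp
    have fr: "vfrac w \<in> vnbhd p 0" by (rule vfrac_in[OF p_gr_0 w])
    have tr: "vtrunc 0 w \<in> vH p" by (rule vH_trunc[OF p_gr_0 w])
    have eq: "vadd p (vfrac w) (vtrunc 0 w) = w" by (rule vadd_vfrac_vtrunc[OF w])
    have eta: "veta p \<Omega> (vfrac w) = 1"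
      using elim(1) veta_periodic[OF tr vnbhd_in[OF fr], of \<Omega>] eq by (simp add: vadd_comm)
    show ?case
    proof (cases "w \<in> E")
      case True
      hence "vfrac w \<in> ?E" using tr eq fr vnbhd_in[OF fr] by (auto simp: vadd_comm intro!: bexI[of _ "vtrunc 0 w"])
      thus ?thesis using True E by (auto simp: indicator_def)
    next
      case False
      have "\<not> (w \<in> \<Omega> \<and> vfrac w \<in> ?E)"
      proof
        assume a: "w \<in> \<Omega> \<and> vfrac w \<in> ?E"
        then obtain h where h: "h \<in> vH p" "vadd p (vfrac w) h \<in> E" by (auto simp: vadd_comm)
        have "h = vtrunc 0 w"
          by (rule veta_eq_1_unique[OF eta h(1) tr]) (use h(2) E(2) a eq in auto)
        thus False using h(2) eq False by simp
      qed
      thus ?thesis using False by (auto simp: indicator_def)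
    qed
  qed
  from L2_closed_span_cong_AE[OF W tile_approx_periodic[OF E'] _ this]
  show ?thesis using E(1) by auto
qed

text \<open>Dilation by B^j multiplies L^2 norms by p^{j/2}. The tolerance is divided by this factor
  in advance, and the coefficients are multiplied by it to undo the normalization of
  \<open>wfam\<close>.\<close>

lemma wfam_approx_dilate:
  assumes g: "g \<in> L2_closed_span L (vH p) (wfreq \<Omega>)"
  shows "(\<lambda>w. g (vshift (- j) w)) \<in> L2_closed_span L (UNIV \<times> vH p) (wfam \<Omega>)"
proof -
  have W: "wfreq \<Omega> h \<in> L2fun L" if "h \<in> vH p" for h by (rule wfreq_L2[OF \<Omega> vH_in[OF that]])
  have V: "wfam \<Omega> i \<in> L2fun L" if "i \<in> UNIV \<times> vH p" for i
    using that by (intro wfam_L2 \<Omega>) (auto simp: vH_in)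
  have gL: "g \<in> L2fun L" by (rule L2_closed_span_D[OF W g])
  show ?thesis
  proof (rule L2_closed_span_limit[OF V L2fun_vshift[OF gL]])
    fix \<epsilon> :: real assume \<epsilon>: "\<epsilon> > 0"
    let ?c = "real p powr (of_int j / 2)"
    have c: "?c > 0" using p_gr_0 by simp
    have "\<epsilon> / ?c > 0" using \<epsilon> c by simp
    then obtain F a where F: "finite F" "F \<subseteq> vH p"
      and less: "L2norm L (\<lambda>x. g x - (\<Sum>h\<in>F. a h * wfreq \<Omega> h x)) < \<epsilon> / ?c"
      using g unfolding L2_closed_span_def by blast
    let ?s = "\<lambda>w. \<Sum>h\<in>F. (a h * of_real ?c) * wfam \<Omega> (j, h) w"
    let ?d = "\<lambda>x. g x - (\<Sum>h\<in>F. a h * wfreq \<Omega> h x)"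
    have d: "?d \<in> L2fun L" by (intro L2fun_diff gL L2fun_lincomb W) (use F(2) in auto)
    have cc: "complex_of_real ?c * of_real (real p powr (- of_int j / 2)) = 1"
      using p_gr_0 by (simp add: of_real_mult[symmetric] powr_add[symmetric] del: of_real_mult)
    have s_eq: "?s w = (\<Sum>h\<in>F. a h * wfreq \<Omega> h (vshift (- j) w))" for w
    proof (rule sum.cong)
      fix h
      have "(a h * of_real ?c) * wfam \<Omega> (j, h) w = a h * (complex_of_real ?c * of_real (real p powr (- of_int j / 2))) * wfreq \<Omega> h (vshift (- j) w)"
        by (simp add: wfam_def)
      thus "(a h * of_real ?c) * wfam \<Omega> (j, h) w = a h * wfreq \<Omega> h (vshift (- j) w)" unfolding cc by simp
    qed simp
    have "L2sq L (\<lambda>w. g (vshift (- j) w) - ?s w) = real p powr j * L2sq L ?d"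
      unfolding s_eq using L2sq_vshift[OF L2fun_meas[OF d], of "- j"] by simp
    also have "real p powr j = ?c\<^sup>2" using p_gr_0 by (simp add: power2_eq_square powr_add[symmetric])
    finally have "L2norm L (\<lambda>w. g (vshift (- j) w) - ?s w) = ?c * L2norm L ?d"
      using c by (simp add: L2norm_eq real_sqrt_mult)
    also have "\<dots> < \<epsilon>" using less c by (simp add: pos_less_divide_eq mult.commute)
    finally have "L2norm L (\<lambda>w. g (vshift (- j) w) - ?s w) < \<epsilon>" .
    moreover have "?s \<in> L2_closed_span L (UNIV \<times> vH p) (wfam \<Omega>)"
      by (intro L2_closed_span_sum L2_closed_span_cmult V L2_closed_span_base) (use F(2) in auto)
    ultimately show "\<exists>s\<in>L2_closed_span L (UNIV \<times> vH p) (wfam \<Omega>). L2norm L (\<lambda>x. g (vshift (- j) x) - s x) < \<epsilon>"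
      by (rule bexI)
  qed
qed

text \<open>The part of E inside the dilate of \<Omega> by B^j is handled at scale j. Almost
  disjointness turns the sum over |j| \<le> n into the indicator of a union, and covering makes
  these unions exhaust E almost everywhere.\<close>

lemma wfam_complete: "L2fun L \<subseteq> L2_closed_span L (UNIV \<times> vH p) (wfam \<Omega>)"
proof
  let ?V = "L2_closed_span L (UNIV \<times> vH p) (wfam \<Omega>)"
  have V: "wfam \<Omega> i \<in> L2fun L" if "i \<in> UNIV \<times> vH p" for i
    using that by (intro wfam_L2 \<Omega>) (auto simp: vH_in)
  fix f assume f: "f \<in> L2fun L"
  show "f \<in> ?V"
  proof (rule L2_closed_span_indicators[OF V f])
    fix E assume E: "E \<in> sets L" "emeasure L E < \<infinity>"
    define B where "B j = vshift (- j) -` \<Omega> \<inter> space L" for j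
    have B: "B j \<in> sets L" for j unfolding B_def by (rule measurable_sets[OF measurable_vshift \<Omega>(1)])
    have EB: "indicator (E \<inter> B j) \<in> ?V" for j
    proof -
      have EG: "E \<subseteq> G" using sets.sets_into_space[OF E(1)] by simp
      let ?E = "\<Omega> \<inter> (vshift j -` E \<inter> space L)"
      have "?E \<in> sets L" using \<Omega>(1) measurable_sets[OF measurable_vshift E(1)] by (rule sets.Int)
      from wfam_approx_dilate[OF tile_approx[OF this], of j]
      have *: "(\<lambda>w. indicator ?E (vshift (- j) w) :: complex) \<in> ?V" by auto
      show ?thesis
      proof (rule L2_closed_span_cong_AE[OF V *])
        show "AE w in L. indicator ?E (vshift (- j) w) = (indicator (E \<inter> B j) w :: complex)"
          by (rule AE_I2) (auto simp: indicator_def B_def vshift_in)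
      qed (use E B in auto)
    qed
    have sum: "(\<lambda>w. \<Sum>j\<in>{- int n..int n}. indicator (E \<inter> B j) w) \<in> ?V" for n :: nat
      by (intro L2_closed_span_sum V EB)
    have "AE w in L. \<forall>i j. i \<noteq> j \<longrightarrow> \<not> (vshift (- i) w \<in> \<Omega> \<and> vshift (- j) w \<in> \<Omega>)"
      unfolding AE_all_countable using dilates_disjoint by auto
    hence disj: "AE w in L. \<forall>i j. w \<in> B i \<longrightarrow> w \<in> B j \<longrightarrow> i = j"
      by eventually_elim (auto simp: B_def)
    have sum_eq: "AE w in L. (\<Sum>j\<in>{- int n..int n}. indicator (E \<inter> B j) w) = (indicator (E \<inter> (\<Union>j\<in>{- int n..int n}. B j)) w :: complex)" for n :: nat
      using disj
    proof eventually_elim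
      case (elim w)
      show ?case
      proof (cases "w \<in> E \<inter> (\<Union>j\<in>{- int n..int n}. B j)")
        case True
        then obtain j where j: "j \<in> {- int n..int n}" "w \<in> B j" "w \<in> E" by blast
        have "(\<Sum>i\<in>{- int n..int n}. indicator (E \<inter> B i) w) = (\<Sum>i\<in>{- int n..int n}. if i = j then 1 else 0 :: complex)"
          by (intro sum.cong) (use elim j in \<open>auto simp: indicator_def\<close>)
        thus ?thesis using True j by simp
      next
        case False
        hence "(\<Sum>i\<in>{- int n..int n}. indicator (E \<inter> B i) w :: complex) = 0"
          by (intro sum.neutral) (auto simp: indicator_def)
        thus ?thesis using False by simp
      qed
    qed
    have part: "indicator (E \<inter> (\<Union>j\<in>{- int n..int n}. B j)) \<in> ?V" for n :: nat
      by (rule L2_closed_span_cong_AE[OF V sum _ sum_eq]) (use E B in auto)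
    have EL: "indicator E \<in> L2fun L" by (rule L2fun_indicator[OF E])
    show "indicator E \<in> ?V"
    proof (rule L2_closed_span_dominated[OF V part EL EL])
      show "AE w in L. (\<lambda>n. indicator (E \<inter> (\<Union>j\<in>{- int n..int n}. B j)) w :: complex) \<longlonglongrightarrow> indicator E w"
        using C AE_space
      proof eventually_elim
        case (elim w)
        then obtain j where j: "w \<in> B j" by (auto simp: B_def)
        have "eventually (\<lambda>n. indicator E w = (indicator (E \<inter> (\<Union>j\<in>{- int n..int n}. B j)) w :: complex)) sequentially"
        proof (rule eventually_sequentiallyI[of "nat \<bar>j\<bar>"])
          fix n assume "nat \<bar>j\<bar> \<le> n"
          hence "j \<in> {- int n..int n}" by auto
          thus "indicator E w = (indicator (E \<inter> (\<Union>j\<in>{- int n..int n}. B j)) w :: complex)"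
            using j by (auto simp: indicator_def)
        qed
        thus ?case by (rule Lim_transform_eventually[OF tendsto_const])
      qed
    qed (auto simp: indicator_def)
  qed
qed

text \<open>Coset indicators generate a dense subspace, and each is the image of an explicit
  integrable function: p^{-l} times the indicator of U_{-l} times a conjugate character.
  Approximating that preimage by \<open>wfam\<close> replaces surjectivity of the transform.\<close>

lemma wsys_onb: "L2_orthonormal_basis L (UNIV \<times> vH p) (wsys \<Omega>)"
  unfolding L2_orthonormal_basis_iff
proof (intro conjI ballI)
  fix i :: "int \<times> (int \<Rightarrow> int)" assume i: "i \<in> UNIV \<times> vH p"
  thus "wsys \<Omega> i \<in> L2fun L" by (intro wsys_L2 \<Omega>) (auto simp: vH_in)
  fix k :: "int \<times> (int \<Rightarrow> int)" assume k: "k \<in> UNIV \<times> vH p"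
  have "snd i \<in> G" "snd k \<in> G" using i k by (auto simp: vH_in)
  thus "L2inner L (wsys \<Omega> i) (wsys \<Omega> k) = (if i = k then 1 else 0)"
    using wfam_orthonormal[OF i k] by (simp add: L2inner_wsys[OF \<Omega>])
next
  show "L2fun L \<subseteq> L2_closed_span L (UNIV \<times> vH p) (wsys \<Omega>)"
  proof (rule L2_closed_span_dense)
    show "wsys \<Omega> i \<in> L2fun L" if "i \<in> UNIV \<times> vH p" for i
      using that by (intro wsys_L2 \<Omega>) (auto simp: vH_in)
    fix x and l :: int assume x: "x \<in> G"
    let ?c = "complex_of_real (real p powr (- l))"
    let ?A = "vnbhd p (- l)"
    let ?t = "\<lambda>w. ?c * wfreq ?A x w"
    have A: "?A \<in> sets L" "emeasure L ?A < \<infinity>" by (auto simp: emeasure_vnbhd)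
    have t: "?t \<in> L2fun L" "integrable L ?t"
      by (intro L2fun_cmult wfreq_L2 A x) (intro integrable_mult_right wfreq_integrable A x)
    have Ft: "inv_fourier p ?t y = indicator (vcoset p x l) y" if y: "y \<in> G" for y
    proof -
      have "inv_fourier p ?t y = (\<integral>w. ?c * (indicator ?A w * vchar p (vsub p y x) w) \<partial>L)"
        unfolding inv_fourier_def
        by (intro Bochner_Integration.integral_cong) (use x y in \<open>auto simp: wfreq_def vchar_vsub_left mult_ac\<close>)
      also have "\<dots> = ?c * (if vsub p y x \<in> vnbhd p l then of_real (real p powr l) else 0)"
        using integral_vnbhd_vchar[OF vsub_in[OF p_gr_0 y x], of "- l"] by simp
      also have "\<dots> = (if vsub p y x \<in> vnbhd p l then 1 else 0)"
        using p_gr_0 by (simp add: of_real_mult[symmetric] powr_add[symmetric] del: of_real_mult)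
      finally show ?thesis using x y by (simp add: vsub_mem_vnbhd_iff vcoset_def indicator_def)
    qed
    have ind: "indicator (vcoset p x l) \<in> L2fun L"
      by (rule L2fun_indicator) (use x in \<open>auto simp: emeasure_coset\<close>)
    show "indicator (vcoset p x l) \<in> L2_closed_span L (UNIV \<times> vH p) (wsys \<Omega>)"
      unfolding L2_closed_span_def
    proof (intro CollectI conjI allI impI ind)
      fix \<epsilon> :: real assume "\<epsilon> > 0"
      moreover have "?t \<in> L2_closed_span L (UNIV \<times> vH p) (wfam \<Omega>)"
        by (rule subsetD[OF wfam_complete t(1)])
      ultimately obtain F a where F: "finite F" "F \<subseteq> UNIV \<times> vH p"
        and less: "L2norm L (\<lambda>w. ?t w - (\<Sum>i\<in>F. a i * wfam \<Omega> i w)) < \<epsilon>"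
        unfolding L2_closed_span_def by blast
      have FG: "snd i \<in> G" if "i \<in> F" for i using F(2) that by (auto simp: vH_in)
      have "L2norm L (\<lambda>y. indicator (vcoset p x l) y - (\<Sum>i\<in>F. a i * wsys \<Omega> i y)) = L2norm L (\<lambda>y. inv_fourier p ?t y - (\<Sum>i\<in>F. a i * wsys \<Omega> i y))"
        by (rule L2norm_cong) (simp only: Ft space_L)
      also have "\<dots> = L2norm L (\<lambda>w. ?t w - (\<Sum>i\<in>F. a i * wfam \<Omega> i w))"
        by (rule L2norm_wsys_lincomb[OF \<Omega> t F(1)]) (rule FG)
      also note less
      finally show "\<exists>F c. finite F \<and> F \<subseteq> UNIV \<times> vH p \<and> L2norm L (\<lambda>y. indicator (vcoset p x l) y - (\<Sum>i\<in>F. c i * wsys \<Omega> i y)) < \<epsilon>"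
        using F by (intro exI[of _ F] exI[of _ a] conjI)
    qed
  qed
qed

end
end

theorem wavelet_set_iff:
  assumes "\<Omega> \<in> sets L" "emeasure L \<Omega> < \<infinity>"
  shows "wavelet_set p \<Omega> \<longleftrightarrow> (AE w in L. veta p \<Omega> w = 1) \<and>
    (\<forall>j. j \<noteq> 0 \<longrightarrow> (AE w in L. \<not> (w \<in> \<Omega> \<and> vshift (- j) w \<in> \<Omega>))) \<and>
    (AE w in L. \<exists>j. vshift (- j) w \<in> \<Omega>)"
proof -
  have "inv_fourier p (indicator \<Omega>) \<in> L2fun L"
    using inv_fourier_isometry(1) ind_\<Omega>_L2[OF assms] ind_\<Omega>_integrable[OF assms] by blast
  hence "wavelet_set p \<Omega> \<longleftrightarrow> L2_orthonormal_basis L (UNIV \<times> vH p) (wsys \<Omega>)"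
    using assms by (simp add: wavelet_set_def wavelet_def wsys_def)
  thus ?thesis using wsys_onb_imp[OF assms] wsys_onb[OF assms] by blast
qed

end

section \<open>Generalized scaling sets\<close>

context vilenkin_group
begin

lemma vdigit_in: "s \<in> {0..<int p} \<Longrightarrow> vdigit s \<in> G"
  using p_gr_0 by (auto simp: vilenkin_def vdigit_def intro!: exI[of _ 1])

text \<open>The elements of 0.\<sigma> \<oplus> H carry \<sigma> at index 1 and nothing beyond, and
  B moves index 1 to index 0, the last index allowed in H.\<close>

lemma bij_betw_vH_digit:
  assumes s: "s \<in> {0..<int p}"
  shows "bij_betw (\<lambda>h. vshift 1 (vadd p (vdigit s) h)) (vH p) {k \<in> vH p. k 0 = s}"
proof (rule bij_betw_byWitness[where f' = "\<lambda>k. vadd p (vneg p (vdigit s)) (vshift (-1) k)"])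
  note d = vdigit_in[OF s]
  show "\<forall>h\<in>vH p. vadd p (vneg p (vdigit s)) (vshift (-1) (vshift 1 (vadd p (vdigit s) h))) = h"
    using vshift_inv(2)[of 1] by (auto simp: vadd_vneg_cancel vH_in)
  show "\<forall>k\<in>{k \<in> vH p. k 0 = s}. vshift 1 (vadd p (vdigit s) (vadd p (vneg p (vdigit s)) (vshift (-1) k))) = k"
    using vshift_inv(1)[of 1] by (auto simp: vadd_vneg_cancel vH_in vshift_in)
  show "(\<lambda>h. vshift 1 (vadd p (vdigit s) h)) ` vH p \<subseteq> {k \<in> vH p. k 0 = s}"
  proof safe
    fix h assume h: "h \<in> vH p"
    show "vshift 1 (vadd p (vdigit s) h) \<in> vH p"
      using h d p_gr_0 by (auto simp: vH_def vshift_in vadd_in) (auto simp: vshift_def vadd_def vdigit_def)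
    show "vshift 1 (vadd p (vdigit s) h) 0 = s"
      using h s by (auto simp: vH_def vshift_def vadd_def vdigit_def)
  qed
  show "(\<lambda>k. vadd p (vneg p (vdigit s)) (vshift (-1) k)) ` {k \<in> vH p. k 0 = s} \<subseteq> vH p"
  proof safe
    fix k assume k: "k \<in> vH p" "s = k 0"
    have "vadd p (vneg p (vdigit (k 0))) (vshift (-1) k) j = 0" if "j > 0" for j
      using k that by (cases "j = 1") (auto simp: vH_def vshift_def vadd_def vneg_def vsub_def vdigit_def mod_simps)
    thus "vadd p (vneg p (vdigit (k 0))) (vshift (-1) k) \<in> vH p"
      using k d p_gr_0 by (auto simp: vH_def vshift_in vadd_in vneg_in)
  qed
qed

lemma veta_vshift:
  assumes w: "w \<in> G"
  shows "veta p (vshift 1 ` S) (vshift 1 w) = (\<Sum>s\<in>{0..<int p}. veta p S (vadd p w (vdigit s)))"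
proof -
  let ?f = "\<lambda>k. indicator (vshift 1 ` S) (vadd p (vshift 1 w) k) :: ennreal"
  \<comment> \<open>The terms are sorted by the digit of k at index 0, the only digit that the
    inverse of B pushes out of H.\<close>
  have "veta p (vshift 1 ` S) (vshift 1 w) = (\<integral>\<^sup>+k. (\<Sum>s\<in>{0..<int p}. ?f k * indicator {k. k 0 = s} k) \<partial>count_space (vH p))"
    unfolding veta_eq
  proof (rule nn_integral_cong)
    fix k assume "k \<in> space (count_space (vH p))"
    hence "k 0 \<in> {0..<int p}" by (auto simp: vH_def vilenkin_def)
    moreover have "(\<Sum>s\<in>{0..<int p}. ?f k * indicator {k. k 0 = s} k) = (\<Sum>s\<in>{0..<int p}. if s = k 0 then ?f k else 0)"
      by (intro sum.cong) (auto simp: indicator_def)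
    ultimately show "?f k = (\<Sum>s\<in>{0..<int p}. ?f k * indicator {k. k 0 = s} k)" by simp
  qed
  also have "\<dots> = (\<Sum>s\<in>{0..<int p}. \<integral>\<^sup>+k. ?f k * indicator {k. k 0 = s} k \<partial>count_space (vH p))"
    by (intro nn_integral_sum) auto
  also have "\<dots> = (\<Sum>s\<in>{0..<int p}. veta p S (vadd p w (vdigit s)))"
  proof (rule sum.cong)
    fix s assume s: "s \<in> {0..<int p}"
    have "(\<integral>\<^sup>+k. ?f k * indicator {k. k 0 = s} k \<partial>count_space (vH p)) = (\<integral>\<^sup>+k. ?f k \<partial>count_space {k \<in> vH p. k 0 = s})"
      by (auto simp: nn_integral_count_space_indicator indicator_def intro!: nn_integral_cong)
    also have "\<dots> = (\<integral>\<^sup>+h. ?f (vshift 1 (vadd p (vdigit s) h)) \<partial>count_space (vH p))"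
      by (rule nn_integral_bij_count_space[OF bij_betw_vH_digit[OF s], symmetric])
    also have "\<dots> = veta p S (vadd p w (vdigit s))"
    proof -
      have "?f (vshift 1 (vadd p (vdigit s) h)) = indicator S (vadd p (vadd p w (vdigit s)) h)" for h
        using inj_image_mem_iff[OF inj_vshift, of 1 "vadd p w (vadd p (vdigit s) h)" S]
        by (simp add: vshift_vadd[symmetric] vadd_assoc indicator_def)
      thus ?thesis by (simp add: veta_eq)
    qed
    finally show "(\<integral>\<^sup>+k. ?f k * indicator {k. k 0 = s} k \<partial>count_space (vH p)) = veta p S (vadd p w (vdigit s))" .
  qed simp
  finally show ?thesis .
qed

section \<open>Consequences of the measure of S\<close>

context
  fixes S :: "(int \<Rightarrow> int) set"
  assumes S: "S \<in> sets L" and \<mu>S: "emeasure L S = ennreal (1 / (real p - 1))"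
begin

lemma BS_sets: "vshift 1 ` S \<in> sets L"
  using vshift_scale[OF S] by blast

lemma emeasure_BS: "emeasure L (vshift 1 ` S) = ennreal (1 / (real p - 1) + 1)"
proof -
  have "emeasure L (vshift 1 ` S) = ennreal (real p) * ennreal (1 / (real p - 1))"
    using vshift_scale[OF S, of 1] p_gr_0 by (simp add: \<mu>S)
  also have "\<dots> = ennreal (real p * (1 / (real p - 1)))"
    using p_gr_1 by (intro ennreal_mult[symmetric]) auto
  also have "real p * (1 / (real p - 1)) = 1 / (real p - 1) + 1"
    using p_gr_1 by (simp add: field_simps)
  finally show ?thesis .
qed

lemma diff_finite: "emeasure L (vshift 1 ` S - S) < \<infinity>"
proof -
  have "emeasure L (vshift 1 ` S - S) \<le> emeasure L (vshift 1 ` S)"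
    using BS_sets by (intro emeasure_mono) auto
  thus ?thesis unfolding emeasure_BS by (simp add: le_less_trans)
qed

lemma diff_sets: "vshift 1 ` S - S \<in> sets L"
  using BS_sets S by (rule sets.Diff)

lemma tile_imp_subset:
  assumes T: "AE w in L. veta p (vshift 1 ` S - S) w = 1"
  shows "S - vshift 1 ` S \<in> null_sets L"
proof -
  let ?B = "vshift 1 ` S" and ?\<Omega> = "vshift 1 ` S - S"
  \<comment> \<open>With E the whole group, \<open>emeasure_veta\<close> evaluates the measure of a
    tile as that of U.\<close>
  have "emeasure L ?\<Omega> = emeasure L (?\<Omega> \<inter> vfrac -` G)"
  proof -
    have "?\<Omega> \<inter> vfrac -` G = ?\<Omega>"
      using sets.sets_into_space[OF diff_sets] vfrac_in[OF p_gr_0] vnbhd_in by fastforce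
    thus ?thesis by simp
  qed
  also have "\<dots> = (\<integral>\<^sup>+w. veta p ?\<Omega> w * indicator (vnbhd p 0) w * indicator G w \<partial>L)"
    using sets.top[of L] by (intro emeasure_veta[OF diff_sets diff_finite]) simp
  also have "\<dots> = (\<integral>\<^sup>+w. indicator (vnbhd p 0) w \<partial>L)"
    by (rule nn_integral_cong_AE, use T AE_space in eventually_elim) auto
  also have "\<dots> = 1" using p_gr_0 by (simp add: emeasure_vnbhd vnbhd_sets)
  finally have m\<Omega>: "measure L ?\<Omega> = 1" by (simp add: measure_def)
  have finB: "emeasure L ?B \<noteq> \<infinity>" and finS: "emeasure L S \<noteq> \<infinity>" by (simp_all add: emeasure_BS \<mu>S)
  have fin: "emeasure L (X \<inter> Y) \<noteq> \<infinity>" "emeasure L (X - Y) \<noteq> \<infinity>"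
    if "X \<in> sets L" "emeasure L X \<noteq> \<infinity>" for X Y
    using emeasure_mono[of "X \<inter> Y" X L] emeasure_mono[of "X - Y" X L] that by (auto simp: top_unique)
  have split: "measure L X = measure L (X - Y) + measure L (X \<inter> Y)"
    if "X \<in> sets L" "Y \<in> sets L" "emeasure L X \<noteq> \<infinity>" for X Y
  proof -
    have "X = (X - Y) \<union> (X \<inter> Y)" by auto
    thus ?thesis using measure_Union[of L "X - Y" "X \<inter> Y"] fin[OF that(1,3)] that by auto
  qed
  have mS: "measure L S = 1 / (real p - 1)" and mB: "measure L ?B = 1 / (real p - 1) + 1"
    using p_gr_1 by (simp_all add: measure_def \<mu>S emeasure_BS del: ennreal_plus)
  \<comment> \<open>Both differences miss the same intersection, so their measures differ by
    \<mu>(BS) - \<mu>(S) = 1, which \<open>?\<Omega>\<close> already uses up.\<close>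
  have "measure L (S - ?B) = 0"
    using split[OF BS_sets S finB] split[OF S BS_sets finS] m\<Omega> mS mB by (simp add: Int_commute)
  thus ?thesis using fin(2)[OF S finS, of ?B] S BS_sets
    by (auto simp: measure_def enn2real_eq_0_iff null_sets_def)
qed

lemma vshift_mem_BS_iff: "vshift (- j) w \<in> vshift 1 ` S \<longleftrightarrow> vshift (- (j + 1)) w \<in> S"
proof -
  have "- 1 + - j = - (j + 1)" by simp
  thus ?thesis by (simp only: vshift_image_iff vshift_vshift)
qed

lemma mem_BS_iff: "w \<in> vshift 1 ` S \<longleftrightarrow> vshift (- 1) w \<in> S"
  by (rule vshift_image_iff)

section \<open>The increasing chain of dilates of S\<close>

context
  assumes sub: "S - vshift 1 ` S \<in> null_sets L"
begin

text \<open>The inclusion of S in BS is dilated by all powers of B and iterated. Only countably many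
  null sets arise, so one exceptional set serves all k and l.\<close>

lemma AE_S_chain: "AE w in L. \<forall>k l. k \<le> l \<longrightarrow> vshift (- k) w \<in> S \<longrightarrow> vshift (- l) w \<in> S"
proof -
  have "AE w in L. w \<in> S \<longrightarrow> vshift (-1) w \<in> S"
    using AE_not_in[OF sub] by eventually_elim (auto simp: mem_BS_iff)
  hence "AE w in L. vshift (- k) w \<in> S \<longrightarrow> vshift (- k) w \<in> vshift 1 ` S" for k
    unfolding mem_BS_iff by (rule AE_vshift)
  hence "AE w in L. \<forall>k. vshift (- k) w \<in> S \<longrightarrow> vshift (- (k + 1)) w \<in> S"
    unfolding AE_all_countable vshift_mem_BS_iff by blast
  thus ?thesis
  proof eventually_elim
    case (elim w)
    show ?case
    proof (intro allI impI)
      fix k l :: int assume "k \<le> l" "vshift (- k) w \<in> S"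
      thus "vshift (- l) w \<in> S"
        by (induction l rule: int_ge_induct) (use elim in auto)
    qed
  qed
qed

text \<open>Off a null set 1_BS = 1_S + 1_{BS - S}. The identity is summed over w \<oplus> H, so the
  null set must be avoided at all these points at once, which countability of H permits.\<close>

lemma AE_veta_split: "AE w in L. veta p (vshift 1 ` S) w = veta p S w + veta p (vshift 1 ` S - S) w"
proof -
  have "AE w in L. \<forall>h\<in>vH p. vadd p h w \<notin> S - vshift 1 ` S"
    using AE_vadd[OF vH_in AE_not_in[OF sub]] by (simp add: AE_ball_countable countable_vH)
  thus ?thesis
  proof eventually_elim
    case (elim w)
    have "veta p (vshift 1 ` S) w = (\<integral>\<^sup>+h. indicator S (vadd p w h) + indicator (vshift 1 ` S - S) (vadd p w h) \<partial>count_space (vH p))"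
      unfolding veta_eq
    proof (rule nn_integral_cong)
      fix h assume "h \<in> space (count_space (vH p))"
      hence "vadd p w h \<notin> S - vshift 1 ` S" using elim by (simp add: vadd_comm)
      thus "indicator (vshift 1 ` S) (vadd p w h) = (indicator S (vadd p w h) + indicator (vshift 1 ` S - S) (vadd p w h) :: ennreal)"
        by (auto split: split_indicator)
    qed
    also have "\<dots> = veta p S w + veta p (vshift 1 ` S - S) w"
      unfolding veta_eq by (intro nn_integral_add) auto
    finally show ?case .
  qed
qed

lemma AE_digit_sum:
  "AE w in L. (\<Sum>s\<in>{0..<int p}. veta p S (vadd p w (vdigit s))) = veta p S (vshift 1 w) + veta p (vshift 1 ` S - S) (vshift 1 w)"
  using AE_vshift[OF AE_veta_split, of 1] AE_space
  by eventually_elim (simp add: veta_vshift)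

text \<open>Over U the function \<eta> integrates to the measure of S, which is finite.\<close>

lemma AE_veta_finite: "AE w in L. veta p S w \<noteq> \<infinity>"
proof (rule AE_periodic)
  have finS: "emeasure L S < \<infinity>" by (simp add: \<mu>S)
  have "(\<integral>\<^sup>+w. veta p S w * indicator (vnbhd p 0) w \<partial>L) = (\<integral>\<^sup>+w. veta p S w * indicator (vnbhd p 0) w * indicator G w \<partial>L)"
    by (intro nn_integral_cong) simp
  also have "\<dots> = emeasure L (S \<inter> vfrac -` G)"
    using sets.top[of L] by (intro emeasure_veta[OF S finS, symmetric]) simp
  also have "\<dots> \<le> emeasure L S" using S by (intro emeasure_mono) auto
  also have "\<dots> < \<infinity>" by (rule finS)
  finally have "AE w in L. veta p S w * indicator (vnbhd p 0) w \<noteq> \<infinity>"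
    using measurable_veta[OF S finS] by (intro nn_integral_PInf_AE) auto
  thus "AE w in L. w \<in> vnbhd p 0 \<longrightarrow> veta p S w \<noteq> \<infinity>"
    by eventually_elim auto
qed (simp add: veta_periodic)

text \<open>The sets B^{-k}S have measures tending to 0, so their intersection is null. This
  excludes points all of whose dilates stay in S, for which no crossing into S would exist.\<close>

lemma AE_exits_S: "AE w in L. \<exists>k. vshift (- k) w \<notin> S"
proof -
  let ?N = "\<Inter>k\<in>(UNIV :: nat set). vshift (- int k) ` S"
  have m: "vshift (- int k) ` S \<in> sets L" "emeasure L (vshift (- int k) ` S) = ennreal (real p powr (- int k)) * emeasure L S" for k
    using vshift_scale[OF S, of "- int k"] by auto
  have N: "?N \<in> sets L" using m(1) by (intro sets.countable_INT) auto
  have le: "emeasure L ?N \<le> ennreal ((1 / real p) ^ k)" for k :: nat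
  proof -
    have "emeasure L ?N \<le> emeasure L (vshift (- int k) ` S)" by (rule emeasure_mono[OF _ m(1)]) auto
    also have "\<dots> = ennreal (real p powr (- int k) * (1 / (real p - 1)))"
      using p_gr_1 by (simp add: m(2) \<mu>S ennreal_mult[symmetric])
    also have "\<dots> \<le> ennreal (real p powr (- int k) * 1)"
      using p_gr_1 by (intro ennreal_leI mult_left_mono) (auto simp: field_simps)
    also have "real p powr (- int k) * 1 = (1 / real p) ^ k"
      using p_gr_0 by (simp add: powr_minus powr_realpow power_one_over field_simps)
    finally show ?thesis .
  qed
  have "(\<lambda>k. ennreal ((1 / real p) ^ k)) \<longlonglongrightarrow> ennreal 0"
    using p_gr_1 by (intro tendsto_ennrealI LIMSEQ_power_zero) simp
  from LIMSEQ_le_const[OF this, of "emeasure L ?N"] le have "emeasure L ?N = 0" by auto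
  hence "?N \<in> null_sets L" using N by (auto simp: null_sets_def)
  from AE_not_in[OF this] show ?thesis
  proof eventually_elim
    case (elim w)
    then obtain k :: nat where "vshift (int k) w \<notin> S" by (auto simp: vshift_image_iff)
    thus ?case by (intro exI[of _ "- int k"]) simp
  qed
qed

text \<open>Along the chain membership in S can switch on only once, and lying in B^j(BS - S) means
  that it switches on between j and j + 1.\<close>

lemma dilates_tile:
  assumes "j \<noteq> 0"
  shows "AE w in L. \<not> (w \<in> vshift 1 ` S - S \<and> vshift (- j) w \<in> vshift 1 ` S - S)"
  using AE_S_chain
proof eventually_elim
  case (elim w)
  show ?case
  proof
    assume a: "w \<in> vshift 1 ` S - S \<and> vshift (- j) w \<in> vshift 1 ` S - S"
    hence 1: "vshift (-1) w \<in> S" "vshift (- 0) w \<notin> S" "vshift (- (j + 1)) w \<in> S" "vshift (- j) w \<notin> S"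
      using vshift_mem_BS_iff[of j w] mem_BS_iff[of w] by auto
    have "1 \<le> j \<or> j + 1 \<le> 0" using assms by linarith
    thus False using elim 1 by blast
  qed
qed

text \<open>For almost every w the 0-1 sequence 1_S(B^{-k}w), k an integer, is nondecreasing and
  takes the value 0. It has limit 1 exactly when it jumps, and a jump is membership in some dilate
  of BS - S.\<close>

lemma dilates_cover_iff:
  "(AE w in L. \<exists>j. vshift (- j) w \<in> vshift 1 ` S - S) \<longleftrightarrow>
   (AE w in L. (\<lambda>k. indicator S (vshift (- int k) w) :: real) \<longlonglongrightarrow> 1)"
proof
  assume "AE w in L. \<exists>j. vshift (- j) w \<in> vshift 1 ` S - S"
  thus "AE w in L. (\<lambda>k. indicator S (vshift (- int k) w) :: real) \<longlonglongrightarrow> 1"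
    using AE_S_chain
  proof eventually_elim
    case (elim w)
    then obtain j where j: "vshift (- (j + 1)) w \<in> S" using vshift_mem_BS_iff by blast
    have "eventually (\<lambda>k. 1 = (indicator S (vshift (- int k) w) :: real)) sequentially"
    proof (rule eventually_sequentiallyI[of "nat (j + 1)"])
      fix k assume "nat (j + 1) \<le> k"
      hence "j + 1 \<le> int k" by linarith
      hence "vshift (- int k) w \<in> S" using elim(2) j by blast
      thus "1 = (indicator S (vshift (- int k) w) :: real)" by simp
    qed
    thus ?case by (rule Lim_transform_eventually[OF tendsto_const])
  qed
next
  assume "AE w in L. (\<lambda>k. indicator S (vshift (- int k) w) :: real) \<longlonglongrightarrow> 1"
  thus "AE w in L. \<exists>j. vshift (- j) w \<in> vshift 1 ` S - S"
    using AE_S_chain AE_exits_S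
  proof eventually_elim
    case (elim w)
    have "eventually (\<lambda>k. indicator S (vshift (- int k) w) > (0 :: real)) sequentially"
      by (rule order_tendstoD(1)[OF elim(1)]) simp
    then obtain n :: nat where n: "vshift (- int n) w \<in> S"
      by (auto simp: eventually_sequentially indicator_def split: if_splits)
    obtain k where k: "vshift (- k) w \<notin> S" using elim(3) by blast
    show ?case
    proof (rule ccontr)
      assume "\<not> ?case"
      \<comment> \<open>Without a jump the value 0 at k persists upwards, contradicting the value 1
        at n; if instead n \<le> k, the chain puts the point in S at k.\<close>
      hence step: "vshift (- (l + 1)) w \<notin> S" if "vshift (- l) w \<notin> S" for l
        using that vshift_mem_BS_iff[of l w] by blast
      have "vshift (- l) w \<notin> S" if "k \<le> l" for l
        using that by (induction l rule: int_ge_induct) (use k step in auto)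
      moreover have "vshift (- k) w \<in> S" if "int n \<le> k" using elim(2) n that by blast
      ultimately show False using n k by (metis linorder_le_cases)
    qed
  qed
qed

text \<open>The digit sum counts S and the difference set over Bw, so (iv) is the tiling identity at
  Bw. Finiteness of \<eta> allows it to be cancelled, and B preserves null sets in both
  directions.\<close>

lemma tile_iff_digit_sum:
  "(AE w in L. veta p (vshift 1 ` S - S) w = 1) \<longleftrightarrow>
   (AE w in L. (\<Sum>s\<in>{0..<int p}. veta p S (vadd p w (vdigit s))) = veta p S (vshift 1 w) + 1)"
proof
  assume "AE w in L. veta p (vshift 1 ` S - S) w = 1"
  from AE_vshift[OF this, of 1] AE_digit_sum
  show "AE w in L. (\<Sum>s\<in>{0..<int p}. veta p S (vadd p w (vdigit s))) = veta p S (vshift 1 w) + 1"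
    by eventually_elim simp
next
  assume "AE w in L. (\<Sum>s\<in>{0..<int p}. veta p S (vadd p w (vdigit s))) = veta p S (vshift 1 w) + 1"
  with AE_digit_sum AE_vshift[OF AE_veta_finite, of 1]
  have "AE w in L. veta p (vshift 1 ` S - S) (vshift 1 w) = 1"
    by eventually_elim (simp add: ennreal_add_left_cancel)
  from AE_vshift[OF this, of "-1"] show "AE w in L. veta p (vshift 1 ` S - S) w = 1"
    using vshift_inv(1)[of 1] by simp
qed

end

text \<open>Of the three conditions in \<open>wavelet_set_iff\<close>, the translation tiling yields
  the inclusion of S in BS; the inclusion in turn supplies disjointness of the dilates and turns the
  other two into (iii) and (iv).\<close>

lemma wavelet_set_diff_iff:
  "wavelet_set p (vshift 1 ` S - S) \<longleftrightarrow> S - vshift 1 ` S \<in> null_sets L \<and>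
    (AE w in L. (\<lambda>k. indicator S (vshift (- int k) w) :: real) \<longlonglongrightarrow> 1) \<and>
    (AE w in L. (\<Sum>s\<in>{0..<int p}. veta p S (vadd p w (vdigit s))) = veta p S (vshift 1 w) + 1)"
  using wavelet_set_iff[OF diff_sets diff_finite] tile_imp_subset tile_iff_digit_sum dilates_cover_iff dilates_tile
  by blast

end
end

theorem theorem4p6:
  fixes p :: nat and S :: "(int \<Rightarrow> int) set"
  assumes "prime p" and "S \<in> sets (vhaar p)"
  shows "generalized_scaling_set p S \<longleftrightarrow>
    emeasure (vhaar p) S = ennreal (1 / (real p - 1)) \<and>
    S - vshift 1 ` S \<in> null_sets (vhaar p) \<and>
    (AE w in vhaar p. (\<lambda>k. indicator S (vshift (- int k) w) :: real) \<longlonglongrightarrow> 1) \<and>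
    (AE w in vhaar p.
       (\<Sum>s\<in>{0..<int p}. veta p S (vadd p w (vdigit s))) = veta p S (vshift 1 w) + 1)"
proof -
  interpret vilenkin_group p by standard (rule assms(1))
  show ?thesis
    unfolding generalized_scaling_set_def using wavelet_set_diff_iff[OF assms(2)] assms(2) by blast
qed

end
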